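(* Let $N$ be an $n$-dimensional Riemannian spin manifold carrying a $\beta$-Killing spinor $\psi$ for some $\beta\in\mathbb{C}$, and let $\pi:M\to N$ be a Riemannian submersion which is either an $\mathbb{S}^1$-bundle with totally geodesic fibres over $N$, or the second projection of the Riemannian product $M:=\mathbb{R}\times N$ onto $N$. Let $M$ be endowed with the spin structure induced by that of $N$ and the trivial spin structure on $\mathbb{S}^1$ or $\mathbb{R}$ respectively. Then: (i) The spinor $\psi$ on $N$ induces a $(0,\beta)$-transversal Killing spinor on $M$. (ii) In the second case ($M=\mathbb{R}\times N$), if moreover $\beta=0$, then $\psi$ induces an $(\alpha,0)$-transversal Killing spinor on $M$ for any $\alpha\in\mathbb{C}$. Furthermore, if $\psi\neq0$ and $\alpha\in\mathbb{R}$, this induced spinor field descends to the Riemannian product $\mathbb{S}^1\times N$, where $\mathbb{S}^1$ is a circle of length $L>0$ carrying the $\delta$-spin structure ($\delta\in\{0,1\}$), if and only if $\alpha\in\frac{\pi\delta}{L}+\frac{2\pi\mathbb{Z}}{L}$.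
   Context: A $\beta$-Killing spinor on a Riemannian spin manifold $N$ is a section $\psi$ of $\Sigma N$ with $\nabla^N_X\psi=\beta X\cdot_N\psi$ for all $X\in\Gamma(TN)$. Riemannian flows: a Riemannian flow $(M^{n+1},g,\mathcal{F})$ is given by a smooth unit vector field $\xi$ with $(\mathcal{L}_\xi g)(Z,W)=0$ for all $Z,W\perp\xi$. Put $Q=\xi^\perp$, $h(Z)=\nabla^M_Z\xi$ for $Z\in Q$, $\kappa=\nabla^M_\xi\xi$, $\Omega(Z,W)=g(h(Z),W)$ on $Q$ extended by $\Omega(\xi,\cdot)=0$. If $M$ is spin with spinor bundle $\Sigma M$ and Clifford multiplication "$\cdot$" ($X\cdot X=-|X|^2$; $e_i\wedge e_j$ acts as $e_i\cdot e_j\cdot$), the transversal connection $\nabla$ on $\Sigma M$ is $\nabla_\xi\varphi=\nabla^M_\xi\varphi-\frac12\Omega\cdot\varphi-\frac12\xi\cdot\kappa\cdot\varphi$, $\nabla_Z\varphi=\nabla^M_Z\varphi-\frac12\xi\cdot h(Z)\cdot\varphi$ for $Z\in\Gamma(Q)$. An $(\alpha,\beta)$-transversal Killing spinor is a section $\psi$ of $\Sigma M$ with $\nabla_\xi\psi=\alpha\,\xi\cdot\psi$ and $\nabla_Z\psi=\beta\,\xi\cdot Z\cdot\psi$ for all $Z\in\Gamma(Q)$. In the present situation $\xi$ is the unit vector field tangent to the fibres given by the $\mathbb{S}^1$-action, respectively $\xi=\frac{\partial}{\partial t}$ on $\mathbb{R}\times N$. Then $Q\cong\pi^*TN$; the spin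 structure of $N$ pulls back to one on $Q$ and hence gives one on $TM=\mathbb{R}\xi\oplus Q$ (this is the induced spin structure), with $\Sigma Q\cong\pi^*\Sigma N$. There is a unitary identification $\Sigma M=\Sigma Q$ if $n$ is even and $\Sigma M=\Sigma Q\oplus\Sigma Q$ if $n$ is odd, with $\xi\cdot Z\cdot=Z\cdot_Q$ for $n$ even and $\xi\cdot Z\cdot=Z\cdot_Q\oplus(-Z\cdot_Q)$ for $n$ odd, $Z\in Q$; moreover $i\xi\cdot=\mathrm{Id}_{\Sigma^+Q}\oplus(-\mathrm{Id}_{\Sigma^-Q})$ for $n$ even, while for $n$ odd $i\xi\cdot$ exchanges the two copies of $\Sigma Q$ by the identity. "Induces": in (i) the induced spinor is $\psi\circ\pi\in\Gamma(\pi^*\Sigma N)$, viewed in $\Sigma M$ (in the first copy of $\Sigma Q$ if $n$ is odd). In (ii) the induced spinor is $e^{-i\alpha t}\psi_++e^{i\alpha t}\psi_-$ if $n$ is even, where $\psi=\psi_++\psi_-$ with $i\xi\cdot\psi_\pm=\pm\psi_\pm$, and $e^{-i\alpha t}(\psi\oplus\psi)$ if $n$ is odd. The circle carries two spin structures: the trivial one ($\delta=0$), whose spinors are periodic functions on $\mathbb{R}$, and the non-trivial one ($\delta=1$), whose spinors are antiperiodic. A spinor field $\phi$ on $\mathbb{R}\times N$ descends to $\mathbb{S}^1\times N$ (circle of length $L$, $\delta$-spin structure) iff $\phi_{(t,x)}=e^{i\pi\delta}\phi_{(t-L,x)}$ for all $(t,x)$. *)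

theory Defs
  imports "HOL-Analysis.Derivative" "Jordan_Normal_Form.Schur_Decomposition"
begin

section \<open>Smooth manifolds\<close>

fun Ck_on :: "nat \<Rightarrow> ('e::real_normed_vector \<Rightarrow> 'f::real_normed_vector) \<Rightarrow> 'e set \<Rightarrow> bool" where
  "Ck_on 0 f S \<longleftrightarrow> continuous_on S f"
| "Ck_on (Suc k) f S \<longleftrightarrow> (\<forall>x\<in>S. f differentiable (at x)) \<and>
     (\<forall>v. Ck_on k (\<lambda>x. frechet_derivative f (at x) v) S)"

text \<open>Only used for open \<open>S\<close> in a Euclidean space, where it is the usual notion of
  a \<open>C\<close>-infinity map.\<close>

definition smooth_on :: "('e::euclidean_space \<Rightarrow> 'f::real_normed_vector) \<Rightarrow> 'e set \<Rightarrow> bool" where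
  "smooth_on f S \<longleftrightarrow> (\<forall>k. Ck_on k f S)"

text \<open>The points of a manifold form a whole type (Hausdorff and second countable by its type
  classes); the charts take values in a Euclidean space \<open>'e\<close>, so the dimension is
  \<open>DIM('e)\<close>.\<close>

type_synonym ('a, 'e) atlas = "('a set \<times> ('a \<Rightarrow> 'e)) set"

definition smooth_atlas :: "('a::{t2_space,second_countable_topology}, 'e::euclidean_space) atlas \<Rightarrow> bool" where
  "smooth_atlas A \<longleftrightarrow>
     (\<forall>(U,c)\<in>A. open U \<and> open (c ` U) \<and> homeomorphism U (c ` U) c (inv_into U c)) \<and>
     (\<Union>(U,c)\<in>A. U) = UNIV \<and>
     (\<forall>(U,c)\<in>A. \<forall>(V,d)\<in>A. smooth_on (d \<circ> inv_into U c) (c ` (U \<inter> V)))"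

definition smooth_fun :: "('a::topological_space, 'e::euclidean_space) atlas \<Rightarrow> 'a set \<Rightarrow> ('a \<Rightarrow> real) \<Rightarrow> bool" where
  "smooth_fun A U f \<longleftrightarrow> open U \<and> (\<forall>(V,c)\<in>A. smooth_on (f \<circ> inv_into V c) (c ` (U \<inter> V)))"

definition smooth_cfun :: "('a::topological_space, 'e::euclidean_space) atlas \<Rightarrow> 'a set \<Rightarrow> ('a \<Rightarrow> complex) \<Rightarrow> bool" where
  "smooth_cfun A U f \<longleftrightarrow> smooth_fun A U (\<lambda>p. Re (f p)) \<and> smooth_fun A U (\<lambda>p. Im (f p))"

definition germs :: "('a::topological_space, 'e::euclidean_space) atlas \<Rightarrow> 'a \<Rightarrow> ('a \<Rightarrow> real) set" where
  "germs A p = {f. \<exists>U. p \<in> U \<and> smooth_fun A U f}"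

definition smooth_map_on ::
  "('a::topological_space, 'e::euclidean_space) atlas \<Rightarrow> 'a set \<Rightarrow>
   ('b::topological_space, 'f::euclidean_space) atlas \<Rightarrow> ('a \<Rightarrow> 'b) \<Rightarrow> bool" where
  "smooth_map_on A U B F \<longleftrightarrow> open U \<and> continuous_on U F \<and>
     (\<forall>V f. smooth_fun B V f \<longrightarrow> smooth_fun A (U \<inter> F -` V) (f \<circ> F))"

definition line_times :: "('a, 'e) atlas \<Rightarrow> (real \<times> 'a, real \<times> 'e) atlas" where
  "line_times A = {(UNIV \<times> U, map_prod id c) | U c. (U, c) \<in> A}"

text \<open>Tangent vectors are derivations of germs of smooth functions. A germ is represented by
  any function that is smooth near \<open>p\<close>; that the value depends on the germ only follows from
  the Leibniz rule, applied with indicator functions of neighbourhoods of \<open>p\<close>. Outside the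
  functions that are smooth near \<open>p\<close> the value is fixed to be 0, which makes equality of
  tangent vectors literal equality.\<close>

type_synonym 'a tvec = "('a \<Rightarrow> real) \<Rightarrow> real"
type_synonym 'a vfield = "'a \<Rightarrow> 'a tvec"

definition tangent :: "('a::topological_space, 'e::euclidean_space) atlas \<Rightarrow> 'a \<Rightarrow> 'a tvec set" where
  "tangent A p = {v.
     (\<forall>f. f \<notin> germs A p \<longrightarrow> v f = 0) \<and>
     (\<forall>f\<in>germs A p. \<forall>g\<in>germs A p. \<forall>a b. v (\<lambda>q. a * f q + b * g q) = a * v f + b * v g) \<and>
     (\<forall>f\<in>germs A p. \<forall>g\<in>germs A p. v (\<lambda>q. f q * g q) = v f * g p + f p * v g)}"

definition smooth_vfield :: "('a::topological_space, 'e::euclidean_space) atlas \<Rightarrow> 'a set \<Rightarrow> 'a vfield \<Rightarrow> bool" where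
  "smooth_vfield A U X \<longleftrightarrow> open U \<and> (\<forall>p\<in>U. X p \<in> tangent A p) \<and>
     (\<forall>V f. V \<subseteq> U \<and> smooth_fun A V f \<longrightarrow> smooth_fun A V (\<lambda>p. X p f))"

definition smooth_vfield_near :: "('a::topological_space, 'e::euclidean_space) atlas \<Rightarrow> 'a \<Rightarrow> 'a vfield \<Rightarrow> bool" where
  "smooth_vfield_near A p X \<longleftrightarrow> (\<exists>U. p \<in> U \<and> smooth_vfield A U X)"

definition lie_bracket :: "('a::topological_space, 'e::euclidean_space) atlas \<Rightarrow> 'a vfield \<Rightarrow> 'a vfield \<Rightarrow> 'a vfield" where
  "lie_bracket A X Y p f =
     (if f \<in> germs A p then X p (\<lambda>q. Y q f) - Y p (\<lambda>q. X q f) else 0)"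

definition pushforward ::
  "('b::topological_space, 'f::euclidean_space) atlas \<Rightarrow> ('a \<Rightarrow> 'b) \<Rightarrow> 'a \<Rightarrow> 'a tvec \<Rightarrow> 'b tvec" where
  "pushforward B F p v f = (if f \<in> germs B (F p) then v (f \<circ> F) else 0)"


section \<open>Riemannian manifolds\<close>

definition riemannian_metric ::
  "('a::topological_space, 'e::euclidean_space) atlas \<Rightarrow> ('a \<Rightarrow> 'a tvec \<Rightarrow> 'a tvec \<Rightarrow> real) \<Rightarrow> bool" where
  "riemannian_metric A g \<longleftrightarrow>
     (\<forall>p. \<forall>u\<in>tangent A p. \<forall>v\<in>tangent A p. g p u v = g p v u) \<and>
     (\<forall>p. \<forall>u\<in>tangent A p. \<forall>v\<in>tangent A p. \<forall>w\<in>tangent A p. \<forall>a b.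
        g p (\<lambda>f. a * u f + b * v f) w = a * g p u w + b * g p v w) \<and>
     (\<forall>p. \<forall>v\<in>tangent A p. v \<noteq> (\<lambda>f. 0) \<longrightarrow> g p v v > 0) \<and>
     (\<forall>U X Y. smooth_vfield A U X \<and> smooth_vfield A U Y \<longrightarrow>
        smooth_fun A U (\<lambda>p. g p (X p) (Y p)))"

text \<open>\<open>D p v Y\<close> is the covariant derivative at \<open>p\<close>, in the direction \<open>v\<close>, of a vector field
  \<open>Y\<close> that is smooth near \<open>p\<close>.\<close>

type_synonym 'a connection = "'a \<Rightarrow> 'a tvec \<Rightarrow> 'a vfield \<Rightarrow> 'a tvec"

definition affine_connection :: "('a::topological_space, 'e::euclidean_space) atlas \<Rightarrow> 'a connection \<Rightarrow> bool" where
  "affine_connection A D \<longleftrightarrow>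
     (\<forall>p. \<forall>v\<in>tangent A p. \<forall>Y. smooth_vfield_near A p Y \<longrightarrow> D p v Y \<in> tangent A p) \<and>
     (\<forall>U X Y. smooth_vfield A U X \<and> smooth_vfield A U Y \<longrightarrow>
        smooth_vfield A U (\<lambda>p. D p (X p) Y)) \<and>
     (\<forall>p. \<forall>v\<in>tangent A p. \<forall>w\<in>tangent A p. \<forall>a b Y. smooth_vfield_near A p Y \<longrightarrow>
        D p (\<lambda>f. a * v f + b * w f) Y = (\<lambda>f. a * D p v Y f + b * D p w Y f)) \<and>
     (\<forall>p. \<forall>v\<in>tangent A p. \<forall>Y Z. smooth_vfield_near A p Y \<and> smooth_vfield_near A p Z \<longrightarrow>
        D p v (\<lambda>q f. Y q f + Z q f) = (\<lambda>f. D p v Y f + D p v Z f)) \<and>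
     (\<forall>p. \<forall>v\<in>tangent A p. \<forall>Y. \<forall>h\<in>germs A p. smooth_vfield_near A p Y \<longrightarrow>
        D p v (\<lambda>q f. h q * Y q f) = (\<lambda>f. v h * Y p f + h p * D p v Y f))"

definition levi_civita ::
  "('a::topological_space, 'e::euclidean_space) atlas \<Rightarrow> ('a \<Rightarrow> 'a tvec \<Rightarrow> 'a tvec \<Rightarrow> real) \<Rightarrow>
   'a connection \<Rightarrow> bool" where
  "levi_civita A g D \<longleftrightarrow> affine_connection A D \<and>
     (\<forall>p. \<forall>v\<in>tangent A p. \<forall>Y Z. smooth_vfield_near A p Y \<and> smooth_vfield_near A p Z \<longrightarrow>
        v (\<lambda>q. g q (Y q) (Z q)) = g p (D p v Y) (Z p) + g p (Y p) (D p v Z)) \<and>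
     (\<forall>p X Y. smooth_vfield_near A p X \<and> smooth_vfield_near A p Y \<longrightarrow>
        (\<lambda>f. D p (X p) Y f - D p (Y p) X f) = lie_bracket A X Y p)"

text \<open>A Riemannian manifold is carried around together with its (unique) Levi-Civita
  connection.\<close>

record ('a, 'e) riem =
  charts :: "('a, 'e) atlas"
  metric :: "'a \<Rightarrow> 'a tvec \<Rightarrow> 'a tvec \<Rightarrow> real"
  conn :: "'a connection"

abbreviation tspace :: "('a::topological_space, 'e::euclidean_space) riem \<Rightarrow> 'a \<Rightarrow> 'a tvec set" where
  "tspace M \<equiv> tangent (charts M)"

definition riemannian_manifold :: "('a::{t2_space,second_countable_topology}, 'e::euclidean_space) riem \<Rightarrow> bool" where
  "riemannian_manifold M \<longleftrightarrow> smooth_atlas (charts M) \<and> riemannian_metric (charts M) (metric M) \<and>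
     levi_civita (charts M) (metric M) (conn M)"

definition riemannian_submersion ::
  "('a::topological_space, 'e::euclidean_space) riem \<Rightarrow> ('b::topological_space, 'f::euclidean_space) riem \<Rightarrow>
   ('a \<Rightarrow> 'b) \<Rightarrow> bool" where
  "riemannian_submersion M N \<pi> \<longleftrightarrow>
     smooth_map_on (charts M) UNIV (charts N) \<pi> \<and>
     (\<forall>p. pushforward (charts N) \<pi> p ` tspace M p = tspace N (\<pi> p)) \<and>
     (\<forall>p. \<forall>v\<in>tspace M p. \<forall>w\<in>tspace M p.
        (\<forall>u\<in>tspace M p. pushforward (charts N) \<pi> p u = (\<lambda>f. 0) \<longrightarrow>
           metric M p u v = 0 \<and> metric M p u w = 0) \<longrightarrow>
        metric M p v w =
          metric N (\<pi> p) (pushforward (charts N) \<pi> p v) (pushforward (charts N) \<pi> p w))"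

definition vertical_field ::
  "('a::topological_space, 'e::euclidean_space) riem \<Rightarrow> ('b::topological_space, 'f::euclidean_space) riem \<Rightarrow>
   ('a \<Rightarrow> 'b) \<Rightarrow> 'a set \<Rightarrow> 'a vfield \<Rightarrow> bool" where
  "vertical_field M N \<pi> U V \<longleftrightarrow> smooth_vfield (charts M) U V \<and>
     (\<forall>p\<in>U. pushforward (charts N) \<pi> p (V p) = (\<lambda>f. 0))"

text \<open>The second fundamental form of the fibres vanishes.\<close>

definition totally_geodesic_fibres ::
  "('a::topological_space, 'e::euclidean_space) riem \<Rightarrow> ('b::topological_space, 'f::euclidean_space) riem \<Rightarrow>
   ('a \<Rightarrow> 'b) \<Rightarrow> bool" where
  "totally_geodesic_fibres M N \<pi> \<longleftrightarrow>
     (\<forall>U V W. vertical_field M N \<pi> U V \<and> vertical_field M N \<pi> U W \<longrightarrow>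
        (\<forall>p\<in>U. pushforward (charts N) \<pi> p (conn M p (V p) W) = (\<lambda>f. 0)))"

text \<open>The circle group is the quotient of the real line by
  \<open>2 * pi\<close> times the integers, and \<open>act \<theta>\<close> is the action of the class of \<open>\<theta>\<close>. In the
  local triviality condition, the map sending \<open>p\<close> to \<open>(\<pi> p, \<tau> p)\<close> is the equivariant
  trivialization over \<open>U\<close>, and its inverse sends \<open>(y, cis \<theta>)\<close> to \<open>act \<theta> (\<sigma> y)\<close>.\<close>

definition principal_circle_bundle ::
  "('a::topological_space, 'e::euclidean_space) riem \<Rightarrow> ('b::topological_space, 'f::euclidean_space) riem \<Rightarrow>
   ('a \<Rightarrow> 'b) \<Rightarrow> (real \<Rightarrow> 'a \<Rightarrow> 'a) \<Rightarrow> bool" where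
  "principal_circle_bundle M N \<pi> act \<longleftrightarrow>
     smooth_map_on (charts M) UNIV (charts N) \<pi> \<and>
     smooth_map_on (line_times (charts M)) UNIV (charts M) (\<lambda>(\<theta>, p). act \<theta> p) \<and>
     (\<forall>s t p. act (s + t) p = act s (act t p)) \<and>
     (\<forall>\<theta> p. act \<theta> p = p \<longleftrightarrow> (\<exists>k::int. \<theta> = 2 * pi * of_int k)) \<and>
     (\<forall>p q. \<pi> p = \<pi> q \<longleftrightarrow> (\<exists>\<theta>. q = act \<theta> p)) \<and>
     (\<forall>x. \<exists>U \<sigma> \<tau>. x \<in> U \<and>
        smooth_map_on (charts N) U (charts M) \<sigma> \<and> smooth_cfun (charts M) (\<pi> -` U) \<tau> \<and>
        (\<forall>y\<in>U. \<pi> (\<sigma> y) = y \<and> \<tau> (\<sigma> y) = 1) \<and>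
        (\<forall>p\<in>\<pi> -` U. \<forall>\<theta>. \<tau> (act \<theta> p) = cis \<theta> * \<tau> p))"

definition fundamental_field ::
  "('a::topological_space, 'e::euclidean_space) riem \<Rightarrow> (real \<Rightarrow> 'a \<Rightarrow> 'a) \<Rightarrow> 'a vfield" where
  "fundamental_field M act p f =
     (if f \<in> germs (charts M) p then deriv (\<lambda>\<theta>. f (act \<theta> p)) 0 else 0)"

definition unit_fibre_field ::
  "('a::topological_space, 'e::euclidean_space) riem \<Rightarrow> (real \<Rightarrow> 'a \<Rightarrow> 'a) \<Rightarrow> 'a vfield" where
  "unit_fibre_field M act p f =
     (let K = fundamental_field M act p in K f / sqrt (metric M p K K))"

definition d_dt :: "('b::topological_space, 'e::euclidean_space) riem \<Rightarrow> (real \<times> 'b) vfield" where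
  "d_dt N p f =
     (if f \<in> germs (line_times (charts N)) p then deriv (\<lambda>s. f (s, snd p)) (fst p) else 0)"

text \<open>The Riemannian product of the real line and \<open>N\<close>; note that \<open>v fst\<close> is \<open>dt(v)\<close>. The
  third argument is to be the Levi-Civita connection of the product metric.\<close>

definition line_product ::
  "('b::topological_space, 'e::euclidean_space) riem \<Rightarrow> (real \<times> 'b) connection \<Rightarrow> (real \<times> 'b, real \<times> 'e) riem" where
  "line_product N D = \<lparr> charts = line_times (charts N),
     metric = (\<lambda>p v w. v fst * w fst +
        metric N (snd p) (pushforward (charts N) snd p v) (pushforward (charts N) snd p w)),
     conn = D \<rparr>"


section \<open>Spin structures and spinors\<close>

definition spin_dim :: "nat \<Rightarrow> nat" where
  "spin_dim n = 2 ^ (n div 2)"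

text \<open>Unitary Clifford modules of dimension \<open>spin_dim n\<close>. By their dimension these are exactly
  the irreducible complex ones (one up to isomorphism if \<open>n\<close> is even, two if \<open>n\<close> is odd).\<close>

definition clifford_module :: "nat \<Rightarrow> (nat \<Rightarrow> complex mat) \<Rightarrow> bool" where
  "clifford_module n \<gamma> \<longleftrightarrow>
     (\<forall>j<n. \<gamma> j \<in> carrier_mat (spin_dim n) (spin_dim n) \<and> mat_adjoint (\<gamma> j) = - \<gamma> j) \<and>
     (\<forall>j<n. \<forall>k<n. \<gamma> j * \<gamma> k + \<gamma> k * \<gamma> j =
        (if j = k then - 2 else 0) \<cdot>\<^sub>m 1\<^sub>m (spin_dim n))"

definition clifford_vec :: "nat \<Rightarrow> (nat \<Rightarrow> complex mat) \<Rightarrow> (nat \<Rightarrow> real) \<Rightarrow> complex mat" where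
  "clifford_vec n \<gamma> a =
     mat (spin_dim n) (spin_dim n) (\<lambda>rc. \<Sum>j<n. of_real (a j) * (\<gamma> j $$ rc))"

text \<open>\<open>Spin(n)\<close>, the products of an even number of unit vectors in the Clifford algebra,
  realized on the spinor module, on which the even part of the real Clifford algebra acts
  faithfully.\<close>

inductive_set spin_group :: "nat \<Rightarrow> (nat \<Rightarrow> complex mat) \<Rightarrow> complex mat set"
  for n :: nat and \<gamma> :: "nat \<Rightarrow> complex mat" where
  "1\<^sub>m (spin_dim n) \<in> spin_group n \<gamma>"
| "s \<in> spin_group n \<gamma> \<Longrightarrow> (\<Sum>j<n. (a j)\<^sup>2) = 1 \<Longrightarrow> (\<Sum>j<n. (b j)\<^sup>2) = 1 \<Longrightarrow>
     clifford_vec n \<gamma> a * clifford_vec n \<gamma> b * s \<in> spin_group n \<gamma>"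

text \<open>A spin structure is given by an open cover with local orthonormal frames and a
  \<open>Spin(n)\<close>-valued cocycle lifting their transition functions. With \<open>s = spin_lift S i k p\<close>
  and \<open>e'\<^sub>l = (\<Sum>j. a\<^sub>j\<^sub>l e\<^sub>j)\<close>, where \<open>e\<close>, \<open>e'\<close> are the frames over the sets with index
  \<open>i\<close>, \<open>k\<close>, lifting means \<open>s \<gamma>\<^sub>l s\<^sup>-\<^sup>1 = (\<Sum>j. a\<^sub>j\<^sub>l \<gamma>\<^sub>j)\<close>. Sections \<open>\<psi>\<close> of the spinor bundle
  are families of local functions with \<open>\<psi>\<^sub>i = s \<psi>\<^sub>k\<close>.\<close>

record ('i, 'a) spin =
  index :: "'i set"
  patch :: "'i \<Rightarrow> 'a set"
  frame :: "'i \<Rightarrow> nat \<Rightarrow> 'a vfield"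
  spin_lift :: "'i \<Rightarrow> 'i \<Rightarrow> 'a \<Rightarrow> complex mat"
  cliff :: "nat \<Rightarrow> complex mat"

definition orthonormal_frame ::
  "('a::topological_space, 'e::euclidean_space) riem \<Rightarrow> 'a set \<Rightarrow> (nat \<Rightarrow> 'a vfield) \<Rightarrow> bool" where
  "orthonormal_frame M U e \<longleftrightarrow>
     (\<forall>j<DIM('e). smooth_vfield (charts M) U (e j)) \<and>
     (\<forall>p\<in>U. (\<forall>j<DIM('e). \<forall>k<DIM('e). metric M p (e j p) (e k p) = (if j = k then 1 else 0)) \<and>
        (\<forall>v\<in>tspace M p. \<exists>c. v = (\<lambda>f. \<Sum>j<DIM('e). c j * e j p f)))"

definition spin_structure :: "('a::topological_space, 'e::euclidean_space) riem \<Rightarrow> ('i, 'a) spin \<Rightarrow> bool" where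
  "spin_structure M S \<longleftrightarrow>
     clifford_module DIM('e) (cliff S) \<and>
     (\<Union>i\<in>index S. patch S i) = UNIV \<and>
     (\<forall>i\<in>index S. open (patch S i) \<and> orthonormal_frame M (patch S i) (frame S i)) \<and>
     (\<forall>i\<in>index S. \<forall>k\<in>index S.
        (\<forall>p\<in>patch S i \<inter> patch S k.
           spin_lift S i k p \<in> spin_group DIM('e) (cliff S) \<and>
           (\<forall>l<DIM('e). spin_lift S i k p * cliff S l =
              clifford_vec DIM('e) (cliff S) (\<lambda>j. metric M p (frame S k l p) (frame S i j p))
                * spin_lift S i k p)) \<and>
        (\<forall>r<spin_dim DIM('e). \<forall>c<spin_dim DIM('e).
           smooth_cfun (charts M) (patch S i \<inter> patch S k) (\<lambda>p. spin_lift S i k p $$ (r, c)))) \<and>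
     (\<forall>i\<in>index S. \<forall>k\<in>index S. \<forall>l\<in>index S. \<forall>p\<in>patch S i \<inter> patch S k \<inter> patch S l.
        spin_lift S i k p * spin_lift S k l p = spin_lift S i l p)"

type_synonym ('i, 'a) spinor = "'i \<Rightarrow> 'a \<Rightarrow> complex vec"

definition spinor_field ::
  "('a::topological_space, 'e::euclidean_space) riem \<Rightarrow> ('i, 'a) spin \<Rightarrow> ('i, 'a) spinor \<Rightarrow> bool" where
  "spinor_field M S \<psi> \<longleftrightarrow>
     (\<forall>i\<in>index S. (\<forall>p\<in>patch S i. \<psi> i p \<in> carrier_vec (spin_dim DIM('e))) \<and>
        (\<forall>r<spin_dim DIM('e). smooth_cfun (charts M) (patch S i) (\<lambda>p. \<psi> i p $ r))) \<and>
     (\<forall>i\<in>index S. \<forall>k\<in>index S. \<forall>p\<in>patch S i \<inter> patch S k.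
        \<psi> i p = spin_lift S i k p *\<^sub>v \<psi> k p)"

definition clifford_mult ::
  "('a::topological_space, 'e::euclidean_space) riem \<Rightarrow> ('i, 'a) spin \<Rightarrow> 'i \<Rightarrow> 'a \<Rightarrow> 'a tvec \<Rightarrow>
   complex vec \<Rightarrow> complex vec" where
  "clifford_mult M S i p v w =
     clifford_vec DIM('e) (cliff S) (\<lambda>j. metric M p v (frame S i j p)) *\<^sub>v w"

definition two_form_mult ::
  "('a::topological_space, 'e::euclidean_space) riem \<Rightarrow> ('i, 'a) spin \<Rightarrow> 'i \<Rightarrow> 'a \<Rightarrow>
   ('a tvec \<Rightarrow> 'a tvec \<Rightarrow> real) \<Rightarrow> complex vec \<Rightarrow> complex vec" where
  "two_form_mult M S i p \<omega> w = vec (spin_dim DIM('e)) (\<lambda>r.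
     \<Sum>k<DIM('e). \<Sum>j<k. of_real (\<omega> (frame S i j p) (frame S i k p)) *
       ((cliff S j * cliff S k) *\<^sub>v w) $ r)"

text \<open>The spinorial Levi-Civita connection in the trivialization over \<open>patch S i\<close>:
  \<open>v(\<psi>) + 1/4 (\<Sum>j k. g(D\<^sub>v e\<^sub>j, e\<^sub>k) e\<^sub>j \<cdot> e\<^sub>k \<cdot> \<psi>)\<close>.\<close>

definition spin_conn ::
  "('a::topological_space, 'e::euclidean_space) riem \<Rightarrow> ('i, 'a) spin \<Rightarrow> 'i \<Rightarrow> 'a \<Rightarrow> 'a tvec \<Rightarrow>
   ('i, 'a) spinor \<Rightarrow> complex vec" where
  "spin_conn M S i p v \<psi> = vec (spin_dim DIM('e)) (\<lambda>r.
     Complex (v (\<lambda>q. Re (\<psi> i q $ r))) (v (\<lambda>q. Im (\<psi> i q $ r))) +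
     1 / 4 * (\<Sum>j<DIM('e). \<Sum>k<DIM('e).
        of_real (metric M p (conn M p v (frame S i j)) (frame S i k p)) *
        ((cliff S j * cliff S k) *\<^sub>v \<psi> i p) $ r))"

definition killing_spinor ::
  "('a::topological_space, 'e::euclidean_space) riem \<Rightarrow> ('i, 'a) spin \<Rightarrow> complex \<Rightarrow> ('i, 'a) spinor \<Rightarrow> bool" where
  "killing_spinor N S \<beta> \<psi> \<longleftrightarrow> spinor_field N S \<psi> \<and>
     (\<forall>i\<in>index S. \<forall>x\<in>patch S i. \<forall>v\<in>tspace N x.
        spin_conn N S i x v \<psi> = \<beta> \<cdot>\<^sub>v clifford_mult N S i x v (\<psi> i x))"


section \<open>Riemannian flows and transversal Killing spinors\<close>

definition transversal_space ::
  "('a::topological_space, 'e::euclidean_space) riem \<Rightarrow> 'a vfield \<Rightarrow> 'a \<Rightarrow> 'a tvec set" where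
  "transversal_space M \<xi> p = {Z \<in> tspace M p. metric M p Z (\<xi> p) = 0}"

definition riemannian_flow :: "('a::topological_space, 'e::euclidean_space) riem \<Rightarrow> 'a vfield \<Rightarrow> bool" where
  "riemannian_flow M \<xi> \<longleftrightarrow> smooth_vfield (charts M) UNIV \<xi> \<and> (\<forall>p. metric M p (\<xi> p) (\<xi> p) = 1) \<and>
     (\<forall>U Z W. smooth_vfield (charts M) U Z \<and> smooth_vfield (charts M) U W \<and>
        (\<forall>p\<in>U. Z p \<in> transversal_space M \<xi> p \<and> W p \<in> transversal_space M \<xi> p) \<longrightarrow>
        (\<forall>p\<in>U. \<xi> p (\<lambda>q. metric M q (Z q) (W q))
           - metric M p (lie_bracket (charts M) \<xi> Z p) (W p)
           - metric M p (Z p) (lie_bracket (charts M) \<xi> W p) = 0))"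

definition transversal_part ::
  "('a::topological_space, 'e::euclidean_space) riem \<Rightarrow> 'a vfield \<Rightarrow> 'a \<Rightarrow> 'a tvec \<Rightarrow> 'a tvec" where
  "transversal_part M \<xi> p v = (\<lambda>f. v f - metric M p v (\<xi> p) * \<xi> p f)"

definition flow_kappa ::
  "('a::topological_space, 'e::euclidean_space) riem \<Rightarrow> 'a vfield \<Rightarrow> 'a vfield" where
  "flow_kappa M \<xi> p = conn M p (\<xi> p) \<xi>"

definition flow_h ::
  "('a::topological_space, 'e::euclidean_space) riem \<Rightarrow> 'a vfield \<Rightarrow> 'a \<Rightarrow> 'a tvec \<Rightarrow> 'a tvec" where
  "flow_h M \<xi> p Z = conn M p Z \<xi>"

definition flow_Omega ::
  "('a::topological_space, 'e::euclidean_space) riem \<Rightarrow> 'a vfield \<Rightarrow> 'a \<Rightarrow> 'a tvec \<Rightarrow> 'a tvec \<Rightarrow> real" where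
  "flow_Omega M \<xi> p v w =
     metric M p (flow_h M \<xi> p (transversal_part M \<xi> p v)) (transversal_part M \<xi> p w)"

definition transversal_conn_xi ::
  "('a::topological_space, 'e::euclidean_space) riem \<Rightarrow> ('i, 'a) spin \<Rightarrow> 'a vfield \<Rightarrow> 'i \<Rightarrow> 'a \<Rightarrow>
   ('i, 'a) spinor \<Rightarrow> complex vec" where
  "transversal_conn_xi M S \<xi> i p \<phi> = spin_conn M S i p (\<xi> p) \<phi>
     - (1 / 2) \<cdot>\<^sub>v two_form_mult M S i p (flow_Omega M \<xi> p) (\<phi> i p)
     - (1 / 2) \<cdot>\<^sub>v clifford_mult M S i p (\<xi> p)
                    (clifford_mult M S i p (flow_kappa M \<xi> p) (\<phi> i p))"

definition transversal_conn_Q ::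
  "('a::topological_space, 'e::euclidean_space) riem \<Rightarrow> ('i, 'a) spin \<Rightarrow> 'a vfield \<Rightarrow> 'i \<Rightarrow> 'a \<Rightarrow>
   'a tvec \<Rightarrow> ('i, 'a) spinor \<Rightarrow> complex vec" where
  "transversal_conn_Q M S \<xi> i p Z \<phi> = spin_conn M S i p Z \<phi>
     - (1 / 2) \<cdot>\<^sub>v clifford_mult M S i p (\<xi> p)
                    (clifford_mult M S i p (flow_h M \<xi> p Z) (\<phi> i p))"

definition transversal_killing_spinor ::
  "('a::topological_space, 'e::euclidean_space) riem \<Rightarrow> ('i, 'a) spin \<Rightarrow> 'a vfield \<Rightarrow>
   complex \<Rightarrow> complex \<Rightarrow> ('i, 'a) spinor \<Rightarrow> bool" where
  "transversal_killing_spinor M S \<xi> \<alpha> \<beta> \<phi> \<longleftrightarrow>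
     riemannian_flow M \<xi> \<and> spinor_field M S \<phi> \<and>
     (\<forall>i\<in>index S. \<forall>p\<in>patch S i.
        transversal_conn_xi M S \<xi> i p \<phi> = \<alpha> \<cdot>\<^sub>v clifford_mult M S i p (\<xi> p) (\<phi> i p) \<and>
        (\<forall>Z\<in>transversal_space M \<xi> p.
           transversal_conn_Q M S \<xi> i p Z \<phi> =
             \<beta> \<cdot>\<^sub>v clifford_mult M S i p (\<xi> p) (clifford_mult M S i p Z (\<phi> i p))))"


section \<open>Induced spin structures and induced spinors\<close>

text \<open>The complex volume element; the half spinor modules are its eigenspaces for the
  eigenvalues 1 and -1 if \<open>n\<close> is even.\<close>

definition volume_element :: "nat \<Rightarrow> (nat \<Rightarrow> complex mat) \<Rightarrow> complex mat" where
  "volume_element n \<gamma> = (\<i> ^ ((n + 1) div 2)) \<cdot>\<^sub>m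
     foldr (\<lambda>j A. \<gamma> j * A) [0..<n] (1\<^sub>m (spin_dim n))"

text \<open>The Clifford module of the total space (\<open>n\<close> is the dimension of the base, \<open>c 0\<close> is
  \<open>\<xi>\<close> and \<open>c (Suc j)\<close> the \<open>j\<close>-th transversal basis vector) under its identification with one
  copy (\<open>n\<close> even), respectively two copies (\<open>n\<close> odd), of the Clifford module \<open>\<gamma>\<close> of the
  base.\<close>

definition clifford_identification ::
  "nat \<Rightarrow> (nat \<Rightarrow> complex mat) \<Rightarrow> (nat \<Rightarrow> complex mat) \<Rightarrow> bool" where
  "clifford_identification n \<gamma> c \<longleftrightarrow>
     (let d = spin_dim n in
      if even n then
        (\<forall>j<n. c 0 * c (Suc j) = \<gamma> j) \<and>
        (\<forall>w\<in>carrier_vec d. volume_element n \<gamma> *\<^sub>v w = w \<longrightarrow> (\<i> \<cdot>\<^sub>m c 0) *\<^sub>v w = w) \<and>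
        (\<forall>w\<in>carrier_vec d. volume_element n \<gamma> *\<^sub>v w = - w \<longrightarrow> (\<i> \<cdot>\<^sub>m c 0) *\<^sub>v w = - w)
      else
        (\<forall>j<n. c 0 * c (Suc j) = four_block_mat (\<gamma> j) (0\<^sub>m d d) (0\<^sub>m d d) (- \<gamma> j)) \<and>
        (\<forall>v\<in>carrier_vec d. \<forall>w\<in>carrier_vec d. (\<i> \<cdot>\<^sub>m c 0) *\<^sub>v (v @\<^sub>v w) = w @\<^sub>v v))"

text \<open>The spin structure of \<open>N\<close> pulled back to \<open>Q\<close> and extended to \<open>TM\<close>: the frames are
  \<open>\<xi>\<close> followed by the horizontal lifts of the frames of \<open>N\<close>, and \<open>Spin(n)\<close> acts on the spinor
  module of \<open>M\<close> through its inclusion into \<open>Spin(n+1)\<close>. In terms of \<open>\<xi>\<close> this inclusion is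
  \<open>Z W = (\<xi> Z) (\<xi> W)\<close>, so that an even element acts by itself on every copy of the spinor
  module of \<open>N\<close>.\<close>

definition induced_spin_structure ::
  "('b::topological_space, 'e::euclidean_space) riem \<Rightarrow> ('i, 'b) spin \<Rightarrow>
   ('a::topological_space, real \<times> 'e) riem \<Rightarrow> ('a \<Rightarrow> 'b) \<Rightarrow> 'a vfield \<Rightarrow> ('i, 'a) spin \<Rightarrow> bool" where
  "induced_spin_structure N SN M \<pi> \<xi> SM \<longleftrightarrow>
     spin_structure M SM \<and>
     index SM = index SN \<and>
     (\<forall>i\<in>index SN. patch SM i = \<pi> -` patch SN i) \<and>
     (\<forall>i\<in>index SN. \<forall>p\<in>\<pi> -` patch SN i.
        frame SM i 0 p = \<xi> p \<and>
        (\<forall>j<DIM('e). frame SM i (Suc j) p \<in> transversal_space M \<xi> p \<and>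
           pushforward (charts N) \<pi> p (frame SM i (Suc j) p) = frame SN i j (\<pi> p))) \<and>
     (\<forall>i\<in>index SN. \<forall>k\<in>index SN. \<forall>p\<in>\<pi> -` (patch SN i \<inter> patch SN k).
        spin_lift SM i k p =
          (let s = spin_lift SN i k (\<pi> p); d = spin_dim DIM('e) in
           if even DIM('e) then s else four_block_mat s (0\<^sub>m d d) (0\<^sub>m d d) s)) \<and>
     clifford_identification DIM('e) (cliff SN) (cliff SM)"

definition induced_spinor ::
  "('b::topological_space, 'e::euclidean_space) riem \<Rightarrow> ('a \<Rightarrow> 'b) \<Rightarrow> ('i, 'b) spinor \<Rightarrow> ('i, 'a) spinor" where
  "induced_spinor N \<pi> \<psi> i p =
     (if even DIM('e) then \<psi> i (\<pi> p) else \<psi> i (\<pi> p) @\<^sub>v 0\<^sub>v (spin_dim DIM('e)))"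

text \<open>The components of \<open>w\<close> in the eigenspaces of \<open>\<i> \<xi> \<cdot>\<close>, an involution, for the
  eigenvalues 1 and -1.\<close>

definition plus_part ::
  "('a::topological_space, 'e::euclidean_space) riem \<Rightarrow> ('i, 'a) spin \<Rightarrow> 'a vfield \<Rightarrow> 'i \<Rightarrow> 'a \<Rightarrow>
   complex vec \<Rightarrow> complex vec" where
  "plus_part M S \<xi> i p w = (1 / 2) \<cdot>\<^sub>v (w + \<i> \<cdot>\<^sub>v clifford_mult M S i p (\<xi> p) w)"

definition minus_part ::
  "('a::topological_space, 'e::euclidean_space) riem \<Rightarrow> ('i, 'a) spin \<Rightarrow> 'a vfield \<Rightarrow> 'i \<Rightarrow> 'a \<Rightarrow>
   complex vec \<Rightarrow> complex vec" where
  "minus_part M S \<xi> i p w = (1 / 2) \<cdot>\<^sub>v (w - \<i> \<cdot>\<^sub>v clifford_mult M S i p (\<xi> p) w)"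

definition induced_spinor_alpha ::
  "('b::topological_space, 'e::euclidean_space) riem \<Rightarrow> (real \<times> 'b, real \<times> 'e) riem \<Rightarrow>
   ('i, real \<times> 'b) spin \<Rightarrow> complex \<Rightarrow> ('i, 'b) spinor \<Rightarrow> ('i, real \<times> 'b) spinor" where
  "induced_spinor_alpha N M S \<alpha> \<psi> i p =
     (let w = \<psi> i (snd p); t = of_real (fst p) in
      if even DIM('e) then
        exp (- \<i> * \<alpha> * t) \<cdot>\<^sub>v plus_part M S (d_dt N) i p w
          + exp (\<i> * \<alpha> * t) \<cdot>\<^sub>v minus_part M S (d_dt N) i p w
      else exp (- \<i> * \<alpha> * t) \<cdot>\<^sub>v (w @\<^sub>v w))"

text \<open>Descending to the product of \<open>N\<close> with a circle of length \<open>L\<close> carrying the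
  \<open>\<delta>\<close>-spin structure. The fibres over \<open>(t, x)\<close> and \<open>(t - L, x)\<close> are identified by using the
  same index \<open>i\<close>, all frames and lifts being pulled back from \<open>N\<close>.\<close>

definition descends ::
  "('i, 'b) spin \<Rightarrow> real \<Rightarrow> nat \<Rightarrow> ('i, real \<times> 'b) spinor \<Rightarrow> bool" where
  "descends SN L \<delta> \<phi> \<longleftrightarrow>
     (\<forall>i\<in>index SN. \<forall>x\<in>patch SN i. \<forall>t.
        \<phi> i (t, x) = exp (\<i> * of_real pi * of_nat \<delta>) \<cdot>\<^sub>v \<phi> i (t - L, x))"

definition nonzero_spinor :: "('i, 'b) spin \<Rightarrow> ('i, 'b) spinor \<Rightarrow> bool" where
  "nonzero_spinor SN \<psi> \<longleftrightarrow>
     (\<exists>i\<in>index SN. \<exists>x\<in>patch SN i. \<psi> i x \<noteq> 0\<^sub>v (dim_vec (\<psi> i x)))"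

end

theory Submission
  imports Defs "HOL-Analysis.Complex_Transcendental"
begin

text \<open>In an adapted frame consisting of \<open>\<xi>\<close> and of horizontal lifts of frames of \<open>N\<close>, the
  terms of the spinorial Levi-Civita connection of \<open>M\<close> that involve \<open>\<xi>\<close> are the Clifford
  terms \<open>\<xi> \<cdot> h(Z)\<close> and \<open>\<xi> \<cdot> \<kappa>\<close> subtracted in the definition of the transversal connection.
  The remaining ones are those of the connection of \<open>N\<close> in direction \<open>Z \<in> Q\<close>, by the Koszul formula,
  since the bracket of horizontal lifts projects to the bracket of the fields on \<open>N\<close>, and they
  are \<open>\<Omega>\<close> in direction \<open>\<xi>\<close>, since the bracket of \<open>\<xi>\<close> with a horizontal lift is vertical. So
  \<open>\<nabla>\<^sub>\<xi>\<close> differentiates components and \<open>\<nabla>\<^sub>Z\<close> of a pulled back spinor is the pullback of its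
  derivative on \<open>N\<close>. On the product with a line, \<open>\<nabla>\<close> commutes with \<open>\<xi> \<cdot>\<close>, and the
  second induced spinor is the rotation \<open>cos(\<alpha> t) u + sin(\<alpha> t) \<xi> \<cdot> u\<close> of a parallel one,
  which is \<open>\<plusminus>1\<close> times its translate by \<open>L\<close> iff \<open>cos(\<alpha> L) = \<plusminus>1\<close>.\<close>

section \<open>Smooth functions\<close>

text \<open>On spinors of M, \<open>clifford_identification\<close> prescribes the products
  \<open>c 0 * c (Suc j)\<close>, but not the matrices \<open>c (Suc j)\<close> themselves. The
  computations are therefore arranged so that vectors of Q occur only in even products: since \<xi>
  squares to -1 and anticommutes with Q, (\<xi> Z)(\<xi> W) = Z W, so that products of two vectors
  of Q act by one and the same matrix on each copy of the spinor module of N, and they commute with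
  \<xi>. The single factor \<xi> Z in the Killing equation, in contrast, has opposite signs on the
  two copies. The connection of M is never computed outright. It enters through metric compatibility
  and torsion-freeness in orthonormal frames, so the circle bundle and the product with a line are
  treated alike. Tangent vectors are abstract derivations. Only two kinds of functions have to be
  differentiated: pullbacks from N, by the pushforward, and functions of t, by power series. For odd
  dimension \<xi> u is proportional to u in the second construction, so the descent criterion cannot
  be read off by comparing coefficients of u and \<xi> u; a 2 x 2 linear system takes the place of
  that.\<close>

lemma differentiable_cong_open:
  assumes "open S" "x \<in> S" "\<And>y. y \<in> S \<Longrightarrow> f y = g y" "f differentiable (at x)"
  shows "g differentiable (at x) \<and> frechet_derivative g (at x) = frechet_derivative f (at x)"
proof -
  have "(f has_derivative frechet_derivative f (at x)) (at x)"
    using assms(4) frechet_derivative_works by blast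
  then have "(g has_derivative frechet_derivative f (at x)) (at x)"
    using assms(1-3) by (rule has_derivative_transform_within_open)
  then show ?thesis
    using differentiableI frechet_derivative_at by fastforce
qed

lemma Ck_on_cong:
  assumes "open S" "\<And>x. x \<in> S \<Longrightarrow> f x = g x" "Ck_on k f S"
  shows "Ck_on k g S"
  using assms(2,3)
proof (induction k arbitrary: f g)
  case 0
  then show ?case by (simp cong: continuous_on_cong)
next
  case (Suc k)
  have *: "g differentiable (at x) \<and> frechet_derivative g (at x) = frechet_derivative f (at x)"
    if "x \<in> S" for x
    using differentiable_cong_open[OF assms(1) that, of f g] Suc.prems that by auto
  have "Ck_on k (\<lambda>x. frechet_derivative g (at x) v) S" for v
    by (rule Suc.IH[of "\<lambda>x. frechet_derivative f (at x) v"]) (use * Suc.prems in auto)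
  then show ?case using * by auto
qed

lemma Ck_on_subset: "Ck_on k f S \<Longrightarrow> T \<subseteq> S \<Longrightarrow> Ck_on k f T"
  by (induction k arbitrary: f) (auto intro: continuous_on_subset)

lemma Ck_on_SucD: "Ck_on (Suc k) f S \<Longrightarrow> Ck_on k f S"
proof (induction k arbitrary: f)
  case 0
  then show ?case
    by (simp add: continuous_at_imp_continuous_on differentiable_imp_continuous_within)
qed auto

text \<open>\<open>Ck_on\<close> is phrased with the selected \<open>frechet_derivative\<close>.
  Derivatives are unique, so by \<open>Ck_on_cong\<close> an explicit f' may take its place. The
  rules for sums, products and compositions rest on this and on the converse
  \<open>Ck_on_SucE\<close>.\<close>

lemma Ck_on_SucI:
  assumes "open S" "\<And>x. x \<in> S \<Longrightarrow> (f has_derivative f' x) (at x)" "\<And>v. Ck_on k (\<lambda>x. f' x v) S"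
  shows "Ck_on (Suc k) f S"
proof -
  have "frechet_derivative f (at x) = f' x" if "x \<in> S" for x
    using assms(2)[OF that] frechet_derivative_at by metis
  then have "Ck_on k (\<lambda>x. frechet_derivative f (at x) v) S" for v
    using Ck_on_cong[OF assms(1) _ assms(3)[of v], of "\<lambda>x. frechet_derivative f (at x) v"] by simp
  then show ?thesis
    using assms(2) by (auto simp: differentiable_def)
qed

lemma Ck_on_SucE:
  assumes "Ck_on (Suc k) f S"
  obtains f' where "\<And>x. x \<in> S \<Longrightarrow> (f has_derivative f' x) (at x)" "\<And>v. Ck_on k (\<lambda>x. f' x v) S"
proof
  show "(f has_derivative frechet_derivative f (at x)) (at x)" if "x \<in> S" for x
    using assms that by (simp add: frechet_derivative_works)
  show "Ck_on k (\<lambda>x. frechet_derivative f (at x) v) S" for v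
    using assms by simp
qed

lemma Ck_on_const: "open S \<Longrightarrow> Ck_on k (\<lambda>x. c) S"
proof (induction k arbitrary: c)
  case (Suc k)
  show ?case
    by (rule Ck_on_SucI[where f' = "\<lambda>_ _. 0"]) (use Suc in auto)
qed simp

lemma Ck_on_add: "open S \<Longrightarrow> Ck_on k f S \<Longrightarrow> Ck_on k g S \<Longrightarrow> Ck_on k (\<lambda>x. f x + g x) S"
proof (induction k arbitrary: f g)
  case 0
  then show ?case by (simp add: continuous_on_add)
next
  case (Suc k)
  obtain f' where f': "\<And>x. x \<in> S \<Longrightarrow> (f has_derivative f' x) (at x)" "\<And>v. Ck_on k (\<lambda>x. f' x v) S"
    using Suc.prems(2) Ck_on_SucE by metis
  obtain g' where g': "\<And>x. x \<in> S \<Longrightarrow> (g has_derivative g' x) (at x)" "\<And>v. Ck_on k (\<lambda>x. g' x v) S"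
    using Suc.prems(3) Ck_on_SucE by metis
  show ?case
    by (rule Ck_on_SucI[where f' = "\<lambda>x v. f' x v + g' x v"])
      (use Suc.prems(1) f' g' Suc.IH in \<open>auto intro!: has_derivative_add\<close>)
qed

lemma Ck_on_mult:
  fixes f g :: "'e::real_normed_vector \<Rightarrow> real"
  shows "open S \<Longrightarrow> Ck_on k f S \<Longrightarrow> Ck_on k g S \<Longrightarrow> Ck_on k (\<lambda>x. f x * g x) S"
proof (induction k arbitrary: f g)
  case 0
  then show ?case by (simp add: continuous_on_mult)
next
  case (Suc k)
  obtain f' where f': "\<And>x. x \<in> S \<Longrightarrow> (f has_derivative f' x) (at x)" "\<And>v. Ck_on k (\<lambda>x. f' x v) S"
    using Suc.prems(2) Ck_on_SucE by metis
  obtain g' where g': "\<And>x. x \<in> S \<Longrightarrow> (g has_derivative g' x) (at x)" "\<And>v. Ck_on k (\<lambda>x. g' x v) S"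
    using Suc.prems(3) Ck_on_SucE by metis
  have "Ck_on k f S" "Ck_on k g S"
    using Suc.prems Ck_on_SucD by blast+
  then show ?case
    by (intro Ck_on_SucI[where f' = "\<lambda>x v. f x * g' x v + f' x v * g x"])
      (use Suc.prems(1) f' g' Suc.IH in \<open>auto intro!: has_derivative_mult Ck_on_add\<close>)
qed

text \<open>Differentiability at a point does not mention the set, so passing to a union is an issue
  for continuity only, where openness of the pieces enters.\<close>

lemma Ck_on_UN:
  assumes "\<And>i. i \<in> I \<Longrightarrow> open (T i)" "\<And>i. i \<in> I \<Longrightarrow> Ck_on k f (T i)"
  shows "Ck_on k f (\<Union>i\<in>I. T i)"
  using assms
proof (induction k arbitrary: f)
  case 0
  then show ?case by (simp add: continuous_on_open_UN)
qed auto

text \<open>The inner map is linear, so the derivative in a fixed direction v is again a composition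
  with \<open>snd\<close>, namely of the derivative of f in direction \<open>snd v\<close>. This
  closes the induction without a chain rule of higher order.\<close>

lemma Ck_on_compose_snd:
  fixes f :: "'e::real_normed_vector \<Rightarrow> 'f::real_normed_vector"
  shows "open S \<Longrightarrow> Ck_on k f S \<Longrightarrow> Ck_on k (\<lambda>p::real \<times> 'e. f (snd p)) (UNIV \<times> S)"
proof (induction k arbitrary: f)
  case 0
  then show ?case
    by (auto intro: continuous_on_compose2[of S f] simp: continuous_on_snd)
next
  case (Suc k)
  obtain f' where f': "\<And>x. x \<in> S \<Longrightarrow> (f has_derivative f' x) (at x)" "\<And>v. Ck_on k (\<lambda>x. f' x v) S"
    using Suc.prems(2) Ck_on_SucE by metis
  have "((\<lambda>p. f (snd p)) has_derivative (\<lambda>v. f' (snd p) (snd v))) (at p)" if "snd p \<in> S" for p :: "real \<times> 'e"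
    by (rule has_derivative_compose[of snd snd p UNIV f "f' (snd p)", simplified])
      (use f' that in \<open>auto intro: derivative_eq_intros\<close>)
  then show ?case
    by (intro Ck_on_SucI[where f' = "\<lambda>p v. f' (snd p) (snd v)"])
      (use Suc.prems(1) f' Suc.IH[of "\<lambda>x. f' x v" for v] in \<open>auto intro: open_Times\<close>)
qed

lemma smooth_on_cong:
  "open S \<Longrightarrow> (\<And>x. x \<in> S \<Longrightarrow> f x = g x) \<Longrightarrow> smooth_on f S \<Longrightarrow> smooth_on g S"
  unfolding smooth_on_def using Ck_on_cong by blast

section \<open>Smooth functions on manifolds, seen through charts\<close>

lemma chart_image_open:
  assumes "smooth_atlas A" "(U, c) \<in> A" "open V"
  shows "open (c ` (V \<inter> U))"
proof -
  have "open U" "open (c ` U)" "homeomorphism U (c ` U) c (inv_into U c)"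
    using assms(1,2) by (auto simp: smooth_atlas_def)
  then have "openin (top_of_set (c ` U)) (c ` (V \<inter> U))"
    using homeomorphism_imp_open_map[of U "c ` U" c "inv_into U c" "V \<inter> U"] assms(3)
    by (simp add: openin_open_eq open_Int)
  then show ?thesis
    using \<open>open (c ` U)\<close> openin_open_trans by blast
qed

lemma chart_inj:
  assumes "smooth_atlas A" "(U, c) \<in> A"
  shows "inj_on c U"
proof -
  have "homeomorphism U (c ` U) c (inv_into U c)"
    using assms by (auto simp: smooth_atlas_def)
  then show ?thesis
    by (metis homeomorphism_def inj_on_inverseI)
qed

lemma smooth_fun_cong:
  assumes "smooth_atlas A" "smooth_fun A U f" "\<And>q. q \<in> U \<Longrightarrow> f q = g q"
  shows "smooth_fun A U g"
  unfolding smooth_fun_def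
proof (safe)
  show "open U" using assms(2) by (simp add: smooth_fun_def)
  fix V c assume c: "(V, c) \<in> A"
  show "smooth_on (g \<circ> inv_into V c) (c ` (U \<inter> V))"
  proof (rule smooth_on_cong)
    show "open (c ` (U \<inter> V))" using chart_image_open assms(1) c \<open>open U\<close> by blast
    show "smooth_on (f \<circ> inv_into V c) (c ` (U \<inter> V))" using assms(2) c by (auto simp: smooth_fun_def)
  qed (use assms(3) chart_inj[OF assms(1) c] in auto)
qed

lemma smooth_fun_subset:
  "smooth_fun A U f \<Longrightarrow> open V \<Longrightarrow> V \<subseteq> U \<Longrightarrow> smooth_fun A V f"
  unfolding smooth_fun_def smooth_on_def
  by (fast intro: Ck_on_subset)

lemma smooth_fun_open: "smooth_fun A U f \<Longrightarrow> open U"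
  by (simp add: smooth_fun_def)

lemma smooth_fun_const:
  assumes "smooth_atlas A" "open U"
  shows "smooth_fun A U (\<lambda>q. a)"
  using assms chart_image_open[OF assms(1)]
  by (auto simp: smooth_fun_def smooth_on_def o_def intro!: Ck_on_const)

lemma smooth_fun_add:
  assumes "smooth_atlas A" "smooth_fun A U f" "smooth_fun A U g"
  shows "smooth_fun A U (\<lambda>q. f q + g q)"
  using assms chart_image_open[OF assms(1)]
  by (fastforce simp: smooth_fun_def smooth_on_def o_def intro!: Ck_on_add)

lemma smooth_fun_mult:
  assumes "smooth_atlas A" "smooth_fun A U f" "smooth_fun A U g"
  shows "smooth_fun A U (\<lambda>q. f q * g q)"
  using assms chart_image_open[OF assms(1)]
  by (fastforce simp: smooth_fun_def smooth_on_def o_def intro!: Ck_on_mult)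

lemma smooth_fun_UN:
  assumes "smooth_atlas A" "\<And>i. i \<in> I \<Longrightarrow> smooth_fun A (U i) f"
  shows "smooth_fun A (\<Union>i\<in>I. U i) f"
  unfolding smooth_fun_def
proof (safe)
  show "open (\<Union>i\<in>I. U i)" using assms(2) by (auto simp: smooth_fun_def)
  fix V c assume c: "(V, c) \<in> A"
  have "c ` ((\<Union>i\<in>I. U i) \<inter> V) = (\<Union>i\<in>I. c ` (U i \<inter> V))" by auto
  moreover have "open (c ` (U i \<inter> V))" if "i \<in> I" for i
    using chart_image_open[OF assms(1) c] smooth_fun_open[OF assms(2)] that by blast
  moreover have "Ck_on k (f \<circ> inv_into V c) (c ` (U i \<inter> V))" if "i \<in> I" for i k
    using assms(2)[OF that] c by (auto simp: smooth_fun_def smooth_on_def)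
  ultimately show "smooth_on (f \<circ> inv_into V c) (c ` ((\<Union>i\<in>I. U i) \<inter> V))"
    unfolding smooth_on_def by (metis (no_types, lifting) Ck_on_UN)
qed

lemma smooth_cfun_cong:
  assumes "smooth_atlas A" "smooth_cfun A U f" "\<And>q. q \<in> U \<Longrightarrow> f q = g q"
  shows "smooth_cfun A U g"
  using assms smooth_fun_cong[OF assms(1)] unfolding smooth_cfun_def by (metis (no_types, lifting))

lemma smooth_cfun_const: "smooth_atlas A \<Longrightarrow> open U \<Longrightarrow> smooth_cfun A U (\<lambda>q. a)"
  by (simp add: smooth_cfun_def smooth_fun_const)

lemma smooth_cfun_add:
  "smooth_atlas A \<Longrightarrow> smooth_cfun A U f \<Longrightarrow> smooth_cfun A U g \<Longrightarrow> smooth_cfun A U (\<lambda>q. f q + g q)"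
  by (simp add: smooth_cfun_def smooth_fun_add)

lemma smooth_cfun_mult:
  assumes "smooth_atlas A" "smooth_cfun A U f" "smooth_cfun A U g"
  shows "smooth_cfun A U (\<lambda>q. f q * g q)"
proof -
  have neg: "smooth_fun A U (\<lambda>q. - h q)" if "smooth_fun A U h" for h
    using smooth_fun_mult[OF assms(1) smooth_fun_const[OF assms(1)] that, of "-1"] smooth_fun_open[OF that]
    by simp
  have fg: "smooth_fun A U (\<lambda>q. Re (f q))" "smooth_fun A U (\<lambda>q. Im (f q))"
    "smooth_fun A U (\<lambda>q. Re (g q))" "smooth_fun A U (\<lambda>q. Im (g q))"
    using assms by (auto simp: smooth_cfun_def)
  have "smooth_fun A U (\<lambda>q. Re (f q) * Re (g q) + - (Im (f q) * Im (g q)))"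
    "smooth_fun A U (\<lambda>q. Re (f q) * Im (g q) + Im (f q) * Re (g q))"
    by (intro smooth_fun_add smooth_fun_mult neg assms(1) fg)+
  then show ?thesis
    by (simp add: smooth_cfun_def algebra_simps)
qed

lemma smooth_cfun_sum:
  "finite I \<Longrightarrow> smooth_atlas A \<Longrightarrow> open U \<Longrightarrow> (\<And>i. i \<in> I \<Longrightarrow> smooth_cfun A U (f i)) \<Longrightarrow>
    smooth_cfun A U (\<lambda>q. \<Sum>i\<in>I. f i q)"
  by (induction rule: finite_induct) (auto intro: smooth_cfun_const smooth_cfun_add)


section \<open>Tangent vectors\<close>

lemma germsI: "smooth_fun A U f \<Longrightarrow> p \<in> U \<Longrightarrow> f \<in> germs A p"
  by (auto simp: germs_def)

lemma germs_cong:
  assumes "smooth_atlas A" "f \<in> germs A p" "open W" "p \<in> W" "\<And>q. q \<in> W \<Longrightarrow> f q = g q"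
  shows "g \<in> germs A p"
proof -
  obtain U where U: "p \<in> U" "smooth_fun A U f" using assms(2) by (auto simp: germs_def)
  have "smooth_fun A (U \<inter> W) f"
    using U(2) assms(3) smooth_fun_open[OF U(2)] by (auto intro: smooth_fun_subset)
  then have "smooth_fun A (U \<inter> W) g"
    using smooth_fun_cong[OF assms(1)] assms(5) by blast
  then show ?thesis using U(1) assms(4) by (auto intro: germsI)
qed

lemma germs_const: "smooth_atlas A \<Longrightarrow> (\<lambda>q. a) \<in> germs A p"
  by (rule germsI[OF smooth_fun_const[of A UNIV]]) auto

lemma germs_binop:
  assumes "f \<in> germs A p" "g \<in> germs A p" "\<And>U. smooth_fun A U f \<Longrightarrow> smooth_fun A U g \<Longrightarrow> smooth_fun A U h"
  shows "h \<in> germs A p"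
proof -
  obtain U V where "p \<in> U" "smooth_fun A U f" "p \<in> V" "smooth_fun A V g"
    using assms(1,2) by (auto simp: germs_def)
  then have "smooth_fun A (U \<inter> V) h"
    by (intro assms(3)) (auto intro: smooth_fun_subset dest: smooth_fun_open)
  then show ?thesis using \<open>p \<in> U\<close> \<open>p \<in> V\<close> by (auto intro: germsI)
qed

lemma germs_add:
  "smooth_atlas A \<Longrightarrow> f \<in> germs A p \<Longrightarrow> g \<in> germs A p \<Longrightarrow> (\<lambda>q. f q + g q) \<in> germs A p"
  by (erule (1) germs_binop) (rule smooth_fun_add)

lemma germs_mult:
  "smooth_atlas A \<Longrightarrow> f \<in> germs A p \<Longrightarrow> g \<in> germs A p \<Longrightarrow> (\<lambda>q. f q * g q) \<in> germs A p"
  by (erule (1) germs_binop) (rule smooth_fun_mult)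

context
  fixes A :: "('a::{t2_space,second_countable_topology}, 'e::euclidean_space) atlas"
  assumes A: "smooth_atlas A"
begin

lemma tangent_nongerm: "v \<in> tangent A p \<Longrightarrow> f \<notin> germs A p \<Longrightarrow> v f = 0"
  by (auto simp: tangent_def)

lemma tangent_lin:
  "v \<in> tangent A p \<Longrightarrow> f \<in> germs A p \<Longrightarrow> g \<in> germs A p \<Longrightarrow>
    v (\<lambda>q. a * f q + b * g q) = a * v f + b * v g"
  by (auto simp: tangent_def)

lemma tangent_add:
  "v \<in> tangent A p \<Longrightarrow> f \<in> germs A p \<Longrightarrow> g \<in> germs A p \<Longrightarrow> v (\<lambda>q. f q + g q) = v f + v g"
  using tangent_lin[of v p f g 1 1] by simp

lemma tangent_mult:
  "v \<in> tangent A p \<Longrightarrow> f \<in> germs A p \<Longrightarrow> g \<in> germs A p \<Longrightarrow>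
    v (\<lambda>q. f q * g q) = v f * g p + f p * v g"
  by (auto simp: tangent_def)

lemma tangent_const:
  assumes "v \<in> tangent A p"
  shows "v (\<lambda>q. a) = 0"
proof -
  have one: "(\<lambda>q. 1) \<in> germs A p" by (rule germs_const[OF A])
  have "v (\<lambda>q. 1) = 0" using tangent_mult[OF assms one one] by simp
  then show ?thesis using tangent_lin[OF assms one one, of a 0] by simp
qed

text \<open>Representatives of germs have to be smooth near p only, so the indicator of an open
  neighbourhood, being constant near p, is admissible. It plays the role of a bump function.\<close>

lemma indicator_germ:
  assumes "open W" "p \<in> W"
  shows "(\<lambda>q. if q \<in> W then 1 else 0) \<in> germs A p"
  by (rule germs_cong[OF A germs_const[OF A] assms, of 1]) auto

text \<open>The indicator h is idempotent with h(p) = 1, so the Leibniz rule gives v(h) = 2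
  v(h).\<close>

lemma tangent_indicator:
  assumes "v \<in> tangent A p" "open W" "p \<in> W"
  shows "v (\<lambda>q. if q \<in> W then 1 else 0) = 0"
proof -
  let ?h = "\<lambda>q. if q \<in> W then 1 else 0 :: real"
  have "(\<lambda>q. ?h q * ?h q) = ?h" by auto
  then show ?thesis
    using tangent_mult[OF assms(1) indicator_germ[OF assms(2,3)] indicator_germ[OF assms(2,3)]] assms(3)
    by simp
qed

text \<open>Multiplication by the indicator of W changes neither v(f) nor v(g), and it makes the two
  functions equal everywhere. If f is not smooth near p, neither is g, and both values are the
  default 0.\<close>

lemma tangent_local:
  assumes "v \<in> tangent A p" "open W" "p \<in> W" "\<And>q. q \<in> W \<Longrightarrow> f q = g q"
  shows "v f = v g"
proof (cases "f \<in> germs A p")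
  case True
  let ?h = "\<lambda>q. if q \<in> W then 1 else 0 :: real"
  have g: "g \<in> germs A p" using germs_cong[OF A True assms(2-4)] .
  have "v f = v (\<lambda>q. f q * ?h q)"
    using tangent_mult[OF assms(1) True indicator_germ[OF assms(2,3)]] tangent_indicator[OF assms(1-3)] assms(3)
    by simp
  also have "(\<lambda>q. f q * ?h q) = (\<lambda>q. g q * ?h q)"
    using assms(4) by auto
  also have "v \<dots> = v g"
    using tangent_mult[OF assms(1) g indicator_germ[OF assms(2,3)]] tangent_indicator[OF assms(1-3)] assms(3)
    by simp
  finally show ?thesis .
next
  case False
  then have "g \<notin> germs A p" using germs_cong[OF A _ assms(2,3), of g f] assms(4) by auto
  then show ?thesis using False tangent_nongerm[OF assms(1)] by simp
qed

lemma tangent_zero: "(\<lambda>f. 0) \<in> tangent A p"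
  by (auto simp: tangent_def)

lemma tangent_comb:
  assumes "v \<in> tangent A p" "w \<in> tangent A p"
  shows "(\<lambda>f. a * v f + b * w f) \<in> tangent A p"
  using assms unfolding tangent_def by (auto simp: algebra_simps)

lemma tangent_sum:
  assumes "finite I" "\<And>i. i \<in> I \<Longrightarrow> v i \<in> tangent A p"
  shows "(\<lambda>f. \<Sum>i\<in>I. c i * v i f) \<in> tangent A p"
  using assms
proof (induction I rule: finite_induct)
  case empty
  then show ?case by (simp add: tangent_zero)
next
  case (insert i I)
  then show ?case using tangent_comb[of "v i" p "\<lambda>f. \<Sum>i\<in>I. c i * v i f" "c i" 1] by simp
qed

section \<open>Vector fields near a point and locality of connections\<close>

lemma smooth_vfield_restrict:
  "smooth_vfield A U X \<Longrightarrow> open V \<Longrightarrow> V \<subseteq> U \<Longrightarrow> smooth_vfield A V X"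
  by (auto simp: smooth_vfield_def)

lemma smooth_vfield_zero: "open U \<Longrightarrow> smooth_vfield A U (\<lambda>p f. 0)"
  using smooth_fun_const[OF A] by (auto simp: smooth_vfield_def tangent_zero dest: smooth_fun_open)

lemma smooth_vfield_cong:
  assumes "smooth_vfield A U X" "\<And>p. p \<in> U \<Longrightarrow> X p = Y p"
  shows "smooth_vfield A U Y"
proof -
  have "smooth_fun A V (\<lambda>p. Y p f)" if "V \<subseteq> U" "smooth_fun A V f" for V f
  proof (rule smooth_fun_cong[OF A])
    show "smooth_fun A V (\<lambda>p. X p f)" using assms(1) that by (auto simp: smooth_vfield_def)
  qed (use assms(2) that in auto)
  then show ?thesis using assms by (auto simp: smooth_vfield_def)
qed

lemma smooth_vfield_UN:
  assumes "\<And>i. i \<in> I \<Longrightarrow> smooth_vfield A (U i) X"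
  shows "smooth_vfield A (\<Union>i\<in>I. U i) X"
  unfolding smooth_vfield_def
proof (safe)
  show "open (\<Union>i\<in>I. U i)" using assms by (auto simp: smooth_vfield_def)
  show "X p \<in> tangent A p" if "p \<in> U i" "i \<in> I" for p i
    using assms that by (auto simp: smooth_vfield_def)
  fix V f assume V: "V \<subseteq> (\<Union>i\<in>I. U i)" "smooth_fun A V f"
  have "smooth_fun A (V \<inter> U i) (\<lambda>p. X p f)" if "i \<in> I" for i
  proof -
    have "open (U i)" using assms that by (auto simp: smooth_vfield_def)
    then have "smooth_fun A (V \<inter> U i) f"
      using V(2) smooth_fun_open[OF V(2)] by (auto intro: smooth_fun_subset)
    then show ?thesis using assms[OF that] by (auto simp: smooth_vfield_def)
  qed
  then have "smooth_fun A (\<Union>i\<in>I. V \<inter> U i) (\<lambda>p. X p f)" by (rule smooth_fun_UN[OF A])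
  moreover have "(\<Union>i\<in>I. V \<inter> U i) = V" using V(1) by auto
  ultimately show "smooth_fun A V (\<lambda>p. X p f)" by simp
qed

lemma smooth_vfield_nearI: "smooth_vfield A U X \<Longrightarrow> p \<in> U \<Longrightarrow> smooth_vfield_near A p X"
  by (auto simp: smooth_vfield_near_def)

lemma smooth_vfield_near_tangent: "smooth_vfield_near A p X \<Longrightarrow> X p \<in> tangent A p"
  by (auto simp: smooth_vfield_near_def smooth_vfield_def)

lemma smooth_vfield_near_germ:
  assumes "smooth_vfield_near A p X" "f \<in> germs A p"
  shows "(\<lambda>q. X q f) \<in> germs A p"
proof -
  obtain U V where U: "p \<in> U" "smooth_vfield A U X" "p \<in> V" "smooth_fun A V f"
    using assms by (auto simp: smooth_vfield_near_def germs_def)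
  then have "smooth_fun A (V \<inter> U) f"
    by (auto intro: smooth_fun_subset dest: smooth_fun_open simp: smooth_vfield_def)
  then have "smooth_fun A (V \<inter> U) (\<lambda>q. X q f)"
    using U(2) by (auto simp: smooth_vfield_def)
  then show ?thesis using U by (auto intro: germsI)
qed

lemma smooth_vfield_near_cong:
  assumes "smooth_vfield_near A p X" "open W" "p \<in> W" "\<And>q. q \<in> W \<Longrightarrow> X q = Y q"
  shows "smooth_vfield_near A p Y"
proof -
  obtain U where U: "p \<in> U" "smooth_vfield A U X"
    using assms by (auto simp: smooth_vfield_near_def)
  then have "smooth_vfield A (U \<inter> W) X"
    using assms(2) by (auto intro: smooth_vfield_restrict simp: smooth_vfield_def)
  then have "smooth_vfield A (U \<inter> W) Y"
    using smooth_vfield_cong assms(4) by blast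
  then show ?thesis using U assms(3) by (auto intro: smooth_vfield_nearI)
qed

text \<open>The indicator h of W again serves as cutoff: h Y = h Z everywhere, and the Leibniz rule
  of D with v(h) = 0 and h(p) = 1 removes h from both covariant derivatives.\<close>

lemma connection_local:
  assumes D: "affine_connection A D" and v: "v \<in> tangent A p"
    and Y: "smooth_vfield_near A p Y" and W: "open W" "p \<in> W" "\<And>q. q \<in> W \<Longrightarrow> Y q = Z q"
  shows "D p v Y = D p v Z"
proof -
  let ?h = "\<lambda>q. if q \<in> W then 1 else 0 :: real"
  have Z: "smooth_vfield_near A p Z" using smooth_vfield_near_cong[OF Y W] .
  have leib: "D p v (\<lambda>q f. ?h q * X q f) = (\<lambda>f. v ?h * X p f + ?h p * D p v X f)"
    if "smooth_vfield_near A p X" for X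
    using D[unfolded affine_connection_def, THEN conjunct2, THEN conjunct2, THEN conjunct2, THEN conjunct2,
        rule_format, OF v indicator_germ[OF W(1,2)] that] .
  have eq: "D p v (\<lambda>q f. ?h q * X q f) = D p v X" if "smooth_vfield_near A p X" for X
    unfolding leib[OF that] tangent_indicator[OF v W(1,2)] using W(2) by simp
  have "(\<lambda>q f. ?h q * Y q f) = (\<lambda>q f. ?h q * Z q f)" using W(3) by auto
  then show ?thesis using eq[OF Y] eq[OF Z] by simp
qed

end

section \<open>Levi-Civita connections\<close>

context
  fixes M :: "('a::{t2_space,second_countable_topology}, 'e::euclidean_space) riem"
  assumes M: "riemannian_manifold M"
begin

lemma riemannian_atlas: "smooth_atlas (charts M)"
  and riemannian_affine_connection: "affine_connection (charts M) (conn M)"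
  using M by (auto simp: riemannian_manifold_def levi_civita_def)

lemma metric_sym: "u \<in> tspace M p \<Longrightarrow> v \<in> tspace M p \<Longrightarrow> metric M p u v = metric M p v u"
  using M by (auto simp: riemannian_manifold_def riemannian_metric_def)

lemma metric_comb_left:
  assumes "u \<in> tspace M p" "v \<in> tspace M p" "w \<in> tspace M p"
  shows "metric M p (\<lambda>f. a * u f + b * v f) w = a * metric M p u w + b * metric M p v w"
  using assms M unfolding riemannian_manifold_def riemannian_metric_def by blast

lemma metric_zero_left: "w \<in> tspace M p \<Longrightarrow> metric M p (\<lambda>f. 0) w = 0"
  using metric_comb_left[of w p w w 0 0] by simp

lemma metric_zero_right: "w \<in> tspace M p \<Longrightarrow> metric M p w (\<lambda>f. 0) = 0"
  using metric_zero_left metric_sym tangent_zero[OF riemannian_atlas] by metis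

lemma metric_diff_left:
  assumes "u \<in> tspace M p" "v \<in> tspace M p" "w \<in> tspace M p"
  shows "metric M p (\<lambda>f. u f - v f) w = metric M p u w - metric M p v w"
  using metric_comb_left[OF assms, of 1 "-1"] by simp

lemma metric_sum_left:
  assumes "finite I" "\<And>i. i \<in> I \<Longrightarrow> v i \<in> tspace M p" "w \<in> tspace M p"
  shows "metric M p (\<lambda>f. \<Sum>i\<in>I. c i * v i f) w = (\<Sum>i\<in>I. c i * metric M p (v i) w)"
  using assms(1,2)
proof (induction rule: finite_induct)
  case empty
  then show ?case using metric_zero_left assms(3) by simp
next
  case (insert i I)
  then show ?case
    using metric_comb_left[of "v i" p "\<lambda>f. \<Sum>i\<in>I. c i * v i f" w "c i" 1] assms(3)
      tangent_sum[OF riemannian_atlas, of I v p c] by simp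
qed

lemma metric_sum_right:
  assumes "finite I" "\<And>i. i \<in> I \<Longrightarrow> v i \<in> tspace M p" "w \<in> tspace M p"
  shows "metric M p w (\<lambda>f. \<Sum>i\<in>I. c i * v i f) = (\<Sum>i\<in>I. c i * metric M p w (v i))"
  using metric_sum_left[OF assms] metric_sym[OF assms(3)] assms
    tangent_sum[OF riemannian_atlas, of I v p c] by simp

lemma conn_tangent:
  assumes "v \<in> tspace M p" "smooth_vfield_near (charts M) p Y"
  shows "conn M p v Y \<in> tspace M p"
  using assms riemannian_affine_connection unfolding affine_connection_def by blast

lemma conn_comb:
  assumes "v \<in> tspace M p" "w \<in> tspace M p" "smooth_vfield_near (charts M) p Y"
  shows "conn M p (\<lambda>f. a * v f + b * w f) Y = (\<lambda>f. a * conn M p v Y f + b * conn M p w Y f)"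
  using assms riemannian_affine_connection unfolding affine_connection_def by blast

lemma conn_zero:
  assumes "smooth_vfield_near (charts M) p Y"
  shows "conn M p (\<lambda>f. 0) Y = (\<lambda>f. 0)"
  using conn_comb[OF _ _ assms, of "\<lambda>f. 0" "\<lambda>f. 0" 0 0] tangent_zero[OF riemannian_atlas] by simp

lemma conn_sum:
  assumes "finite I" "\<And>i. i \<in> I \<Longrightarrow> v i \<in> tspace M p" "smooth_vfield_near (charts M) p Y"
  shows "conn M p (\<lambda>f. \<Sum>i\<in>I. c i * v i f) Y = (\<lambda>f. \<Sum>i\<in>I. c i * conn M p (v i) Y f)"
  using assms(1,2)
proof (induction rule: finite_induct)
  case empty
  then show ?case using conn_zero assms(3) by simp
next
  case (insert i I)
  then show ?case
    using conn_comb[of "v i" p "\<lambda>f. \<Sum>i\<in>I. c i * v i f" Y "c i" 1] assms(3)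
      tangent_sum[OF riemannian_atlas, of I v p c] by simp
qed

lemma metric_conn_sum:
  assumes "finite I" "\<And>i. i \<in> I \<Longrightarrow> v i \<in> tspace M p" "smooth_vfield_near (charts M) p Y" "w \<in> tspace M p"
  shows "metric M p (conn M p (\<lambda>f. \<Sum>i\<in>I. c i * v i f) Y) w = (\<Sum>i\<in>I. c i * metric M p (conn M p (v i) Y) w)"
proof -
  have "conn M p (\<lambda>f. \<Sum>i\<in>I. c i * v i f) Y = (\<lambda>f. \<Sum>i\<in>I. c i * conn M p (v i) Y f)"
    by (rule conn_sum) (use assms in auto)
  then show ?thesis
    by (simp only:) (rule metric_sum_left, use assms conn_tangent in auto)
qed

lemma conn_metric:
  assumes "v \<in> tspace M p" "smooth_vfield_near (charts M) p Y" "smooth_vfield_near (charts M) p Z"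
  shows "v (\<lambda>q. metric M q (Y q) (Z q)) = metric M p (conn M p v Y) (Z p) + metric M p (Y p) (conn M p v Z)"
  using assms M unfolding riemannian_manifold_def levi_civita_def by blast

lemma conn_torsion_free:
  assumes "smooth_vfield_near (charts M) p X" "smooth_vfield_near (charts M) p Y"
  shows "lie_bracket (charts M) X Y p = (\<lambda>f. conn M p (X p) Y f - conn M p (Y p) X f)"
  using assms M unfolding riemannian_manifold_def levi_civita_def by metis

lemma lie_bracket_tangent:
  assumes "smooth_vfield_near (charts M) p X" "smooth_vfield_near (charts M) p Y"
  shows "lie_bracket (charts M) X Y p \<in> tspace M p"
  using tangent_comb[OF riemannian_atlas, of "conn M p (X p) Y" p "conn M p (Y p) X" 1 "-1"]
    conn_torsion_free[OF assms] conn_tangent assms smooth_vfield_near_tangent[OF riemannian_atlas] by simp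

lemma metric_lie_bracket:
  assumes "smooth_vfield_near (charts M) p X" "smooth_vfield_near (charts M) p Y" "w \<in> tspace M p"
  shows "metric M p (lie_bracket (charts M) X Y p) w =
    metric M p (conn M p (X p) Y) w - metric M p (conn M p (Y p) X) w"
  unfolding conn_torsion_free[OF assms(1,2)]
  by (intro metric_diff_left conn_tangent assms smooth_vfield_near_tangent[OF riemannian_atlas])

text \<open>The function g(Y, Z) is constant near p, so v annihilates it and metric compatibility
  leaves two terms with sum zero. For an orthonormal frame this is the skewness of the connection
  matrix.\<close>

lemma conn_antisym:
  assumes v: "v \<in> tspace M p"
    and YZ: "smooth_vfield_near (charts M) p Y" "smooth_vfield_near (charts M) p Z"
    and W: "open W" "p \<in> W" "\<And>q. q \<in> W \<Longrightarrow> metric M q (Y q) (Z q) = a"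
  shows "metric M p (conn M p v Y) (Z p) = - metric M p (conn M p v Z) (Y p)"
proof -
  have "v (\<lambda>q. metric M q (Y q) (Z q)) = 0"
    using tangent_local[OF riemannian_atlas v W] tangent_const[OF riemannian_atlas v] by simp
  then show ?thesis
    using conn_metric[OF v YZ] metric_sym[of "Y p" p "conn M p v Z"] conn_tangent[OF v YZ(2)]
      smooth_vfield_near_tangent[OF riemannian_atlas YZ(1)] by simp
qed

text \<open>The derivative terms of the general formula vanish because the three inner products are
  constant near p. Three instances of \<open>conn_antisym\<close> and torsion-freeness give the
  rest. Only brackets survive, and these are compatible with projections.\<close>

lemma koszul:
  assumes X: "smooth_vfield_near (charts M) p X" and Y: "smooth_vfield_near (charts M) p Y"
    and Z: "smooth_vfield_near (charts M) p Z"
    and W: "open W" "p \<in> W"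
    and const: "\<And>q. q \<in> W \<Longrightarrow> metric M q (X q) (Y q) = a" "\<And>q. q \<in> W \<Longrightarrow> metric M q (X q) (Z q) = b"
      "\<And>q. q \<in> W \<Longrightarrow> metric M q (Y q) (Z q) = c"
  shows "2 * metric M p (conn M p (X p) Y) (Z p) =
    metric M p (lie_bracket (charts M) X Y p) (Z p) - metric M p (lie_bracket (charts M) X Z p) (Y p)
    - metric M p (lie_bracket (charts M) Y Z p) (X p)"
  using conn_antisym[OF _ Y Z W const(3), of "X p"] conn_antisym[OF _ X Z W const(2), of "Y p"]
    conn_antisym[OF _ X Y W const(1), of "Z p"]
  by (simp add: X Y Z metric_lie_bracket smooth_vfield_near_tangent[OF riemannian_atlas])

text \<open>\<open>orthonormal_frame\<close> only provides some coefficients; pairing with the frame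
  vectors identifies them.\<close>

lemma orthonormal_expansion:
  assumes e: "orthonormal_frame M U e" and p: "p \<in> U" and v: "v \<in> tspace M p"
  shows "v = (\<lambda>f. \<Sum>j<DIM('e). metric M p v (e j p) * e j p f)"
proof -
  obtain c where c: "v = (\<lambda>f. \<Sum>j<DIM('e). c j * e j p f)"
    using e p v unfolding orthonormal_frame_def by blast
  have et: "e j p \<in> tspace M p" if "j < DIM('e)" for j
    using e p that by (auto simp: orthonormal_frame_def smooth_vfield_def)
  have "metric M p v (e k p) = c k" if k: "k < DIM('e)" for k
  proof -
    have "metric M p v (e k p) = (\<Sum>j<DIM('e). c j * metric M p (e j p) (e k p))"
      unfolding c by (rule metric_sum_left) (use et k in auto)
    also have "\<dots> = (\<Sum>j<DIM('e). if j = k then c j else 0)"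
      using e p k by (intro sum.cong) (auto simp: orthonormal_frame_def)
    finally show ?thesis using k by simp
  qed
  then have "(\<lambda>f. \<Sum>j<DIM('e). metric M p v (e j p) * e j p f) = (\<lambda>f. \<Sum>j<DIM('e). c j * e j p f)"
    by (intro ext sum.cong) auto
  then show ?thesis using c by simp
qed

end

section \<open>Pushforwards and related vector fields\<close>

lemma pushforward_sum:
  "pushforward B F p (\<lambda>f. \<Sum>i\<in>I. c i * v i f) = (\<lambda>f. \<Sum>i\<in>I. c i * pushforward B F p (v i) f)"
  by (auto simp: pushforward_def)

lemma smooth_fun_compose:
  assumes "smooth_map_on A UNIV B F" "smooth_fun B V f"
  shows "smooth_fun A (F -` V) (\<lambda>p. f (F p))"
proof -
  have "smooth_fun A (UNIV \<inter> F -` V) (f \<circ> F)"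
    using assms unfolding smooth_map_on_def by blast
  then show ?thesis by (simp add: o_def)
qed

lemma smooth_map_germs:
  assumes "smooth_map_on A UNIV B F" "f \<in> germs B (F p)"
  shows "f \<circ> F \<in> germs A p"
proof -
  obtain V where "F p \<in> V" "smooth_fun B V f" using assms(2) by (auto simp: germs_def)
  then show ?thesis
    using smooth_fun_compose[OF assms(1)] by (auto simp: germs_def o_def)
qed

lemma smooth_cfun_compose:
  "smooth_map_on A UNIV B F \<Longrightarrow> smooth_cfun B V f \<Longrightarrow> smooth_cfun A (F -` V) (\<lambda>p. f (F p))"
  by (simp add: smooth_cfun_def smooth_fun_compose[of A B F V "\<lambda>p. Re (f p)"]
      smooth_fun_compose[of A B F V "\<lambda>p. Im (f p)"])

context
  fixes A :: "('a::{t2_space,second_countable_topology}, 'e::euclidean_space) atlas"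
    and B :: "('b::{t2_space,second_countable_topology}, 'f::euclidean_space) atlas"
    and F :: "'a \<Rightarrow> 'b"
  assumes A: "smooth_atlas A" and B: "smooth_atlas B" and F: "smooth_map_on A UNIV B F"
begin

lemma pushforward_tangent:
  assumes v: "v \<in> tangent A p"
  shows "pushforward B F p v \<in> tangent B (F p)"
proof -
  have "v ((\<lambda>q. a * f q + b * g q) \<circ> F) = a * v (f \<circ> F) + b * v (g \<circ> F)"
    "v ((\<lambda>q. f q * g q) \<circ> F) = v (f \<circ> F) * g (F p) + f (F p) * v (g \<circ> F)"
    if "f \<in> germs B (F p)" "g \<in> germs B (F p)" for f g a b
    using tangent_lin[OF A v smooth_map_germs[OF F that(1)] smooth_map_germs[OF F that(2)]]
      tangent_mult[OF A v smooth_map_germs[OF F that(1)] smooth_map_germs[OF F that(2)]]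
    by (simp_all add: o_def)
  moreover have "(\<lambda>q. a * f q + b * g q) \<in> germs B (F p)" "(\<lambda>q. f q * g q) \<in> germs B (F p)"
    if "f \<in> germs B (F p)" "g \<in> germs B (F p)" for f g a b
    using that by (auto intro!: germs_add germs_mult germs_const B)
  ultimately show ?thesis
    by (simp add: tangent_def pushforward_def)
qed

text \<open>For related fields, Y(f o F) = (Y' f) o F. Differentiating once more along X and
  exchanging the roles gives both halves of the bracket. The identity holds only near p, where f is
  smooth and the fields are related, so locality of X at p is needed.\<close>

lemma pushforward_lie_bracket:
  assumes X: "smooth_vfield_near A p X" "smooth_vfield_near B (F p) X'"
    and Y: "smooth_vfield_near A p Y" "smooth_vfield_near B (F p) Y'"
    and W: "open W" "p \<in> W"
    and rel: "\<And>q. q \<in> W \<Longrightarrow> pushforward B F q (X q) = X' (F q)"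
      "\<And>q. q \<in> W \<Longrightarrow> pushforward B F q (Y q) = Y' (F q)"
  shows "pushforward B F p (lie_bracket A X Y p) = lie_bracket B X' Y' (F p)"
proof
  fix f
  show "pushforward B F p (lie_bracket A X Y p) f = lie_bracket B X' Y' (F p) f"
  proof (cases "f \<in> germs B (F p)")
    case True
    then obtain V where V: "F p \<in> V" "smooth_fun B V f" by (auto simp: germs_def)
    have VW: "open (F -` V \<inter> W)"
      using F smooth_fun_open[OF V(2)] W(1) by (simp add: smooth_map_on_def open_vimage open_Int)
    \<comment> \<open>Stated for arbitrary related fields, since it is used twice, with X and Y
      exchanged.\<close>
    have *: "X p (\<lambda>q. Y q (f \<circ> F)) = X' (F p) (\<lambda>y. Y' y f)"
      if X: "smooth_vfield_near A p X" "smooth_vfield_near B (F p) X'"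
        and Y: "smooth_vfield_near B (F p) Y'"
        and rel: "\<And>q. q \<in> W \<Longrightarrow> pushforward B F q (X q) = X' (F q)"
          "\<And>q. q \<in> W \<Longrightarrow> pushforward B F q (Y q) = Y' (F q)" for X X' Y Y'
    proof -
      have "Y q (f \<circ> F) = ((\<lambda>y. Y' y f) \<circ> F) q" if "q \<in> F -` V \<inter> W" for q
      proof -
        have "f \<in> germs B (F q)" using that V(2) by (auto intro: germsI)
        then have "Y q (f \<circ> F) = pushforward B F q (Y q) f" by (simp add: pushforward_def)
        then show ?thesis using rel(2) that by simp
      qed
      then have "X p (\<lambda>q. Y q (f \<circ> F)) = X p ((\<lambda>y. Y' y f) \<circ> F)"
        by (intro tangent_local[OF A smooth_vfield_near_tangent[OF A X(1)] VW]) (use V(1) W(2) in simp)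
      also have "\<dots> = pushforward B F p (X p) (\<lambda>y. Y' y f)"
        using smooth_vfield_near_germ[OF B Y True] by (simp add: pushforward_def)
      finally show ?thesis using rel(1) W(2) by simp
    qed
    show ?thesis
      using True smooth_map_germs[OF F True]
      by (simp add: pushforward_def lie_bracket_def *[OF X Y(2) rel] *[OF Y X(2) rel(2,1)])
  next
    case False
    then show ?thesis by (simp add: pushforward_def lie_bracket_def)
  qed
qed

end


section \<open>Flows with adapted frames\<close>

text \<open>The common situation of both parts: all that is used about the projection is that \<open>\<xi>\<close>
  is vertical and that the projection is isometric on \<open>Q\<close>.\<close>

locale basic_flow =
  fixes N :: "('b::{t2_space,second_countable_topology}, 'e::euclidean_space) riem"
    and M :: "('a::{t2_space,second_countable_topology}, real \<times> 'e) riem"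
    and \<pi> :: "'a \<Rightarrow> 'b" and \<xi> :: "'a vfield"
    and SN :: "('i, 'b) spin" and SM :: "('i, 'a) spin"
  assumes base: "riemannian_manifold N" and total: "riemannian_manifold M"
    and base_spin: "spin_structure N SN"
    and induced: "induced_spin_structure N SN M \<pi> \<xi> SM"
    and smooth_projection: "smooth_map_on (charts M) UNIV (charts N) \<pi>"
    and vertical: "\<And>p. pushforward (charts N) \<pi> p (\<xi> p) = (\<lambda>f. 0)"
    and isometric: "\<And>p v w. v \<in> transversal_space M \<xi> p \<Longrightarrow> w \<in> transversal_space M \<xi> p \<Longrightarrow>
      metric M p v w = metric N (\<pi> p) (pushforward (charts N) \<pi> p v) (pushforward (charts N) \<pi> p w)"
begin

abbreviation "push \<equiv> pushforward (charts N) \<pi>"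

lemmas atlas_M = riemannian_atlas[OF total]
lemmas atlas_N = riemannian_atlas[OF base]
lemmas push_tangent = pushforward_tangent[OF atlas_M atlas_N smooth_projection]

lemma total_spin: "spin_structure M SM"
  using induced by (simp add: induced_spin_structure_def)

lemma index_eq: "index SM = index SN"
  using induced by (simp add: induced_spin_structure_def)

lemma patch_eq: "i \<in> index SN \<Longrightarrow> patch SM i = \<pi> -` patch SN i"
  using induced by (simp add: induced_spin_structure_def)

lemma exists_patch: obtains i where "i \<in> index SN" "\<pi> p \<in> patch SN i"
proof -
  have "\<pi> p \<in> (\<Union>i\<in>index SN. patch SN i)"
    using base_spin by (simp add: spin_structure_def)
  then show thesis using that by blast
qed

lemma open_patch: "i \<in> index SN \<Longrightarrow> open (\<pi> -` patch SN i)"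
  using total_spin by (auto simp: spin_structure_def index_eq patch_eq)

lemma base_frame: "i \<in> index SN \<Longrightarrow> orthonormal_frame N (patch SN i) (frame SN i)"
  using base_spin by (auto simp: spin_structure_def)

lemma total_frame: "i \<in> index SN \<Longrightarrow> orthonormal_frame M (\<pi> -` patch SN i) (frame SM i)"
  using total_spin by (auto simp: spin_structure_def index_eq patch_eq)

lemma frame_0: "i \<in> index SN \<Longrightarrow> \<pi> p \<in> patch SN i \<Longrightarrow> frame SM i 0 p = \<xi> p"
  using induced by (simp add: induced_spin_structure_def)

lemma frame_Suc:
  assumes "i \<in> index SN" "\<pi> p \<in> patch SN i" "j < DIM('e)"
  shows "frame SM i (Suc j) p \<in> transversal_space M \<xi> p" "push p (frame SM i (Suc j) p) = frame SN i j (\<pi> p)"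
  using induced assms by (auto simp: induced_spin_structure_def)

lemma frame_near:
  "i \<in> index SN \<Longrightarrow> \<pi> p \<in> patch SN i \<Longrightarrow> j < Suc DIM('e) \<Longrightarrow> smooth_vfield_near (charts M) p (frame SM i j)"
  using total_frame[of i] by (auto simp: orthonormal_frame_def intro: smooth_vfield_nearI[OF atlas_M])

lemma base_frame_near:
  "i \<in> index SN \<Longrightarrow> x \<in> patch SN i \<Longrightarrow> j < DIM('e) \<Longrightarrow> smooth_vfield_near (charts N) x (frame SN i j)"
  using base_frame[of i] by (auto simp: orthonormal_frame_def intro: smooth_vfield_nearI[OF atlas_N])

lemma frame_tangent:
  "i \<in> index SN \<Longrightarrow> \<pi> p \<in> patch SN i \<Longrightarrow> j < Suc DIM('e) \<Longrightarrow> frame SM i j p \<in> tspace M p"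
  using frame_near smooth_vfield_near_tangent[OF atlas_M] by blast

lemma base_frame_tangent:
  "i \<in> index SN \<Longrightarrow> x \<in> patch SN i \<Longrightarrow> j < DIM('e) \<Longrightarrow> frame SN i j x \<in> tspace N x"
  using base_frame_near smooth_vfield_near_tangent[OF atlas_N] by blast

lemma frame_metric:
  "i \<in> index SN \<Longrightarrow> \<pi> p \<in> patch SN i \<Longrightarrow> j < Suc DIM('e) \<Longrightarrow> k < Suc DIM('e) \<Longrightarrow>
    metric M p (frame SM i j p) (frame SM i k p) = (if j = k then 1 else 0)"
  using total_frame[of i] by (auto simp: orthonormal_frame_def)

lemma base_frame_metric:
  "i \<in> index SN \<Longrightarrow> x \<in> patch SN i \<Longrightarrow> j < DIM('e) \<Longrightarrow> k < DIM('e) \<Longrightarrow>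
    metric N x (frame SN i j x) (frame SN i k x) = (if j = k then 1 else 0)"
  using base_frame[of i] by (auto simp: orthonormal_frame_def)

text \<open>Over every patch \<xi> is the vector with index 0 of the adapted frame, so its
  smoothness comes with the spin structure of M and is glued over the patches.\<close>

lemma flow_smooth: "smooth_vfield (charts M) UNIV \<xi>"
proof -
  have "smooth_vfield (charts M) (\<pi> -` patch SN i) \<xi>" if "i \<in> index SN" for i
  proof (rule smooth_vfield_cong[OF atlas_M])
    show "smooth_vfield (charts M) (\<pi> -` patch SN i) (frame SM i 0)"
      using total_frame[OF that] by (simp add: orthonormal_frame_def)
  qed (use frame_0[OF that] in auto)
  then have "smooth_vfield (charts M) (\<Union>i\<in>index SN. \<pi> -` patch SN i) \<xi>"
    by (rule smooth_vfield_UN[OF atlas_M])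
  moreover have "p \<in> (\<Union>i\<in>index SN. \<pi> -` patch SN i)" for p
    using exists_patch[of p] by auto
  then have "(\<Union>i\<in>index SN. \<pi> -` patch SN i) = UNIV"
    by auto
  ultimately show ?thesis by simp
qed

lemma flow_near: "smooth_vfield_near (charts M) p \<xi>"
  using flow_smooth smooth_vfield_nearI[OF atlas_M] by blast

lemma flow_tangent: "\<xi> p \<in> tspace M p"
  using flow_near smooth_vfield_near_tangent[OF atlas_M] by blast

lemma flow_unit: "metric M p (\<xi> p) (\<xi> p) = 1"
proof -
  obtain i where "i \<in> index SN" "\<pi> p \<in> patch SN i" by (rule exists_patch)
  then show ?thesis using frame_metric[of i p 0 0] frame_0 by simp
qed

lemma transversal_tangent: "v \<in> transversal_space M \<xi> p \<Longrightarrow> v \<in> tspace M p"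
  by (simp add: transversal_space_def)

text \<open>One horizontal argument suffices: the vertical component of v is orthogonal to w and is
  killed by the projection, so v may be replaced by its horizontal component
  \<open>?z\<close>.\<close>

lemma metric_push:
  assumes v: "v \<in> tspace M p" and w: "w \<in> transversal_space M \<xi> p"
  shows "metric M p v w = metric N (\<pi> p) (push p v) (push p w)"
proof -
  let ?z = "\<lambda>f. 1 * v f + (- metric M p v (\<xi> p)) * \<xi> p f"
  have z: "?z \<in> tspace M p"
    using tangent_comb[OF atlas_M v flow_tangent] .
  have "?z \<in> transversal_space M \<xi> p"
    using z metric_comb_left[OF total v flow_tangent flow_tangent, of 1 "- metric M p v (\<xi> p)"]
    by (simp add: transversal_space_def flow_unit)
  then have "metric M p ?z w = metric N (\<pi> p) (push p ?z) (push p w)"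
    using isometric w by blast
  moreover have "metric M p ?z w = metric M p v w"
    using metric_comb_left[OF total v flow_tangent transversal_tangent[OF w], of 1 "- metric M p v (\<xi> p)"]
      w metric_sym[OF total flow_tangent[of p], of w] by (simp add: transversal_space_def)
  moreover have "push p ?z = push p v"
    using vertical[of p] by (auto simp: pushforward_def fun_eq_iff split: if_splits)
  ultimately show ?thesis by simp
qed

lemma transversal_expansion:
  assumes i: "i \<in> index SN" "\<pi> p \<in> patch SN i" and v: "v \<in> transversal_space M \<xi> p"
  shows "v = (\<lambda>f. \<Sum>j<DIM('e). metric M p v (frame SM i (Suc j) p) * frame SM i (Suc j) p f)"
  using orthonormal_expansion[OF total total_frame[OF i(1)], of p v] i v frame_0[OF i]
  by (simp add: transversal_space_def sum.lessThan_Suc_shift del: sum.lessThan_Suc)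

lemma metric_frame_push:
  assumes i: "i \<in> index SN" "\<pi> p \<in> patch SN i" and v: "v \<in> tspace M p" and k: "k < DIM('e)"
  shows "metric M p v (frame SM i (Suc k) p) = metric N (\<pi> p) (push p v) (frame SN i k (\<pi> p))"
  using metric_push[OF v frame_Suc(1)[OF i k]] frame_Suc(2)[OF i k] by simp

lemma lie_bracket_frame:
  assumes i: "i \<in> index SN" "\<pi> p \<in> patch SN i" and j: "j < DIM('e)" and k: "k < DIM('e)" and l: "l < DIM('e)"
  shows "metric M p (lie_bracket (charts M) (frame SM i (Suc j)) (frame SM i (Suc k)) p) (frame SM i (Suc l) p)
    = metric N (\<pi> p) (lie_bracket (charts N) (frame SN i j) (frame SN i k) (\<pi> p)) (frame SN i l (\<pi> p))"
proof -
  have "push p (lie_bracket (charts M) (frame SM i (Suc j)) (frame SM i (Suc k)) p)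
    = lie_bracket (charts N) (frame SN i j) (frame SN i k) (\<pi> p)"
    by (rule pushforward_lie_bracket[OF atlas_M atlas_N smooth_projection _ _ _ _ open_patch[OF i(1)]])
      (use i j k frame_near base_frame_near frame_Suc in auto)
  then show ?thesis
    using metric_frame_push[OF i _ l] lie_bracket_tangent[OF total] frame_near[OF i] j k by simp
qed

lemma conn_frame:
  assumes i: "i \<in> index SN" "\<pi> p \<in> patch SN i" and j: "j < DIM('e)" and k: "k < DIM('e)" and l: "l < DIM('e)"
  shows "metric M p (conn M p (frame SM i (Suc j) p) (frame SM i (Suc k))) (frame SM i (Suc l) p)
    = metric N (\<pi> p) (conn N (\<pi> p) (frame SN i j (\<pi> p)) (frame SN i k)) (frame SN i l (\<pi> p))"
proof -
  have "open (patch SN i)"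
    using base_spin i by (auto simp: spin_structure_def)
  then show ?thesis
    using koszul[OF total frame_near[OF i, of "Suc j"] frame_near[OF i, of "Suc k"] frame_near[OF i, of "Suc l"]
        open_patch[OF i(1)] _ frame_metric[OF i(1)] frame_metric[OF i(1)] frame_metric[OF i(1)]]
      koszul[OF base base_frame_near[OF i, of "j"] base_frame_near[OF i, of "k"] base_frame_near[OF i, of "l"]
        _ i(2) base_frame_metric[OF i(1)] base_frame_metric[OF i(1)] base_frame_metric[OF i(1)]]
      lie_bracket_frame[OF i] j k l i(2)
    by simp
qed

text \<open>Both sides are linear in the direction v at p, and v has the same coefficients in the
  lifted frame as its projection in the frame of N. So the case of frame vectors,
  \<open>conn_frame\<close>, is enough.\<close>

lemma conn_transversal:
  assumes i: "i \<in> index SN" "\<pi> p \<in> patch SN i" and v: "v \<in> transversal_space M \<xi> p" and k: "k < DIM('e)" and l: "l < DIM('e)"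
  shows "metric M p (conn M p v (frame SM i (Suc k))) (frame SM i (Suc l) p)
    = metric N (\<pi> p) (conn N (\<pi> p) (push p v) (frame SN i k)) (frame SN i l (\<pi> p))"
proof -
  let ?c = "\<lambda>j. metric M p v (frame SM i (Suc j) p)"
  note near = frame_near[OF i, of "Suc k"] base_frame_near[OF i k]
  have t: "frame SM i (Suc j) p \<in> tspace M p" if "j < DIM('e)" for j using frame_tangent i that by simp
  have "push p v = push p (\<lambda>f. \<Sum>j<DIM('e). ?c j * frame SM i (Suc j) p f)"
    using transversal_expansion[OF i v] by simp
  also have "\<dots> = (\<lambda>f. \<Sum>j<DIM('e). ?c j * frame SN i j (\<pi> p) f)"
    unfolding pushforward_sum by (intro ext sum.cong) (use frame_Suc(2)[OF i] in auto)
  finally have push_v: "push p v = (\<lambda>f. \<Sum>j<DIM('e). ?c j * frame SN i j (\<pi> p) f)" .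
  have "metric N (\<pi> p) (conn N (\<pi> p) (push p v) (frame SN i k)) (frame SN i l (\<pi> p)) =
      (\<Sum>j<DIM('e). ?c j * metric N (\<pi> p) (conn N (\<pi> p) (frame SN i j (\<pi> p)) (frame SN i k)) (frame SN i l (\<pi> p)))"
    unfolding push_v
    by (rule metric_conn_sum[OF base]) (use base_frame_tangent[OF i] l near(2) in auto)
  also have "\<dots> = (\<Sum>j<DIM('e). ?c j * metric M p (conn M p (frame SM i (Suc j) p) (frame SM i (Suc k))) (frame SM i (Suc l) p))"
    using conn_frame[OF i _ k l] by simp
  also have "\<dots> = metric M p (conn M p (\<lambda>f. \<Sum>j<DIM('e). ?c j * frame SM i (Suc j) p f) (frame SM i (Suc k))) (frame SM i (Suc l) p)"
    by (rule metric_conn_sum[OF total, symmetric]) (use t l k near(1) in auto)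
  finally show ?thesis using transversal_expansion[OF i v] by simp
qed

section \<open>Covariant derivatives of \<xi> and along \<xi>\<close>

lemma conn_frame_antisym:
  assumes i: "i \<in> index SN" "\<pi> p \<in> patch SN i" and v: "v \<in> tspace M p" and j: "j < Suc DIM('e)" and k: "k < Suc DIM('e)"
  shows "metric M p (conn M p v (frame SM i j)) (frame SM i k p) = - metric M p (conn M p v (frame SM i k)) (frame SM i j p)"
  by (rule conn_antisym[OF total v frame_near[OF i j] frame_near[OF i k] open_patch[OF i(1)] _ frame_metric[OF i(1) _ j k]])
    (use i in auto)

text \<open>\<open>conn\<close> takes a whole field as argument, while the equality of the two
  fields is known on the patch only; locality of the connection closes the gap.\<close>

lemma conn_frame_0:
  assumes i: "i \<in> index SN" "\<pi> p \<in> patch SN i" and v: "v \<in> tspace M p"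
  shows "conn M p v (frame SM i 0) = conn M p v \<xi>"
  by (rule connection_local[OF atlas_M riemannian_affine_connection[OF total] v frame_near[OF i] open_patch[OF i(1)]])
    (use i frame_0 in auto)

text \<open>Being vertical, \<xi> is related to the zero field on N, so its bracket with a
  horizontal lift projects to zero and is not seen by a horizontal vector. Torsion-freeness turns
  this into an equality of covariant derivatives.\<close>

lemma conn_flow_frame:
  assumes i: "i \<in> index SN" "\<pi> p \<in> patch SN i" and j: "j < DIM('e)" and k: "k < DIM('e)"
  shows "metric M p (conn M p (\<xi> p) (frame SM i (Suc j))) (frame SM i (Suc k) p)
    = metric M p (conn M p (frame SM i (Suc j) p) \<xi>) (frame SM i (Suc k) p)"
proof -
  have "open (patch SN i)"
    using base_spin i by (auto simp: spin_structure_def)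
  note zero = smooth_vfield_nearI[OF atlas_N smooth_vfield_zero[OF atlas_N this] i(2)]
  have "push p (lie_bracket (charts M) \<xi> (frame SM i (Suc j)) p)
    = lie_bracket (charts N) (\<lambda>y f. 0) (frame SN i j) (\<pi> p)"
    by (rule pushforward_lie_bracket[OF atlas_M atlas_N smooth_projection flow_near zero _ _ open_patch[OF i(1)]])
      (use i j frame_near base_frame_near frame_Suc vertical in auto)
  also have "\<dots> = (\<lambda>f. 0)"
    using tangent_const[OF atlas_N base_frame_tangent[OF i j]] by (auto simp: lie_bracket_def)
  finally have "metric M p (lie_bracket (charts M) \<xi> (frame SM i (Suc j)) p) (frame SM i (Suc k) p) = 0"
    using metric_frame_push[OF i lie_bracket_tangent[OF total flow_near frame_near[OF i]] k] j
      metric_zero_left[OF base base_frame_tangent[OF i k]] by simp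
  then show ?thesis
    using metric_lie_bracket[OF total flow_near frame_near[OF i], of "Suc j"] frame_tangent[OF i] j k by simp
qed

text \<open>By \<open>conn_flow_frame\<close> the matrix of h in the frame is the connection matrix
  in direction \<xi>, which is skew because the frame is orthonormal.\<close>

lemma flow_h_antisym_frame:
  assumes i: "i \<in> index SN" "\<pi> p \<in> patch SN i" and j: "j < DIM('e)" and k: "k < DIM('e)"
  shows "metric M p (conn M p (frame SM i (Suc j) p) \<xi>) (frame SM i (Suc k) p)
    = - metric M p (conn M p (frame SM i (Suc k) p) \<xi>) (frame SM i (Suc j) p)"
  using conn_frame_antisym[OF i flow_tangent, of "Suc j" "Suc k"] conn_flow_frame[OF i] j k by simp

lemma flow_h_antisym:
  assumes v: "v \<in> transversal_space M \<xi> p" and w: "w \<in> transversal_space M \<xi> p"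
  shows "metric M p (conn M p v \<xi>) w = - metric M p (conn M p w \<xi>) v"
proof -
  obtain i where i: "i \<in> index SN" "\<pi> p \<in> patch SN i" by (rule exists_patch)
  have t: "frame SM i (Suc j) p \<in> tspace M p" if "j < DIM('e)" for j using frame_tangent i that by simp
  let ?a = "\<lambda>j k. metric M p (conn M p (frame SM i (Suc j) p) \<xi>) (frame SM i (Suc k) p)"
  have *: "metric M p (conn M p v \<xi>) w =
      (\<Sum>j<DIM('e). \<Sum>k<DIM('e). metric M p v (frame SM i (Suc j) p) * (metric M p w (frame SM i (Suc k) p) * ?a j k))"
    if v: "v \<in> transversal_space M \<xi> p" and w: "w \<in> transversal_space M \<xi> p" for v w
  proof -
    have "metric M p (conn M p v \<xi>) w = metric M p (conn M p
        (\<lambda>f. \<Sum>j<DIM('e). metric M p v (frame SM i (Suc j) p) * frame SM i (Suc j) p f) \<xi>) w"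
      using transversal_expansion[OF i v] by simp
    also have "\<dots> = (\<Sum>j<DIM('e). metric M p v (frame SM i (Suc j) p) * metric M p (conn M p (frame SM i (Suc j) p) \<xi>) w)"
      by (rule metric_conn_sum[OF total]) (use t flow_near transversal_tangent[OF w] in auto)
    also have "\<dots> = (\<Sum>j<DIM('e). metric M p v (frame SM i (Suc j) p) * metric M p (conn M p (frame SM i (Suc j) p) \<xi>)
        (\<lambda>f. \<Sum>k<DIM('e). metric M p w (frame SM i (Suc k) p) * frame SM i (Suc k) p f))"
      using transversal_expansion[OF i w] by simp
    also have "\<dots> = (\<Sum>j<DIM('e). \<Sum>k<DIM('e). metric M p v (frame SM i (Suc j) p) * (metric M p w (frame SM i (Suc k) p) * ?a j k))"
      by (intro sum.cong refl, subst metric_sum_right[OF total])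
        (use t flow_near conn_tangent[OF total] in \<open>auto simp: sum_distrib_left algebra_simps\<close>)
    finally show ?thesis .
  qed
  show ?thesis
    unfolding *[OF v w] *[OF w v]
  \<comment> \<open>Exchanging the summations aligns the two expansions, so that skewness can be
    applied entry by entry.\<close>
  proof (subst sum.swap, unfold sum_negf[symmetric], intro sum.cong refl)
    fix j k assume "j \<in> {..<DIM('e)}" "k \<in> {..<DIM('e)}"
    then have "?a k j = - ?a j k" by (intro flow_h_antisym_frame[OF i]) auto
    then show "metric M p v (frame SM i (Suc k) p) * (metric M p w (frame SM i (Suc j) p) * ?a k j) =
        - (metric M p w (frame SM i (Suc j) p) * (metric M p v (frame SM i (Suc k) p) * ?a j k))"
      by simp
  qed
qed

text \<open>By metric compatibility and torsion-freeness the Lie derivative of g along \<xi>,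
  evaluated on Z and W, is g(h(Z), W) + g(Z, h(W)). Skewness of h makes it vanish.\<close>

lemma riemannian_flow: "riemannian_flow M \<xi>"
  unfolding riemannian_flow_def
proof (intro conjI allI impI ballI)
  fix U Z W p
  assume *: "smooth_vfield (charts M) U Z \<and> smooth_vfield (charts M) U W \<and>
    (\<forall>p\<in>U. Z p \<in> transversal_space M \<xi> p \<and> W p \<in> transversal_space M \<xi> p)" and p: "p \<in> U"
  then have near: "smooth_vfield_near (charts M) p Z" "smooth_vfield_near (charts M) p W"
    and Z: "Z p \<in> transversal_space M \<xi> p" and W: "W p \<in> transversal_space M \<xi> p"
    using smooth_vfield_nearI[OF atlas_M] by blast+
  note t = transversal_tangent[OF Z] transversal_tangent[OF W]
  have "metric M p (Z p) u = metric M p u (Z p)" if "u \<in> tspace M p" for u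
    using metric_sym[OF total t(1) that] .
  then show "\<xi> p (\<lambda>q. metric M q (Z q) (W q)) - metric M p (lie_bracket (charts M) \<xi> Z p) (W p)
      - metric M p (Z p) (lie_bracket (charts M) \<xi> W p) = 0"
    using conn_metric[OF total flow_tangent near] metric_lie_bracket[OF total flow_near near(1) t(2)]
      metric_lie_bracket[OF total flow_near near(2) t(1)] flow_h_antisym[OF Z W]
      lie_bracket_tangent[OF total flow_near near(2)] conn_tangent[OF total flow_tangent near(2)]
    by simp
qed (use flow_smooth flow_unit in auto)

end

section \<open>Clifford modules\<close>

lemma index_mult_mat_vec_sum:
  "A \<in> carrier_mat m n \<Longrightarrow> w \<in> carrier_vec n \<Longrightarrow> r < m \<Longrightarrow> (A *\<^sub>v w) $ r = (\<Sum>s<n. A $$ (r, s) * w $ s)"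
  by (auto simp: scalar_prod_def atLeast0LessThan intro!: sum.cong)

lemma clifford_vec_carrier [simp]: "clifford_vec n \<gamma> a \<in> carrier_mat (spin_dim n) (spin_dim n)"
  by (simp add: clifford_vec_def)

lemma clifford_vec_unit:
  assumes "\<And>j. j < n \<Longrightarrow> a j = (if j = k then 1 else 0)" "k < n" "\<gamma> k \<in> carrier_mat (spin_dim n) (spin_dim n)"
  shows "clifford_vec n \<gamma> a = \<gamma> k"
proof -
  have "(\<Sum>j<n. complex_of_real (a j) * \<gamma> j $$ rc) = (\<Sum>j<n. if j = k then \<gamma> j $$ rc else 0)" for rc
    using assms(1) by (intro sum.cong) auto
  then show ?thesis using assms(2,3) by (intro eq_matI) (auto simp: clifford_vec_def)
qed

lemma clifford_vec_mult_index:
  assumes "\<And>j. j < n \<Longrightarrow> \<gamma> j \<in> carrier_mat (spin_dim n) (spin_dim n)" "w \<in> carrier_vec (spin_dim n)" "r < spin_dim n"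
  shows "(clifford_vec n \<gamma> a *\<^sub>v w) $ r = (\<Sum>j<n. of_real (a j) * (\<gamma> j *\<^sub>v w) $ r)"
proof -
  have "(clifford_vec n \<gamma> a *\<^sub>v w) $ r = (\<Sum>s<spin_dim n. \<Sum>j<n. of_real (a j) * \<gamma> j $$ (r, s) * w $ s)"
    using assms by (simp add: index_mult_mat_vec_sum[OF clifford_vec_carrier] sum_distrib_right)
      (simp add: clifford_vec_def sum_distrib_right)
  also have "\<dots> = (\<Sum>j<n. of_real (a j) * (\<gamma> j *\<^sub>v w) $ r)"
    by (subst sum.swap, intro sum.cong refl)
      (simp add: index_mult_mat_vec_sum[OF assms(1) assms(2,3)] sum_distrib_left mult.assoc)
  finally show ?thesis .
qed

lemma mult_clifford_vec_index:
  assumes \<gamma>: "\<And>j. j < n \<Longrightarrow> \<gamma> j \<in> carrier_mat (spin_dim n) (spin_dim n)"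
    and A: "A \<in> carrier_mat (spin_dim n) (spin_dim n)" and w: "w \<in> carrier_vec (spin_dim n)" and r: "r < spin_dim n"
  shows "(A *\<^sub>v (clifford_vec n \<gamma> a *\<^sub>v w)) $ r = (\<Sum>j<n. of_real (a j) * ((A * \<gamma> j) *\<^sub>v w) $ r)"
proof -
  have "(A *\<^sub>v (clifford_vec n \<gamma> a *\<^sub>v w)) $ r =
      (\<Sum>s<spin_dim n. A $$ (r, s) * (\<Sum>j<n. of_real (a j) * (\<gamma> j *\<^sub>v w) $ s))"
    by (subst index_mult_mat_vec_sum[OF A mult_mat_vec_carrier[OF clifford_vec_carrier w] r])
      (intro sum.cong refl, simp add: clifford_vec_mult_index[OF \<gamma> w])
  also have "\<dots> = (\<Sum>j<n. of_real (a j) * (\<Sum>s<spin_dim n. A $$ (r, s) * (\<gamma> j *\<^sub>v w) $ s))"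
    unfolding sum_distrib_left by (subst sum.swap) (simp add: algebra_simps)
  also have "\<dots> = (\<Sum>j<n. of_real (a j) * ((A * \<gamma> j) *\<^sub>v w) $ r)"
    using index_mult_mat_vec_sum[OF A mult_mat_vec_carrier[OF \<gamma> w] r] assoc_mult_mat_vec[OF A \<gamma> w]
    by (intro sum.cong refl) simp
  finally show ?thesis .
qed

text \<open>Used with A = \<xi> and B, C in Q. Moving A past one vector costs a sign, which A A = -1
  compensates; moving it past two costs none. The first part recovers products of two vectors of Q
  from the products \<xi> Z that the identification of the spinor modules prescribes.\<close>

lemma anticommuting_mult:
  fixes A B C :: "'a::comm_ring_1 mat"
  assumes A: "A \<in> carrier_mat m m" and B: "B \<in> carrier_mat m m" and C: "C \<in> carrier_mat m m"
    and AA: "A * A = - 1\<^sub>m m" and BA: "B * A = - (A * B)" and CA: "C * A = - (A * C)"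
  shows "(A * B) * (A * C) = B * C" "A * (B * C) = (B * C) * A"
proof -
  note cl = mult_carrier_mat
  have "(A * B) * (A * C) = A * (B * A * C)"
    using assoc_mult_mat[OF A B cl[OF A C]] assoc_mult_mat[OF B A C] by simp
  also have "B * A * C = - (A * (B * C))"
    unfolding BA using A B C assoc_mult_mat[OF A B C] by simp
  also have "A * - (A * (B * C)) = - (A * (A * (B * C)))"
    using A B C by simp
  also have "A * (A * (B * C)) = - (B * C)"
    using assoc_mult_mat[OF A A cl[OF B C]] B C by (simp add: AA)
  finally show "(A * B) * (A * C) = B * C" using B C by simp
  have "(B * C) * A = B * - (A * C)"
    unfolding assoc_mult_mat[OF B C A] CA ..
  also have "\<dots> = - (B * A * C)"
    using A B C assoc_mult_mat[OF B A C] by simp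
  also have "\<dots> = A * (B * C)"
    unfolding BA using A B C assoc_mult_mat[OF A B C] by simp
  finally show "A * (B * C) = (B * C) * A" ..
qed

lemma spin_group_carrier:
  assumes "s \<in> spin_group n \<gamma>"
  shows "s \<in> carrier_mat (spin_dim n) (spin_dim n)"
  using assms by induction (auto intro!: mult_carrier_mat[of _ _ "spin_dim n"])

text \<open>A 2-form acts by a sum over j < k, the spinorial connection involves a sum over all
  pairs. In the application coefficients and Clifford products are both skew, so that their products
  are symmetric.\<close>

lemma sum_symmetric_strict:
  fixes b :: "nat \<Rightarrow> nat \<Rightarrow> complex"
  assumes "\<And>j k. j < m \<Longrightarrow> k < m \<Longrightarrow> b j k = b k j" "\<And>j. j < m \<Longrightarrow> b j j = 0"
  shows "(\<Sum>j<m. \<Sum>k<m. b j k) = 2 * (\<Sum>k<m. \<Sum>j<k. b j k)"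
  using assms
proof (induction m)
  case (Suc m)
  have "(\<Sum>j<m. b m j) = (\<Sum>j<m. b j m)"
    using Suc.prems by (intro sum.cong) auto
  then show ?case using Suc by (simp add: sum.distrib)
qed simp

text \<open>Index 0 will be that of \<xi>; the entries pairing it with Q occur twice, which is the
  origin of the factor 2.\<close>

lemma sum_Suc_split:
  fixes a :: "nat \<Rightarrow> nat \<Rightarrow> complex"
  assumes "a 0 0 = 0" "\<And>k. k < m \<Longrightarrow> a (Suc k) 0 = a 0 (Suc k)"
  shows "(\<Sum>j<Suc m. \<Sum>k<Suc m. a j k) = (\<Sum>j<m. \<Sum>k<m. a (Suc j) (Suc k)) + 2 * (\<Sum>k<m. a 0 (Suc k))"
  using assms by (simp add: sum.lessThan_Suc_shift sum.distrib del: sum.lessThan_Suc)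

section \<open>Complex-valued germs and their derivatives\<close>

definition cgerms :: "('a::topological_space, 'e::euclidean_space) atlas \<Rightarrow> 'a \<Rightarrow> ('a \<Rightarrow> complex) set" where
  "cgerms A p = {f. (\<lambda>q. Re (f q)) \<in> germs A p \<and> (\<lambda>q. Im (f q)) \<in> germs A p}"

text \<open>The complex-linear extension of a real derivation, in the form of the derivative term of
  \<open>spin_conn\<close>.\<close>

definition cderiv :: "'a tvec \<Rightarrow> ('a \<Rightarrow> complex) \<Rightarrow> complex" where
  "cderiv v f = Complex (v (\<lambda>q. Re (f q))) (v (\<lambda>q. Im (f q)))"

lemma cgermsI: "smooth_cfun A U f \<Longrightarrow> p \<in> U \<Longrightarrow> f \<in> cgerms A p"
  by (auto simp: smooth_cfun_def cgerms_def germs_def)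

context
  fixes A :: "('a::{t2_space,second_countable_topology}, 'e::euclidean_space) atlas"
  assumes A: "smooth_atlas A"
begin

lemma cgerms_const: "(\<lambda>q. a) \<in> cgerms A p"
  by (simp add: cgerms_def germs_const[OF A])

lemma cgerms_add: "f \<in> cgerms A p \<Longrightarrow> g \<in> cgerms A p \<Longrightarrow> (\<lambda>q. f q + g q) \<in> cgerms A p"
  by (simp add: cgerms_def germs_add[OF A])

lemma cgerms_mult:
  assumes "f \<in> cgerms A p" "g \<in> cgerms A p"
  shows "(\<lambda>q. f q * g q) \<in> cgerms A p"
proof -
  have neg: "(\<lambda>q. (-1) * h q) \<in> germs A p" if "h \<in> germs A p" for h
    by (rule germs_mult[OF A germs_const[OF A] that])
  have "(\<lambda>q. Re (f q) * Re (g q) + (-1) * (Im (f q) * Im (g q))) \<in> germs A p"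
    "(\<lambda>q. Re (f q) * Im (g q) + Im (f q) * Re (g q)) \<in> germs A p"
    by (intro germs_add[OF A] germs_mult[OF A] neg; use assms in \<open>simp add: cgerms_def\<close>)+
  then show ?thesis
    by (simp add: cgerms_def)
qed

lemma cgerms_sum: "finite I \<Longrightarrow> (\<And>i. i \<in> I \<Longrightarrow> f i \<in> cgerms A p) \<Longrightarrow> (\<lambda>q. \<Sum>i\<in>I. f i q) \<in> cgerms A p"
  by (induction rule: finite_induct) (auto intro: cgerms_const cgerms_add)

context
  fixes v p
  assumes v: "v \<in> tangent A p"
begin

lemma cderiv_local:
  "open W \<Longrightarrow> p \<in> W \<Longrightarrow> (\<And>q. q \<in> W \<Longrightarrow> f q = g q) \<Longrightarrow> cderiv v f = cderiv v g"
  using tangent_local[OF A v, of W "\<lambda>q. Re (f q)" "\<lambda>q. Re (g q)"]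
    tangent_local[OF A v, of W "\<lambda>q. Im (f q)" "\<lambda>q. Im (g q)"]
  by (simp add: cderiv_def)

lemma cderiv_const: "cderiv v (\<lambda>q. a) = 0"
  by (simp add: cderiv_def tangent_const[OF A v] complex_eq_iff)

lemma cderiv_add:
  "f \<in> cgerms A p \<Longrightarrow> g \<in> cgerms A p \<Longrightarrow> cderiv v (\<lambda>q. f q + g q) = cderiv v f + cderiv v g"
  by (simp add: cgerms_def cderiv_def tangent_add[OF A v] complex_eq_iff)

lemma cderiv_mult:
  assumes "f \<in> cgerms A p" "g \<in> cgerms A p"
  shows "cderiv v (\<lambda>q. f q * g q) = cderiv v f * g p + f p * cderiv v g"
proof -
  note g = assms[unfolded cgerms_def mem_Collect_eq]
  have Re: "(\<lambda>q. Re (f q * g q)) = (\<lambda>q. 1 * (Re (f q) * Re (g q)) + (-1) * (Im (f q) * Im (g q)))"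
    and Im: "(\<lambda>q. Im (f q * g q)) = (\<lambda>q. Re (f q) * Im (g q) + Im (f q) * Re (g q))"
    by auto
  have "v (\<lambda>q. 1 * (Re (f q) * Re (g q)) + (-1) * (Im (f q) * Im (g q))) =
      1 * v (\<lambda>q. Re (f q) * Re (g q)) + (-1) * v (\<lambda>q. Im (f q) * Im (g q))"
    by (rule tangent_lin[OF A v]) (use g germs_mult[OF A] in auto)
  moreover have "v (\<lambda>q. Re (f q) * Im (g q) + Im (f q) * Re (g q)) =
      v (\<lambda>q. Re (f q) * Im (g q)) + v (\<lambda>q. Im (f q) * Re (g q))"
    by (rule tangent_add[OF A v]) (use g germs_mult[OF A] in auto)
  ultimately show ?thesis
    unfolding cderiv_def Re Im using g
    by (simp add: tangent_mult[OF A v] complex_eq_iff algebra_simps)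
qed

lemma cderiv_sum:
  "finite I \<Longrightarrow> (\<And>i. i \<in> I \<Longrightarrow> f i \<in> cgerms A p) \<Longrightarrow> cderiv v (\<lambda>q. \<Sum>i\<in>I. f i q) = (\<Sum>i\<in>I. cderiv v (f i))"
  by (induction rule: finite_induct) (auto simp: cderiv_const cderiv_add cgerms_sum)

end

end

lemma cderiv_pushforward:
  "f \<in> cgerms B (F p) \<Longrightarrow> cderiv v (\<lambda>q. f (F q)) = cderiv (pushforward B F p v) f"
  by (simp add: cderiv_def pushforward_def cgerms_def o_def)

lemma spin_conn_index:
  fixes M :: "('a::topological_space, 'e::euclidean_space) riem"
  assumes "r < spin_dim DIM('e)"
  shows "spin_conn M S i p v \<psi> $ r = cderiv v (\<lambda>q. \<psi> i q $ r) + 1 / 4 * (\<Sum>j<DIM('e). \<Sum>k<DIM('e).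
    of_real (metric M p (conn M p v (frame S i j)) (frame S i k p)) * ((cliff S j * cliff S k) *\<^sub>v \<psi> i p) $ r)"
  using assms by (simp add: spin_conn_def cderiv_def)


section \<open>Transversal Killing spinors on flows with adapted frames\<close>

lemma dim_total [simp]: "DIM(real \<times> 'e::euclidean_space) = Suc DIM('e)"
  by simp

lemma spin_dim_Suc: "spin_dim (Suc n) = (if even n then spin_dim n else spin_dim n + spin_dim n)"
  by (auto simp: spin_dim_def elim!: oddE)

context basic_flow
begin

abbreviation "c \<equiv> cliff SM"
abbreviation "\<gamma> \<equiv> cliff SN"

lemma cliff_carrier: "j < Suc DIM('e) \<Longrightarrow> c j \<in> carrier_mat (spin_dim (Suc DIM('e))) (spin_dim (Suc DIM('e)))"
  using total_spin by (simp add: spin_structure_def clifford_module_def)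

lemma base_cliff_carrier: "j < DIM('e) \<Longrightarrow> \<gamma> j \<in> carrier_mat (spin_dim DIM('e)) (spin_dim DIM('e))"
  using base_spin by (simp add: spin_structure_def clifford_module_def)

lemma cliff_mult_carrier: "j < Suc DIM('e) \<Longrightarrow> k < Suc DIM('e) \<Longrightarrow> c j * c k \<in> carrier_mat (spin_dim (Suc DIM('e))) (spin_dim (Suc DIM('e)))"
  using cliff_carrier by (intro mult_carrier_mat)

lemma base_cliff_mult_carrier: "j < DIM('e) \<Longrightarrow> k < DIM('e) \<Longrightarrow> \<gamma> j * \<gamma> k \<in> carrier_mat (spin_dim DIM('e)) (spin_dim DIM('e))"
  using base_cliff_carrier by (intro mult_carrier_mat)

lemma cliff_relation:
  assumes "j < Suc DIM('e)" "k < Suc DIM('e)"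
  shows "c j * c k + c k * c j = (if j = k then - 2 else 0) \<cdot>\<^sub>m 1\<^sub>m (spin_dim (Suc DIM('e)))"
proof -
  have "clifford_module (Suc DIM('e)) c"
    using total_spin by (simp add: spin_structure_def)
  then show ?thesis
    using assms unfolding clifford_module_def by meson
qed

text \<open>The relation for j = k determines twice the square; it is halved entry by entry.\<close>

lemma cliff_square:
  assumes "j < Suc DIM('e)"
  shows "c j * c j = - 1\<^sub>m (spin_dim (Suc DIM('e)))"
proof (rule eq_matI)
  note carr = carrier_matD[OF cliff_mult_carrier[OF assms assms]]
  fix r s assume rs: "r < dim_row (- 1\<^sub>m (spin_dim (Suc DIM('e))) :: complex mat)"
    "s < dim_col (- 1\<^sub>m (spin_dim (Suc DIM('e))) :: complex mat)"
  have "(c j * c j + c j * c j) $$ (r, s) = (- 2 \<cdot>\<^sub>m 1\<^sub>m (spin_dim (Suc DIM('e)))) $$ (r, s)"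
    using cliff_relation[OF assms assms] by simp
  then have "(c j * c j) $$ (r, s) + (c j * c j) $$ (r, s) = - 2 * 1\<^sub>m (spin_dim (Suc DIM('e))) $$ (r, s)"
    using rs carr by (simp del: index_mult_mat(1) index_one_mat(1))
  then show "(c j * c j) $$ (r, s) = (- 1\<^sub>m (spin_dim (Suc DIM('e)))) $$ (r, s)"
    using rs by (simp del: index_mult_mat(1) index_one_mat(1))
qed (use carrier_matD[OF cliff_mult_carrier[OF assms assms]] in auto)

lemma cliff_anticommute:
  assumes "j < Suc DIM('e)" "k < Suc DIM('e)" "j \<noteq> k"
  shows "c j * c k = - (c k * c j)"
proof (rule eq_matI)
  note carr = carrier_matD[OF cliff_mult_carrier[OF assms(1,2)]] carrier_matD[OF cliff_mult_carrier[OF assms(2,1)]]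
  fix r s assume rs: "r < dim_row (- (c k * c j))" "s < dim_col (- (c k * c j))"
  have "(c j * c k + c k * c j) $$ (r, s) = (0 \<cdot>\<^sub>m 1\<^sub>m (spin_dim (Suc DIM('e)))) $$ (r, s)"
    using cliff_relation[OF assms(1,2)] assms(3) by simp
  then have "(c j * c k) $$ (r, s) + (c k * c j) $$ (r, s) = 0"
    using rs carr by (simp del: index_mult_mat(1))
  then show "(c j * c k) $$ (r, s) = (- (c k * c j)) $$ (r, s)"
    using rs carr by (simp add: eq_neg_iff_add_eq_0 del: index_mult_mat(1))
qed (use carrier_matD[OF cliff_mult_carrier[OF assms(1,2)]] carrier_matD[OF cliff_mult_carrier[OF assms(2,1)]] in auto)

lemma cliff_anticommute_index:
  assumes "j < Suc DIM('e)" "k < Suc DIM('e)" "j \<noteq> k" "w \<in> carrier_vec (spin_dim (Suc DIM('e)))" "r < spin_dim (Suc DIM('e))"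
  shows "((c j * c k) *\<^sub>v w) $ r = - ((c k * c j) *\<^sub>v w) $ r"
  using cliff_mult_carrier[OF assms(2,1)] assms(4,5) unfolding cliff_anticommute[OF assms(1-3)]
  by (subst uminus_mult_mat_vec) auto

lemma cliff_0_square_vec:
  assumes "w \<in> carrier_vec (spin_dim (Suc DIM('e)))"
  shows "c 0 *\<^sub>v (c 0 *\<^sub>v w) = - w"
  using cliff_carrier[of 0] assms
  by (simp flip: assoc_mult_mat_vec add: cliff_square uminus_mult_mat_vec)

lemma cliff_0_mult:
  assumes "j < DIM('e)" "k < DIM('e)"
  shows "(c 0 * c (Suc j)) * (c 0 * c (Suc k)) = c (Suc j) * c (Suc k)"
  by (rule anticommuting_mult(1)[where m = "spin_dim (Suc DIM('e))"])
    (use assms cliff_square cliff_anticommute[of "Suc _" 0] cliff_carrier in auto)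

lemma cliff_0_commute:
  assumes "j < DIM('e)" "k < DIM('e)"
  shows "c 0 * (c (Suc j) * c (Suc k)) = (c (Suc j) * c (Suc k)) * c 0"
  by (rule anticommuting_mult(2)[where m = "spin_dim (Suc DIM('e))"])
    (use assms cliff_square cliff_anticommute[of "Suc _" 0] cliff_carrier in auto)

lemma clifford_mult_flow:
  assumes i: "i \<in> index SN" "\<pi> p \<in> patch SN i"
  shows "clifford_mult M SM i p (\<xi> p) w = c 0 *\<^sub>v w"
proof -
  have "clifford_vec (Suc DIM('e)) c (\<lambda>j. metric M p (\<xi> p) (frame SM i j p)) = c 0"
    by (rule clifford_vec_unit) (use frame_metric[OF i, of 0] frame_0[OF i] cliff_carrier in auto)
  then show ?thesis by (simp add: clifford_mult_def)
qed

text \<open>Written with the products \<open>c 0 * c (Suc k)\<close> because these are the ones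
  known on spinors of N. The term with index 0 drops out since v is orthogonal to \<xi>.\<close>

lemma clifford_mult_flow_transversal:
  assumes i: "i \<in> index SN" "\<pi> p \<in> patch SN i" and v: "v \<in> transversal_space M \<xi> p"
    and w: "w \<in> carrier_vec (spin_dim (Suc DIM('e)))" and r: "r < spin_dim (Suc DIM('e))"
  shows "clifford_mult M SM i p (\<xi> p) (clifford_mult M SM i p v w) $ r =
    (\<Sum>k<DIM('e). of_real (metric M p v (frame SM i (Suc k) p)) * ((c 0 * c (Suc k)) *\<^sub>v w) $ r)"
proof -
  have "clifford_mult M SM i p (\<xi> p) (clifford_mult M SM i p v w) $ r =
      (\<Sum>k<Suc DIM('e). of_real (metric M p v (frame SM i k p)) * ((c 0 * c k) *\<^sub>v w) $ r)"
    unfolding clifford_mult_flow[OF i] unfolding clifford_mult_def dim_total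
    by (rule mult_clifford_vec_index) (use cliff_carrier w r in auto)
  then show ?thesis
    using v frame_0[OF i] by (simp add: sum.lessThan_Suc_shift transversal_space_def del: sum.lessThan_Suc)
qed

text \<open>The derivative of g(\<xi>, \<xi>) = 1 is zero. Thus h(Z) and \<kappa> lie in Q and can
  be expanded by \<open>clifford_mult_flow_transversal\<close>.\<close>

lemma conn_flow_transversal:
  assumes v: "v \<in> tspace M p"
  shows "conn M p v \<xi> \<in> transversal_space M \<xi> p"
  using conn_antisym[OF total v flow_near flow_near open_UNIV _ flow_unit] conn_tangent[OF total v flow_near]
  by (simp add: transversal_space_def)

text \<open>The index pairs (0, k) and (k, 0) contribute equally, so 1/4 becomes 1/2, and their
  coefficients are the components of the derivative of \<xi> in direction v. That derivative is h(Z)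
  for v = Z in Q, and \<kappa> for v = \<xi>.\<close>

lemma spin_conn_split:
  assumes i: "i \<in> index SN" "\<pi> p \<in> patch SN i" and v: "v \<in> tspace M p"
    and \<phi>: "\<phi> i p \<in> carrier_vec (spin_dim (Suc DIM('e)))" and r: "r < spin_dim (Suc DIM('e))"
  shows "spin_conn M SM i p v \<phi> $ r = cderiv v (\<lambda>q. \<phi> i q $ r)
    + 1 / 4 * (\<Sum>j<DIM('e). \<Sum>k<DIM('e). of_real (metric M p (conn M p v (frame SM i (Suc j))) (frame SM i (Suc k) p))
        * ((c (Suc j) * c (Suc k)) *\<^sub>v \<phi> i p) $ r)
    + 1 / 2 * clifford_mult M SM i p (\<xi> p) (clifford_mult M SM i p (conn M p v \<xi>) (\<phi> i p)) $ r"
proof -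
  let ?a = "\<lambda>j k. complex_of_real (metric M p (conn M p v (frame SM i j)) (frame SM i k p)) * ((c j * c k) *\<^sub>v \<phi> i p) $ r"
  have "metric M p (conn M p v (frame SM i 0)) (frame SM i 0 p) = 0"
    using conn_frame_antisym[OF i v, of 0 0] by simp
  moreover have "?a (Suc k) 0 = ?a 0 (Suc k)" if "k < DIM('e)" for k
  proof -
    have "metric M p (conn M p v (frame SM i (Suc k))) (frame SM i 0 p) =
        - metric M p (conn M p v (frame SM i 0)) (frame SM i (Suc k) p)"
      by (rule conn_frame_antisym[OF i v]) (use that in auto)
    moreover have "((c (Suc k) * c 0) *\<^sub>v \<phi> i p) $ r = - ((c 0 * c (Suc k)) *\<^sub>v \<phi> i p) $ r"
      by (rule cliff_anticommute_index) (use that \<phi> r in auto)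
    ultimately show ?thesis by simp
  qed
  ultimately have "(\<Sum>j<Suc DIM('e). \<Sum>k<Suc DIM('e). ?a j k) =
      (\<Sum>j<DIM('e). \<Sum>k<DIM('e). ?a (Suc j) (Suc k)) + 2 * (\<Sum>k<DIM('e). ?a 0 (Suc k))"
    by (intro sum_Suc_split) simp_all
  moreover have "(\<Sum>k<DIM('e). ?a 0 (Suc k)) =
      clifford_mult M SM i p (\<xi> p) (clifford_mult M SM i p (conn M p v \<xi>) (\<phi> i p)) $ r"
    using clifford_mult_flow_transversal[OF i conn_flow_transversal[OF v] \<phi> r]
    by (simp only: conn_frame_0[OF i v])
  ultimately show ?thesis
    using r by (simp add: spin_conn_index[where 'e = "real \<times> 'e"] del: sum.lessThan_Suc)
qed

lemma dim_clifford_mult [simp]: "dim_vec (clifford_mult M SM i p v w) = spin_dim (Suc DIM('e))"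
  by (simp add: clifford_mult_def carrier_matD(1)[OF clifford_vec_carrier])

lemma dim_spin_conn [simp]: "dim_vec (spin_conn M SM i p v \<phi>) = spin_dim (Suc DIM('e))"
  by (simp add: spin_conn_def)

lemma transversal_conn_Q_index:
  assumes i: "i \<in> index SN" "\<pi> p \<in> patch SN i" and v: "v \<in> transversal_space M \<xi> p"
    and \<phi>: "\<phi> i p \<in> carrier_vec (spin_dim (Suc DIM('e)))" and r: "r < spin_dim (Suc DIM('e))"
  shows "transversal_conn_Q M SM \<xi> i p v \<phi> $ r = cderiv v (\<lambda>q. \<phi> i q $ r)
    + 1 / 4 * (\<Sum>j<DIM('e). \<Sum>k<DIM('e).
        of_real (metric N (\<pi> p) (conn N (\<pi> p) (push p v) (frame SN i j)) (frame SN i k (\<pi> p)))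
        * ((c (Suc j) * c (Suc k)) *\<^sub>v \<phi> i p) $ r)"
  unfolding transversal_conn_Q_def flow_h_def
  using spin_conn_split[where \<phi> = \<phi>, OF i transversal_tangent[OF v] \<phi> r] r conn_transversal[OF i v]
  by simp

text \<open>By \<open>conn_flow_frame\<close> the coefficients of \<Omega> form the connection
  matrix in direction \<xi>. The factor 2 is what makes one half of a sum over j < k cancel one
  quarter of a sum over all pairs.\<close>

lemma two_form_mult_Omega:
  assumes i: "i \<in> index SN" "\<pi> p \<in> patch SN i"
    and w: "w \<in> carrier_vec (spin_dim (Suc DIM('e)))" and r: "r < spin_dim (Suc DIM('e))"
  shows "2 * two_form_mult M SM i p (flow_Omega M \<xi> p) w $ r =
    (\<Sum>j<DIM('e). \<Sum>k<DIM('e). of_real (metric M p (conn M p (\<xi> p) (frame SM i (Suc j))) (frame SM i (Suc k) p))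
        * ((c (Suc j) * c (Suc k)) *\<^sub>v w) $ r)"
proof -
  let ?\<omega> = "\<lambda>j k. flow_Omega M \<xi> p (frame SM i j p) (frame SM i k p)"
  let ?b = "\<lambda>j k. complex_of_real (?\<omega> j k) * ((c j * c k) *\<^sub>v w) $ r"
  have t0: "transversal_part M \<xi> p (frame SM i 0 p) = (\<lambda>f. 0)"
    by (simp add: transversal_part_def frame_0[OF i] flow_unit)
  have tS: "transversal_part M \<xi> p (frame SM i (Suc j) p) = frame SM i (Suc j) p" if "j < DIM('e)" for j
    using frame_Suc(1)[OF i that] by (simp add: transversal_part_def transversal_space_def)
  have t: "transversal_part M \<xi> p (frame SM i j p) \<in> tspace M p" if "j < Suc DIM('e)" for j
    using that by (cases j) (auto simp: t0 tS tangent_zero[OF atlas_M] frame_tangent[OF i])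
  \<comment> \<open>The transversal part of \<xi> is zero, which realizes the extension of \<Omega>
    by 0.\<close>
  have 0: "?\<omega> 0 k = 0" "?\<omega> k 0 = 0" if "k < Suc DIM('e)" for k
    using t[OF that] conn_tangent[OF total t[OF that] flow_near]
    by (simp_all add: flow_Omega_def flow_h_def t0 conn_zero[OF total flow_near] metric_zero_left[OF total]
        metric_zero_right[OF total])
  have S: "?\<omega> (Suc j) (Suc k) = metric M p (conn M p (\<xi> p) (frame SM i (Suc j))) (frame SM i (Suc k) p)"
    if "j < DIM('e)" "k < DIM('e)" for j k
    using conn_flow_frame[OF i that] that by (simp add: flow_Omega_def flow_h_def tS)
  have anti: "?\<omega> j k = - ?\<omega> k j" if "j < Suc DIM('e)" "k < Suc DIM('e)" for j k
  proof (cases "j = 0 \<or> k = 0")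
    case True
    then show ?thesis using 0 that by auto
  next
    case False
    then obtain j' k' where [simp]: "j = Suc j'" "k = Suc k'" by (meson not0_implies_Suc)
    have "?\<omega> j k = metric M p (conn M p (\<xi> p) (frame SM i j)) (frame SM i k p)" using S that by simp
    also have "\<dots> = - metric M p (conn M p (\<xi> p) (frame SM i k)) (frame SM i j p)"
      by (rule conn_frame_antisym[OF i flow_tangent that])
    finally show ?thesis using S that by simp
  qed
  have sym: "?b j k = ?b k j" if jk: "j < Suc DIM('e)" "k < Suc DIM('e)" for j k
  proof (cases "j = k")
    case False
    have "((c j * c k) *\<^sub>v w) $ r = - ((c k * c j) *\<^sub>v w) $ r"
      using cliff_anticommute_index[OF jk False w r] .
    then show ?thesis unfolding anti[OF jk] by simp
  qed simp
  have diag: "?b j j = 0" if "j < Suc DIM('e)" for j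
    using anti[OF that that] by simp
  have "2 * two_form_mult M SM i p (flow_Omega M \<xi> p) w $ r = 2 * (\<Sum>k<Suc DIM('e). \<Sum>j<k. ?b j k)"
    using r by (simp add: two_form_mult_def del: sum.lessThan_Suc)
  also have "\<dots> = (\<Sum>j<Suc DIM('e). \<Sum>k<Suc DIM('e). ?b j k)"
    by (rule sum_symmetric_strict[symmetric]) (fact sym diag)+
  also have "\<dots> = (\<Sum>j<DIM('e). \<Sum>k<DIM('e). ?b (Suc j) (Suc k))"
    by (subst sum_Suc_split) (auto simp: 0)
  finally show ?thesis using S by simp
qed

text \<open>The two corrections cancel the whole connection matrix: \<Omega> the block of Q, and
  \<xi> \<kappa> the entries that involve \<xi>.\<close>

lemma transversal_conn_xi_index:
  assumes i: "i \<in> index SN" "\<pi> p \<in> patch SN i"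
    and \<phi>: "\<phi> i p \<in> carrier_vec (spin_dim (Suc DIM('e)))" and r: "r < spin_dim (Suc DIM('e))"
  shows "transversal_conn_xi M SM \<xi> i p \<phi> $ r = cderiv (\<xi> p) (\<lambda>q. \<phi> i q $ r)"
proof -
  have "dim_vec (two_form_mult M SM i p (flow_Omega M \<xi> p) (\<phi> i p)) = spin_dim (Suc DIM('e))"
    by (simp add: two_form_mult_def)
  then show ?thesis
    unfolding transversal_conn_xi_def flow_kappa_def
    using spin_conn_split[where \<phi> = \<phi>, OF i flow_tangent \<phi> r] r two_form_mult_Omega[OF i \<phi> r, symmetric] by simp
qed

lemma dim_transversal_conn [simp]:
  "dim_vec (transversal_conn_xi M SM \<xi> i p \<phi>) = spin_dim (Suc DIM('e))"
  "dim_vec (transversal_conn_Q M SM \<xi> i p v \<phi>) = spin_dim (Suc DIM('e))"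
  by (simp_all add: transversal_conn_xi_def transversal_conn_Q_def)

end

text \<open>The identification of \<open>\<Sigma>M\<close> with \<open>\<Sigma>Q\<close> (\<open>n\<close> even) or \<open>\<Sigma>Q \<oplus> \<Sigma>Q\<close> (\<open>n\<close> odd).\<close>

definition spinor_pair :: "nat \<Rightarrow> complex vec \<Rightarrow> complex vec \<Rightarrow> complex vec" where
  "spinor_pair n u u' = (if even n then u else u @\<^sub>v u')"

lemma spinor_pair_carrier:
  "u \<in> carrier_vec (spin_dim n) \<Longrightarrow> u' \<in> carrier_vec (spin_dim n) \<Longrightarrow>
    spinor_pair n u u' \<in> carrier_vec (spin_dim (Suc n))"
  by (simp add: spinor_pair_def spin_dim_Suc)

lemma spinor_pair_index:
  "u \<in> carrier_vec (spin_dim n) \<Longrightarrow> u' \<in> carrier_vec (spin_dim n) \<Longrightarrow> r < spin_dim (Suc n) \<Longrightarrow>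
    spinor_pair n u u' $ r = (if r < spin_dim n then u $ r else u' $ (r - spin_dim n))"
  by (auto simp: spinor_pair_def spin_dim_Suc split: if_splits)

lemma spinor_pair_eqI:
  assumes "dim_vec w = spin_dim (Suc n)" "u \<in> carrier_vec (spin_dim n)" "u' \<in> carrier_vec (spin_dim n)"
    "\<And>r. r < spin_dim (Suc n) \<Longrightarrow> w $ r = (if r < spin_dim n then u $ r else u' $ (r - spin_dim n))"
  shows "w = spinor_pair n u u'"
  using assms spinor_pair_carrier[OF assms(2,3)] by (intro eq_vecI) (auto simp: spinor_pair_index)

lemma spinor_pair_smult:
  "a \<cdot>\<^sub>v spinor_pair n u u' = spinor_pair n (a \<cdot>\<^sub>v u) (a \<cdot>\<^sub>v u')"
  by (auto simp: spinor_pair_def)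

lemma dim_spin_conn_eq:
  "dim_vec (spin_conn (N :: ('b::topological_space, 'e::euclidean_space) riem) S i x v \<psi>) = spin_dim DIM('e)"
  by (simp add: spin_conn_def)

section \<open>Spinors pulled back from the base\<close>

context basic_flow
begin

text \<open>Serves both constructions: the pair (\<psi>, 0) is the induced Killing spinor, and
  (\<psi>, \<psi>) is the spinor that gets rotated on the product with a line. If the dimension of N
  is even, the second entry is discarded.\<close>

definition basic_spinor :: "('i, 'b) spinor \<Rightarrow> ('i, 'b) spinor \<Rightarrow> ('i, 'a) spinor" where
  "basic_spinor \<psi> \<eta> i p = spinor_pair DIM('e) (\<psi> i (\<pi> p)) (\<eta> i (\<pi> p))"

lemma identification: "clifford_identification DIM('e) \<gamma> c"
  using induced by (simp add: induced_spin_structure_def)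

lemma cliff_0_mult_eq:
  assumes "j < DIM('e)"
  shows "c 0 * c (Suc j) = (if even DIM('e) then \<gamma> j else
    four_block_mat (\<gamma> j) (0\<^sub>m (spin_dim DIM('e)) (spin_dim DIM('e))) (0\<^sub>m (spin_dim DIM('e)) (spin_dim DIM('e))) (- \<gamma> j))"
  using identification assms by (auto simp: clifford_identification_def Let_def split: if_splits)

lemma cliff_0_mult_pair:
  assumes u: "u \<in> carrier_vec (spin_dim DIM('e))" "u' \<in> carrier_vec (spin_dim DIM('e))" and j: "j < DIM('e)"
  shows "(c 0 * c (Suc j)) *\<^sub>v spinor_pair DIM('e) u u' = spinor_pair DIM('e) (\<gamma> j *\<^sub>v u) (- (\<gamma> j *\<^sub>v u'))"
proof -
  have "- \<gamma> j \<in> carrier_mat (spin_dim DIM('e)) (spin_dim DIM('e))"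
    using base_cliff_carrier[OF j] by simp
  then show ?thesis
    using mult_mat_vec_split[OF base_cliff_carrier[OF j] _ u] base_cliff_carrier[OF j] u(2)
    by (simp add: cliff_0_mult_eq[OF j] spinor_pair_def uminus_mult_mat_vec)
qed

text \<open>Each factor \<xi> Z brings the sign of the second copy once, so the signs cancel in
  (\<xi> Z)(\<xi> W) = Z W and even products act alike on both copies.\<close>

lemma cliff_mult_pair:
  assumes u: "u \<in> carrier_vec (spin_dim DIM('e))" "u' \<in> carrier_vec (spin_dim DIM('e))"
    and j: "j < DIM('e)" and k: "k < DIM('e)"
  shows "(c (Suc j) * c (Suc k)) *\<^sub>v spinor_pair DIM('e) u u' =
    spinor_pair DIM('e) ((\<gamma> j * \<gamma> k) *\<^sub>v u) ((\<gamma> j * \<gamma> k) *\<^sub>v u')"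
proof -
  note C = base_cliff_carrier[OF j] base_cliff_carrier[OF k]
  note K = mult_mat_vec_carrier[OF C(2) u(1)] mult_mat_vec_carrier[OF C(2) u(2)]
  have "(c (Suc j) * c (Suc k)) *\<^sub>v spinor_pair DIM('e) u u' =
      (c 0 * c (Suc j)) *\<^sub>v ((c 0 * c (Suc k)) *\<^sub>v spinor_pair DIM('e) u u')"
    unfolding cliff_0_mult[OF j k, symmetric]
    by (rule assoc_mult_mat_vec[OF cliff_mult_carrier cliff_mult_carrier spinor_pair_carrier[OF u]])
      (use j k in auto)
  also have "\<dots> = spinor_pair DIM('e) (\<gamma> j *\<^sub>v (\<gamma> k *\<^sub>v u)) (- (\<gamma> j *\<^sub>v - (\<gamma> k *\<^sub>v u')))"
    using K by (simp add: cliff_0_mult_pair[OF _ _ j] cliff_0_mult_pair[OF u k])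
  also have "- (\<gamma> j *\<^sub>v - (\<gamma> k *\<^sub>v u')) = \<gamma> j *\<^sub>v (\<gamma> k *\<^sub>v u')"
  proof (rule eq_vecI)
    fix r assume "r < dim_vec (\<gamma> j *\<^sub>v (\<gamma> k *\<^sub>v u'))"
    then have r: "r < spin_dim DIM('e)" using C(1) by simp
    show "(- (\<gamma> j *\<^sub>v - (\<gamma> k *\<^sub>v u'))) $ r = (\<gamma> j *\<^sub>v (\<gamma> k *\<^sub>v u')) $ r"
      using C(1) K(2) r
      by (simp add: index_mult_mat_vec_sum[OF C(1)] sum_negf carrier_vecD[OF K(2)] carrier_matD[OF C(2)]
          del: index_mult_mat_vec)
  qed (use C in simp)
  finally show ?thesis
    using C u by (simp add: assoc_mult_mat_vec[OF C])
qed

lemma base_lift_carrier: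
  assumes "i \<in> index SN" "k \<in> index SN" "x \<in> patch SN i \<inter> patch SN k"
  shows "spin_lift SN i k x \<in> carrier_mat (spin_dim DIM('e)) (spin_dim DIM('e))"
  using base_spin assms by (intro spin_group_carrier[of _ _ \<gamma>]) (auto simp: spin_structure_def)

lemma lift_pair:
  assumes u: "u \<in> carrier_vec (spin_dim DIM('e))" "u' \<in> carrier_vec (spin_dim DIM('e))"
    and i: "i \<in> index SN" "k \<in> index SN" "\<pi> p \<in> patch SN i \<inter> patch SN k"
  shows "spin_lift SM i k p *\<^sub>v spinor_pair DIM('e) u u' =
    spinor_pair DIM('e) (spin_lift SN i k (\<pi> p) *\<^sub>v u) (spin_lift SN i k (\<pi> p) *\<^sub>v u')"
proof -
  have "spin_lift SM i k p = (let s = spin_lift SN i k (\<pi> p); d = spin_dim DIM('e) in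
      if even DIM('e) then s else four_block_mat s (0\<^sub>m d d) (0\<^sub>m d d) s)"
    using induced i unfolding induced_spin_structure_def by simp
  then show ?thesis
    using mult_mat_vec_split[OF base_lift_carrier[OF i] base_lift_carrier[OF i] u]
    by (simp add: spinor_pair_def Let_def)
qed

lemma spinor_field_carrier:
  "spinor_field N SN \<psi> \<Longrightarrow> i \<in> index SN \<Longrightarrow> x \<in> patch SN i \<Longrightarrow> \<psi> i x \<in> carrier_vec (spin_dim DIM('e))"
  unfolding spinor_field_def by blast

lemma spinor_field_smooth:
  "spinor_field N SN \<psi> \<Longrightarrow> i \<in> index SN \<Longrightarrow> r < spin_dim DIM('e) \<Longrightarrow>
    smooth_cfun (charts N) (patch SN i) (\<lambda>x. \<psi> i x $ r)"
  unfolding spinor_field_def by blast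

lemma basic_spinor_carrier:
  assumes "spinor_field N SN \<psi>" "spinor_field N SN \<eta>" "i \<in> index SN" "\<pi> p \<in> patch SN i"
  shows "basic_spinor \<psi> \<eta> i p \<in> carrier_vec (spin_dim (Suc DIM('e)))"
  using spinor_field_carrier assms by (simp add: basic_spinor_def spinor_pair_carrier)

lemma basic_spinor_index:
  assumes "spinor_field N SN \<psi>" "spinor_field N SN \<eta>" "i \<in> index SN" "\<pi> p \<in> patch SN i"
    "r < spin_dim (Suc DIM('e))"
  shows "basic_spinor \<psi> \<eta> i p $ r =
    (if r < spin_dim DIM('e) then \<psi> i (\<pi> p) $ r else \<eta> i (\<pi> p) $ (r - spin_dim DIM('e)))"
  using spinor_field_carrier assms by (simp add: basic_spinor_def spinor_pair_index)

lemma basic_spinor_smooth: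
  assumes \<psi>: "spinor_field N SN \<psi>" and \<eta>: "spinor_field N SN \<eta>" and i: "i \<in> index SN"
    and r: "r < spin_dim (Suc DIM('e))"
  shows "smooth_cfun (charts M) (\<pi> -` patch SN i) (\<lambda>p. basic_spinor \<psi> \<eta> i p $ r)"
proof (rule smooth_cfun_cong[OF atlas_M])
  have "r - spin_dim DIM('e) < spin_dim DIM('e)" if "\<not> r < spin_dim DIM('e)"
    using r that by (auto simp: spin_dim_Suc split: if_splits)
  then show "smooth_cfun (charts M) (\<pi> -` patch SN i)
      (\<lambda>p. if r < spin_dim DIM('e) then \<psi> i (\<pi> p) $ r else \<eta> i (\<pi> p) $ (r - spin_dim DIM('e)))"
    using smooth_cfun_compose[OF smooth_projection spinor_field_smooth[OF \<psi> i]]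
      smooth_cfun_compose[OF smooth_projection spinor_field_smooth[OF \<eta> i]]
    by (cases "r < spin_dim DIM('e)") simp_all
qed (use assms basic_spinor_index in auto)

lemma basic_spinor_field:
  assumes \<psi>: "spinor_field N SN \<psi>" and \<eta>: "spinor_field N SN \<eta>"
  shows "spinor_field M SM (basic_spinor \<psi> \<eta>)"
proof -
  have lift: "basic_spinor \<psi> \<eta> i p = spin_lift SM i k p *\<^sub>v basic_spinor \<psi> \<eta> k p"
    if "i \<in> index SN" "k \<in> index SN" "\<pi> p \<in> patch SN i" "\<pi> p \<in> patch SN k" for i k p
  proof -
    have "\<psi> i (\<pi> p) = spin_lift SN i k (\<pi> p) *\<^sub>v \<psi> k (\<pi> p)" "\<eta> i (\<pi> p) = spin_lift SN i k (\<pi> p) *\<^sub>v \<eta> k (\<pi> p)"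
      using that \<psi> \<eta> unfolding spinor_field_def by blast+
    then show ?thesis
      using lift_pair[OF spinor_field_carrier[OF \<psi>] spinor_field_carrier[OF \<eta>]] that
      by (simp add: basic_spinor_def)
  qed
  show ?thesis
    unfolding spinor_field_def index_eq dim_total
    by (intro conjI ballI allI impI)
      (auto simp: patch_eq intro: basic_spinor_carrier[OF assms] basic_spinor_smooth[OF assms] lift)
qed

lemma cderiv_basic:
  assumes \<psi>: "spinor_field N SN \<psi>" and \<eta>: "spinor_field N SN \<eta>"
    and i: "i \<in> index SN" "\<pi> p \<in> patch SN i" and v: "v \<in> tspace M p" and r: "r < spin_dim (Suc DIM('e))"
  shows "cderiv v (\<lambda>q. basic_spinor \<psi> \<eta> i q $ r) =
    (if r < spin_dim DIM('e) then cderiv (push p v) (\<lambda>x. \<psi> i x $ r)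
     else cderiv (push p v) (\<lambda>x. \<eta> i x $ (r - spin_dim DIM('e))))"
proof -
  have r': "r - spin_dim DIM('e) < spin_dim DIM('e)" if "\<not> r < spin_dim DIM('e)"
    using r that by (auto simp: spin_dim_Suc split: if_splits)
  have "cderiv v (\<lambda>q. basic_spinor \<psi> \<eta> i q $ r) =
      cderiv v (\<lambda>p. if r < spin_dim DIM('e) then \<psi> i (\<pi> p) $ r else \<eta> i (\<pi> p) $ (r - spin_dim DIM('e)))"
    by (rule cderiv_local[OF atlas_M v open_patch[OF i(1)]]) (use assms basic_spinor_index in auto)
  moreover have "(\<lambda>x. \<psi> i x $ r) \<in> cgerms (charts N) (\<pi> p)" if "r < spin_dim DIM('e)"
    using cgermsI spinor_field_smooth[OF \<psi> i(1) that] i(2) by blast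
  moreover have "(\<lambda>x. \<eta> i x $ (r - spin_dim DIM('e))) \<in> cgerms (charts N) (\<pi> p)" if "\<not> r < spin_dim DIM('e)"
    using cgermsI spinor_field_smooth[OF \<eta> i(1) r'[OF that]] i(2) by blast
  ultimately show ?thesis
    using cderiv_pushforward[of "\<lambda>x. \<psi> i x $ r" "charts N" \<pi> p v]
      cderiv_pushforward[of "\<lambda>x. \<eta> i x $ (r - spin_dim DIM('e))" "charts N" \<pi> p v]
    by (cases "r < spin_dim DIM('e)") simp_all
qed

text \<open>Only the derivative of the components is left, and it factors through the projection,
  under which \<xi> goes to zero.\<close>

lemma transversal_conn_xi_basic:
  assumes \<psi>: "spinor_field N SN \<psi>" and \<eta>: "spinor_field N SN \<eta>" and i: "i \<in> index SN" "\<pi> p \<in> patch SN i"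
  shows "transversal_conn_xi M SM \<xi> i p (basic_spinor \<psi> \<eta>) = 0\<^sub>v (spin_dim (Suc DIM('e)))"
proof (rule eq_vecI)
  fix r assume "r < dim_vec (0\<^sub>v (spin_dim (Suc DIM('e))) :: complex vec)"
  then show "transversal_conn_xi M SM \<xi> i p (basic_spinor \<psi> \<eta>) $ r = 0\<^sub>v (spin_dim (Suc DIM('e))) $ r"
    using transversal_conn_xi_index[OF i, of "basic_spinor \<psi> \<eta>" r] basic_spinor_carrier[OF assms]
      cderiv_basic[OF assms flow_tangent, of r] by (simp add: vertical) (simp add: cderiv_def complex_eq_iff)
qed simp

text \<open>Besides the derivative, only products of two vectors of Q occur, so the two components
  decouple and carry no relative sign.\<close>

lemma transversal_conn_Q_basic:
  assumes \<psi>: "spinor_field N SN \<psi>" and \<eta>: "spinor_field N SN \<eta>" and i: "i \<in> index SN" "\<pi> p \<in> patch SN i"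
    and v: "v \<in> transversal_space M \<xi> p"
  shows "transversal_conn_Q M SM \<xi> i p v (basic_spinor \<psi> \<eta>) =
    spinor_pair DIM('e) (spin_conn N SN i (\<pi> p) (push p v) \<psi>) (spin_conn N SN i (\<pi> p) (push p v) \<eta>)"
proof (rule spinor_pair_eqI)
  note C = spinor_field_carrier[OF \<psi> i] spinor_field_carrier[OF \<eta> i]
  fix r assume r: "r < spin_dim (Suc DIM('e))"
  have r': "r - spin_dim DIM('e) < spin_dim DIM('e)" if "\<not> r < spin_dim DIM('e)"
    using r that by (auto simp: spin_dim_Suc split: if_splits)
  let ?a = "\<lambda>j k. complex_of_real (metric N (\<pi> p) (conn N (\<pi> p) (push p v) (frame SN i j)) (frame SN i k (\<pi> p)))"
  have "((c (Suc j) * c (Suc k)) *\<^sub>v basic_spinor \<psi> \<eta> i p) $ r = (if r < spin_dim DIM('e)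
      then ((\<gamma> j * \<gamma> k) *\<^sub>v \<psi> i (\<pi> p)) $ r else ((\<gamma> j * \<gamma> k) *\<^sub>v \<eta> i (\<pi> p)) $ (r - spin_dim DIM('e)))"
    if "j < DIM('e)" "k < DIM('e)" for j k
    unfolding basic_spinor_def cliff_mult_pair[OF C that]
    by (rule spinor_pair_index[OF _ _ r])
      (use C base_cliff_mult_carrier[OF that] in \<open>auto intro: mult_mat_vec_carrier\<close>)
  then have "transversal_conn_Q M SM \<xi> i p v (basic_spinor \<psi> \<eta>) $ r =
      cderiv v (\<lambda>q. basic_spinor \<psi> \<eta> i q $ r)
      + 1 / 4 * (\<Sum>j<DIM('e). \<Sum>k<DIM('e). ?a j k * (if r < spin_dim DIM('e)
      then ((\<gamma> j * \<gamma> k) *\<^sub>v \<psi> i (\<pi> p)) $ r else ((\<gamma> j * \<gamma> k) *\<^sub>v \<eta> i (\<pi> p)) $ (r - spin_dim DIM('e))))"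
    unfolding transversal_conn_Q_index[where \<phi> = "basic_spinor \<psi> \<eta>", OF i v basic_spinor_carrier[OF \<psi> \<eta> i] r]
    by (intro arg_cong2[where f = "(+)"] arg_cong2[where f = "(*)"] refl sum.cong) auto
  then show "transversal_conn_Q M SM \<xi> i p v (basic_spinor \<psi> \<eta>) $ r =
      (if r < spin_dim DIM('e) then spin_conn N SN i (\<pi> p) (push p v) \<psi> $ r
       else spin_conn N SN i (\<pi> p) (push p v) \<eta> $ (r - spin_dim DIM('e)))"
    using r' unfolding cderiv_basic[OF \<psi> \<eta> i transversal_tangent[OF v] r]
    by (cases "r < spin_dim DIM('e)") (simp_all add: spin_conn_index)
qed (rule dim_transversal_conn carrier_vecI[OF dim_spin_conn_eq])+

text \<open>Here a single factor \<xi> Z occurs and the sign of the second copy stays. A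
  \<beta>-Killing spinor placed there would satisfy the transversal equation with -\<beta>.\<close>

lemma clifford_mult_basic:
  assumes \<psi>: "spinor_field N SN \<psi>" and \<eta>: "spinor_field N SN \<eta>" and i: "i \<in> index SN" "\<pi> p \<in> patch SN i"
    and v: "v \<in> transversal_space M \<xi> p"
  shows "clifford_mult M SM i p (\<xi> p) (clifford_mult M SM i p v (basic_spinor \<psi> \<eta> i p)) =
    spinor_pair DIM('e) (clifford_mult N SN i (\<pi> p) (push p v) (\<psi> i (\<pi> p)))
      (- clifford_mult N SN i (\<pi> p) (push p v) (\<eta> i (\<pi> p)))"
proof (rule spinor_pair_eqI)
  note C = spinor_field_carrier[OF \<psi> i] spinor_field_carrier[OF \<eta> i]
  have K: "clifford_mult N SN i (\<pi> p) (push p v) w \<in> carrier_vec (spin_dim DIM('e))"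
    if "w \<in> carrier_vec (spin_dim DIM('e))" for w
    unfolding clifford_mult_def by (rule mult_mat_vec_carrier[OF clifford_vec_carrier that])
  show "clifford_mult N SN i (\<pi> p) (push p v) (\<psi> i (\<pi> p)) \<in> carrier_vec (spin_dim DIM('e))"
    "- clifford_mult N SN i (\<pi> p) (push p v) (\<eta> i (\<pi> p)) \<in> carrier_vec (spin_dim DIM('e))"
    using K C by simp_all
  fix r assume r: "r < spin_dim (Suc DIM('e))"
  have r': "r - spin_dim DIM('e) < spin_dim DIM('e)" if "\<not> r < spin_dim DIM('e)"
    using r that by (auto simp: spin_dim_Suc split: if_splits)
  have index: "clifford_mult N SN i (\<pi> p) (push p v) w $ s =
      (\<Sum>k<DIM('e). of_real (metric N (\<pi> p) (push p v) (frame SN i k (\<pi> p))) * (\<gamma> k *\<^sub>v w) $ s)"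
    if "w \<in> carrier_vec (spin_dim DIM('e))" "s < spin_dim DIM('e)" for w s
    unfolding clifford_mult_def by (rule clifford_vec_mult_index) (use base_cliff_carrier that in auto)
  have "((c 0 * c (Suc k)) *\<^sub>v basic_spinor \<psi> \<eta> i p) $ r = (if r < spin_dim DIM('e)
      then (\<gamma> k *\<^sub>v \<psi> i (\<pi> p)) $ r else - (\<gamma> k *\<^sub>v \<eta> i (\<pi> p)) $ (r - spin_dim DIM('e)))"
    if k: "k < DIM('e)" for k
  proof -
    note K = mult_mat_vec_carrier[OF base_cliff_carrier[OF k] C(1)] mult_mat_vec_carrier[OF base_cliff_carrier[OF k] C(2)]
    show ?thesis
      unfolding basic_spinor_def cliff_0_mult_pair[OF C k]
      using K r r' carrier_matD(1)[OF base_cliff_carrier[OF k]]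
      by (subst spinor_pair_index) auto
  qed
  then have "clifford_mult M SM i p (\<xi> p) (clifford_mult M SM i p v (basic_spinor \<psi> \<eta> i p)) $ r =
      (\<Sum>k<DIM('e). of_real (metric N (\<pi> p) (push p v) (frame SN i k (\<pi> p))) * (if r < spin_dim DIM('e)
      then (\<gamma> k *\<^sub>v \<psi> i (\<pi> p)) $ r else - (\<gamma> k *\<^sub>v \<eta> i (\<pi> p)) $ (r - spin_dim DIM('e))))"
    unfolding clifford_mult_flow_transversal[OF i v basic_spinor_carrier[OF \<psi> \<eta> i] r]
    by (intro sum.cong refl) (simp add: metric_frame_push[OF i transversal_tangent[OF v]])
  then show "clifford_mult M SM i p (\<xi> p) (clifford_mult M SM i p v (basic_spinor \<psi> \<eta> i p)) $ r =
      (if r < spin_dim DIM('e) then clifford_mult N SN i (\<pi> p) (push p v) (\<psi> i (\<pi> p)) $ r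
       else (- clifford_mult N SN i (\<pi> p) (push p v) (\<eta> i (\<pi> p))) $ (r - spin_dim DIM('e)))"
    using r' K[OF C(2)] by (cases "r < spin_dim DIM('e)") (simp_all add: index C sum_negf)
qed simp

definition zero_spinor :: "('i, 'b) spinor" where
  "zero_spinor i x = 0\<^sub>v (spin_dim DIM('e))"

lemma zero_spinor_field: "spinor_field N SN zero_spinor"
proof -
  have "open (patch SN i)" if "i \<in> index SN" for i
    using base_spin that by (auto simp: spin_structure_def)
  moreover have "0\<^sub>v (spin_dim DIM('e)) = spin_lift SN i k x *\<^sub>v 0\<^sub>v (spin_dim DIM('e))"
    if "i \<in> index SN" "k \<in> index SN" "x \<in> patch SN i \<inter> patch SN k" for i k x
    using base_lift_carrier[OF that] by (intro eq_vecI) auto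
  ultimately show ?thesis
    by (auto simp: spinor_field_def zero_spinor_def intro!: smooth_cfun_const[OF atlas_N])
qed

lemma spin_conn_zero_spinor:
  assumes i: "i \<in> index SN" "x \<in> patch SN i" and v: "v \<in> tspace N x"
  shows "spin_conn N SN i x v zero_spinor = 0\<^sub>v (spin_dim DIM('e))"
proof (rule eq_vecI)
  fix r assume "r < dim_vec (0\<^sub>v (spin_dim DIM('e)) :: complex vec)"
  then have r: "r < spin_dim DIM('e)" by simp
  have "((\<gamma> j * \<gamma> k) *\<^sub>v 0\<^sub>v (spin_dim DIM('e))) $ r = 0" if "j < DIM('e)" "k < DIM('e)" for j k
    using base_cliff_mult_carrier[OF that] r by (simp add: index_mult_mat_vec_sum)
  then show "spin_conn N SN i x v zero_spinor $ r = 0\<^sub>v (spin_dim DIM('e)) $ r"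
    using r by (simp add: spin_conn_index zero_spinor_def cderiv_const[OF atlas_N v])
qed (simp add: dim_spin_conn_eq)

text \<open>The zero spinor satisfies the Killing equation for \<beta> and for -\<beta>, so it may
  fill the second copy, where the sign is reversed.\<close>

lemma induced_spinor_killing:
  assumes killing: "killing_spinor N SN \<beta> \<psi>"
  shows "transversal_killing_spinor M SM \<xi> 0 \<beta> (induced_spinor N \<pi> \<psi>)"
proof -
  have \<psi>: "spinor_field N SN \<psi>" using killing by (simp add: killing_spinor_def)
  have eq: "induced_spinor N \<pi> \<psi> = basic_spinor \<psi> zero_spinor"
    by (intro ext) (simp add: induced_spinor_def basic_spinor_def spinor_pair_def zero_spinor_def)
  note fields = \<psi> zero_spinor_field
  have "transversal_conn_Q M SM \<xi> i p v (basic_spinor \<psi> zero_spinor) =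
      \<beta> \<cdot>\<^sub>v clifford_mult M SM i p (\<xi> p) (clifford_mult M SM i p v (basic_spinor \<psi> zero_spinor i p))"
    if i: "i \<in> index SN" "\<pi> p \<in> patch SN i" and v: "v \<in> transversal_space M \<xi> p" for i p v
  proof -
    note t = push_tangent[OF transversal_tangent[OF v]]
    have "spin_conn N SN i (\<pi> p) (push p v) \<psi> = \<beta> \<cdot>\<^sub>v clifford_mult N SN i (\<pi> p) (push p v) (\<psi> i (\<pi> p))"
      using killing i t by (auto simp: killing_spinor_def)
    moreover have "clifford_mult N SN i (\<pi> p) (push p v) (zero_spinor i (\<pi> p)) = 0\<^sub>v (spin_dim DIM('e))"
      unfolding clifford_mult_def zero_spinor_def
      by (intro eq_vecI) (simp_all add: carrier_matD[OF clifford_vec_carrier])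
    moreover have "\<beta> \<cdot>\<^sub>v - 0\<^sub>v (spin_dim DIM('e)) = 0\<^sub>v (spin_dim DIM('e))"
      by (intro eq_vecI) simp_all
    ultimately show ?thesis
      by (simp add: transversal_conn_Q_basic[OF fields i v] clifford_mult_basic[OF fields i v]
          spinor_pair_smult spin_conn_zero_spinor[OF i t])
  qed
  moreover have "transversal_conn_xi M SM \<xi> i p (basic_spinor \<psi> zero_spinor) =
      0 \<cdot>\<^sub>v clifford_mult M SM i p (\<xi> p) (basic_spinor \<psi> zero_spinor i p)"
    if i: "i \<in> index SN" "\<pi> p \<in> patch SN i" for i p
    unfolding transversal_conn_xi_basic[OF fields i] by (intro eq_vecI) simp_all
  ultimately show ?thesis
    unfolding eq transversal_killing_spinor_def
    using riemannian_flow basic_spinor_field[OF fields] by (simp add: index_eq patch_eq)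
qed

end

section \<open>The product with a line\<close>

text \<open>Everywhere convergent series are stable under differentiation: the coefficients become
  \<open>diffs a\<close>, and a direction v contributes just the constant factor
  \<open>fst v\<close>.\<close>

lemma Ck_on_power_series_fst:
  assumes "open S" "\<And>t::real. summable (\<lambda>n. a n * t ^ n)"
  shows "Ck_on k (\<lambda>p::real \<times> 'e::real_normed_vector. \<Sum>n. a n * (fst p - t0) ^ n) S"
  using assms(2)
proof (induction k arbitrary: a)
  case 0
  have "isCont (\<lambda>t. \<Sum>n. a n * t ^ n) t" for t
    by (rule isCont_powser_converges_everywhere[OF 0])
  then have "continuous_on UNIV (\<lambda>t. \<Sum>n. a n * t ^ n)"
    by (simp add: continuous_at_imp_continuous_on)
  then show ?case
    by (auto intro!: continuous_on_compose2[of UNIV "\<lambda>t. \<Sum>n. a n * t ^ n"] continuous_intros)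
next
  case (Suc k)
  have "((\<lambda>t. \<Sum>n. a n * t ^ n) has_derivative (*) (\<Sum>n. diffs a n * t ^ n)) (at t)" for t
    using termdiffs_strong_converges_everywhere[OF Suc.prems] by (simp add: has_field_derivative_def)
  then have "((\<lambda>p. \<Sum>n. a n * (fst p - t0) ^ n) has_derivative (\<lambda>v. (\<Sum>n. diffs a n * (fst p - t0) ^ n) * fst v)) (at p)"
    for p :: "real \<times> 'e"
    by (rule has_derivative_compose[of "\<lambda>p. fst p - t0" fst p UNIV, simplified, rotated])
      (auto intro!: derivative_eq_intros)
  moreover have "Ck_on k (\<lambda>p::real \<times> 'e. (\<Sum>n. diffs a n * (fst p - t0) ^ n) * fst v) S" for v :: "real \<times> 'e"
    by (intro Ck_on_mult Ck_on_const Suc.IH assms(1) termdiff_converges_all[OF Suc.prems])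
  ultimately show ?case
    by (intro Ck_on_SucI[OF assms(1)])
qed

context
  fixes A :: "('b::{t2_space,second_countable_topology}, 'e::euclidean_space) atlas"
  assumes A: "smooth_atlas A" and line: "smooth_atlas (line_times A)"
begin

text \<open>Charts of \<open>line_times\<close> leave the first coordinate unchanged, so in every
  chart the function is given by the same series.\<close>

lemma smooth_fun_power_series_fst:
  assumes "\<And>t::real. summable (\<lambda>n. a n * t ^ n)"
  shows "smooth_fun (line_times A) UNIV (\<lambda>q. \<Sum>n. a n * (fst q - t0) ^ n)"
  unfolding smooth_fun_def
proof (safe)
  fix V c assume c: "(V, c) \<in> line_times A"
  then obtain k where k: "c = map_prod id k" by (auto simp: line_times_def)
  have o: "open (c ` (UNIV \<inter> V))" by (rule chart_image_open[OF line c open_UNIV])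
  show "smooth_on ((\<lambda>q. \<Sum>n. a n * (fst q - t0) ^ n) \<circ> inv_into V c) (c ` (UNIV \<inter> V))"
  proof (rule smooth_on_cong[OF o])
    show "smooth_on (\<lambda>q. \<Sum>n. a n * (fst q - t0) ^ n) (c ` (UNIV \<inter> V))"
      unfolding smooth_on_def using Ck_on_power_series_fst[OF o assms] by blast
    fix x assume "x \<in> c ` (UNIV \<inter> V)"
    then have "fst x = fst (c (inv_into V c x))" by (simp add: f_inv_into_f)
    then show "(\<Sum>n. a n * (fst x - t0) ^ n) = ((\<lambda>q. \<Sum>n. a n * (fst q - t0) ^ n) \<circ> inv_into V c) x"
      by (simp add: k)
  qed
qed simp

text \<open>In charts the projection is the linear map \<open>snd\<close>, so the special chain rule
  \<open>Ck_on_compose_snd\<close> suffices.\<close>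

lemma smooth_map_snd: "smooth_map_on (line_times A) UNIV A snd"
proof -
  have "smooth_fun (line_times A) (UNIV \<inter> snd -` V) (f \<circ> snd)" if f: "smooth_fun A V f" for V f
    unfolding smooth_fun_def
  proof (safe)
    show open_V: "open (UNIV \<inter> snd -` V)"
      using open_vimage[OF smooth_fun_open[OF f], of snd] by (simp add: continuous_on_snd)
    fix W c assume c: "(W, c) \<in> line_times A"
    then obtain U k where k: "(U, k) \<in> A" "W = UNIV \<times> U" "c = map_prod id k" by (auto simp: line_times_def)
    have image: "c ` (UNIV \<inter> snd -` V \<inter> W) = UNIV \<times> k ` (V \<inter> U)"
      unfolding k by (force simp: image_iff)
    show "smooth_on (f \<circ> snd \<circ> inv_into W c) (c ` (UNIV \<inter> snd -` V \<inter> W))"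
    proof (rule smooth_on_cong)
      show "open (c ` (UNIV \<inter> snd -` V \<inter> W))" by (rule chart_image_open[OF line c open_V])
      have "smooth_on (f \<circ> inv_into U k) (k ` (V \<inter> U))" using f k(1) by (auto simp: smooth_fun_def)
      then show "smooth_on (\<lambda>p. (f \<circ> inv_into U k) (snd p)) (c ` (UNIV \<inter> snd -` V \<inter> W))"
        unfolding image smooth_on_def
        using Ck_on_compose_snd chart_image_open[OF A k(1) smooth_fun_open[OF f]] by blast
      fix x assume "x \<in> c ` (UNIV \<inter> snd -` V \<inter> W)"
      then have x: "inv_into W c x \<in> W" "c (inv_into W c x) = x"
        by (auto simp: f_inv_into_f inv_into_into)
      then have "snd (inv_into W c x) \<in> U" "snd x = k (snd (inv_into W c x))"
        by (auto simp: k(2,3) map_prod_def split: prod.splits)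
      then show "(f \<circ> inv_into U k) (snd x) = (f \<circ> snd \<circ> inv_into W c) x"
        using inv_into_f_f[OF chart_inj[OF A k(1)]] by simp
    qed
  qed
  then show ?thesis
    unfolding smooth_map_on_def by (intro conjI allI impI open_UNIV continuous_on_snd continuous_on_id)
qed

lemma smooth_fun_fst: "smooth_fun (line_times A) UNIV fst"
proof -
  let ?a = "\<lambda>n. if n = 1 then 1 else 0 :: real"
  have 0: "?a n * t ^ n = 0" if "n \<notin> {1}" for n and t :: real using that by auto
  have "summable (\<lambda>n. ?a n * t ^ n)" for t by (rule summable_finite[of "{1}"]) (use 0 in auto)
  moreover have "(\<Sum>n. ?a n * t ^ n) = t" for t by (subst suminf_finite[of "{1}"]) (use 0 in auto)
  ultimately show ?thesis
    using smooth_fun_power_series_fst[of ?a 0] by simp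
qed

lemma fst_germ: "fst \<in> germs (line_times A) p"
  using germsI[OF smooth_fun_fst] by simp

text \<open>The chain rule in this case, by Hadamard's lemma: a power series in \<open>t - t0\<close> is its
  constant term plus \<open>t - t0\<close> times a power series.\<close>

lemma tangent_power_series_fst:
  assumes v: "v \<in> tangent (line_times A) p" and a: "\<And>t::real. summable (\<lambda>n. a n * t ^ n)"
  shows "v (\<lambda>q. \<Sum>n. a n * (fst q - fst p) ^ n) = a 1 * v fst"
proof -
  let ?g = "\<lambda>q. \<Sum>n. a (Suc n) * (fst q - fst p) ^ n"
  have a': "summable (\<lambda>n. a (Suc n) * t ^ n)" for t :: real
    using a[of t] summable_powser_split_head[of a t] by simp
  have g: "?g \<in> germs (line_times A) p"
    using smooth_fun_power_series_fst[OF a'] by (rule germsI) simp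
  have t: "(\<lambda>q. fst q + (- fst p)) \<in> germs (line_times A) p"
    by (intro germs_add[OF line] fst_germ germs_const[OF line])
  have split: "(\<lambda>q. \<Sum>n. a n * (fst q - fst p) ^ n) = (\<lambda>q. a 0 + (fst q + (- fst p)) * ?g q)"
    using powser_split_head(1)[OF a] by (simp add: mult.commute)
  have "v (\<lambda>q. \<Sum>n. a n * (fst q - fst p) ^ n) = v (\<lambda>q. a 0) + v (\<lambda>q. (fst q + (- fst p)) * ?g q)"
    unfolding split by (intro tangent_add[OF line v] germs_const[OF line] germs_mult[OF line] t g)
  also have "\<dots> = (v fst + v (\<lambda>q. - fst p)) * ?g p"
    using tangent_mult[OF line v t g] tangent_add[OF line v fst_germ germs_const[OF line], of "- fst p"]
    by (simp add: tangent_const[OF line v])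
  also have "?g p = a 1" using powser_zero[of "\<lambda>n. a (Suc n)"] by simp
  finally show ?thesis by (simp only: tangent_const[OF line v] add_0_right mult.commute)
qed

text \<open>Expanded at an arbitrary t0, because \<open>tangent_power_series_fst\<close> wants the
  series centred at the base point. The functional equation of exp puts the factor exp(a t0) into
  the coefficients.\<close>

lemma exp_fst_series:
  fixes a :: complex
  defines "b \<equiv> \<lambda>n t0. exp (a * of_real t0) * (a ^ n /\<^sub>R fact n)"
  shows "summable (\<lambda>n. Re (b n t0) * t ^ n)" "summable (\<lambda>n. Im (b n t0) * t ^ n)"
    "Re (exp (a * of_real s)) = (\<Sum>n. Re (b n t0) * (s - t0) ^ n)"
    "Im (exp (a * of_real s)) = (\<Sum>n. Im (b n t0) * (s - t0) ^ n)"
proof -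
  have "(\<lambda>n. b n t0 * of_real (t ^ n)) sums (exp (a * of_real t0) * exp (a * of_real t))" for t
    using sums_mult[OF exp_converges[of "a * of_real t"], of "exp (a * of_real t0)"]
    by (simp add: b_def power_mult_distrib scaleR_conv_of_real mult.assoc)
  then have *: "(\<lambda>n. b n t0 * of_real (t ^ n)) sums exp (a * of_real (t0 + t))" for t
    by (simp add: exp_add distrib_left)
  have Re: "(\<lambda>n. Re (b n t0) * t ^ n) sums Re (exp (a * of_real (t0 + t)))"
    and Im: "(\<lambda>n. Im (b n t0) * t ^ n) sums Im (exp (a * of_real (t0 + t)))" for t
    using sums_Re[OF *[of t]] sums_Im[OF *[of t]] by simp_all
  show "summable (\<lambda>n. Re (b n t0) * t ^ n)" "summable (\<lambda>n. Im (b n t0) * t ^ n)"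
    using Re Im sums_summable by blast+
  show "Re (exp (a * of_real s)) = (\<Sum>n. Re (b n t0) * (s - t0) ^ n)"
    "Im (exp (a * of_real s)) = (\<Sum>n. Im (b n t0) * (s - t0) ^ n)"
    using sums_unique[OF Re[of "s - t0"]] sums_unique[OF Im[of "s - t0"]] by simp_all
qed

lemma smooth_cfun_exp_fst: "smooth_cfun (line_times A) UNIV (\<lambda>q. exp (a * of_real (fst q)))"
  unfolding smooth_cfun_def exp_fst_series(3,4)[of a _ 0]
  by (intro conjI smooth_fun_power_series_fst exp_fst_series(1,2))

lemma cderiv_exp_fst:
  assumes v: "v \<in> tangent (line_times A) p"
  shows "cderiv v (\<lambda>q. exp (a * of_real (fst q))) = a * exp (a * of_real (fst p)) * of_real (v fst)"
  unfolding cderiv_def exp_fst_series(3,4)[of a _ "fst p"]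
    tangent_power_series_fst[OF v exp_fst_series(1)] tangent_power_series_fst[OF v exp_fst_series(2)]
  by (simp add: complex_eq_iff)

lemma cgerms_exp_fst: "(\<lambda>q. exp (a * of_real (fst q))) \<in> cgerms (line_times A) p"
  using cgermsI[OF smooth_cfun_exp_fst] by simp

lemma smooth_cfun_cos_fst: "smooth_cfun (line_times A) UNIV (\<lambda>q. cos (\<alpha> * of_real (fst q)))"
  and smooth_cfun_sin_fst: "smooth_cfun (line_times A) UNIV (\<lambda>q. sin (\<alpha> * of_real (fst q)))"
  and cderiv_cos_fst: "v \<in> tangent (line_times A) p \<Longrightarrow>
    cderiv v (\<lambda>q. cos (\<alpha> * of_real (fst q))) = - \<alpha> * sin (\<alpha> * of_real (fst p)) * of_real (v fst)"
  and cderiv_sin_fst: "v \<in> tangent (line_times A) p \<Longrightarrow>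
    cderiv v (\<lambda>q. sin (\<alpha> * of_real (fst q))) = \<alpha> * cos (\<alpha> * of_real (fst p)) * of_real (v fst)"
proof -
  let ?E = "\<lambda>a q. exp (a * of_real (fst q)) :: complex"
  \<comment> \<open>Since \<alpha> is complex, real and imaginary parts are not handled directly;
    both functions are combinations of the exponentials treated above.\<close>
  have cos: "cos (\<alpha> * of_real t) = 1 / 2 * exp (\<i> * \<alpha> * of_real t) + 1 / 2 * exp (- \<i> * \<alpha> * of_real t)"
    and sin: "sin (\<alpha> * of_real t) = - \<i> / 2 * exp (\<i> * \<alpha> * of_real t) + \<i> / 2 * exp (- \<i> * \<alpha> * of_real t)" for t
    by (simp_all add: cos_exp_eq sin_exp_eq field_simps)
  note const = smooth_cfun_const[OF line open_UNIV]
  note mult = smooth_cfun_mult[OF line]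
  show "smooth_cfun (line_times A) UNIV (\<lambda>q. cos (\<alpha> * of_real (fst q)))"
    "smooth_cfun (line_times A) UNIV (\<lambda>q. sin (\<alpha> * of_real (fst q)))"
    unfolding cos sin by (intro smooth_cfun_add[OF line] mult const smooth_cfun_exp_fst)+
  assume v: "v \<in> tangent (line_times A) p"
  have lin: "cderiv v (\<lambda>q. x * ?E a q + y * ?E b q) = x * cderiv v (?E a) + y * cderiv v (?E b)" for x y a b
    using cgerms_const[OF line] cgerms_exp_fst
    by (simp add: cderiv_add[OF line v] cderiv_mult[OF line v] cgerms_mult[OF line] cderiv_const[OF line v])
  show "cderiv v (\<lambda>q. cos (\<alpha> * of_real (fst q))) = - \<alpha> * sin (\<alpha> * of_real (fst p)) * of_real (v fst)"
    "cderiv v (\<lambda>q. sin (\<alpha> * of_real (fst q))) = \<alpha> * cos (\<alpha> * of_real (fst p)) * of_real (v fst)"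
    unfolding cos sin lin cderiv_exp_fst[OF v] by (simp_all add: algebra_simps)
qed

end

section \<open>The product with a line as a Riemannian flow\<close>

lemma d_dt_fst:
  assumes "smooth_atlas (charts N)" "smooth_atlas (line_times (charts N))"
  shows "d_dt N p fst = 1"
  using fst_germ[OF assms] by (simp add: d_dt_def)

lemma line_product_simps [simp]:
  "charts (line_product N D) = line_times (charts N)"
  "metric (line_product N D) p v w = v fst * w fst +
    metric N (snd p) (pushforward (charts N) snd p v) (pushforward (charts N) snd p w)"
  by (simp_all add: line_product_def)

lemma d_dt_vertical: "pushforward (charts N) snd p (d_dt N p) = (\<lambda>f. 0)"
  by (auto simp: pushforward_def d_dt_def fun_eq_iff)

text \<open>In the product metric g(v, d/dt) = dt(v), because d/dt projects to zero and dt(d/dt) =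
  1. Consequently functions of t have no derivative along Q.\<close>

lemma d_dt_transversal:
  fixes N :: "('b::{t2_space,second_countable_topology}, 'e::euclidean_space) riem"
  assumes N: "riemannian_manifold N" and M: "riemannian_manifold (line_product N D)"
    and v: "v \<in> transversal_space (line_product N D) (d_dt N) p"
  shows "v fst = 0"
proof -
  note atlas = riemannian_atlas[OF N] riemannian_atlas[OF M, simplified]
  have "pushforward (charts N) snd p v \<in> tspace N (snd p)"
    by (rule pushforward_tangent[OF atlas(2,1) smooth_map_snd[OF atlas]]) (use v in \<open>simp add: transversal_space_def\<close>)
  then have "metric N (snd p) (pushforward (charts N) snd p v) (\<lambda>f. 0) = 0"
    by (rule metric_zero_right[OF N])
  then show ?thesis
    using v by (simp add: transversal_space_def d_dt_vertical d_dt_fst[OF atlas])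
qed

text \<open>On Q the dt term of the product metric vanishes by \<open>d_dt_transversal\<close>, and
  what remains is the metric of N on the projections.\<close>

lemma line_basic_flow:
  fixes N :: "('b::{t2_space,second_countable_topology}, 'e::euclidean_space) riem"
  assumes N: "riemannian_manifold N" and SN: "spin_structure N SN"
    and M: "riemannian_manifold (line_product N D)"
    and ind: "induced_spin_structure N SN (line_product N D) snd (d_dt N) SM"
  shows "basic_flow N (line_product N D) snd (d_dt N) SN SM"
proof (unfold_locales)
  note atlas = riemannian_atlas[OF N] riemannian_atlas[OF M, simplified]
  show "smooth_map_on (charts (line_product N D)) UNIV (charts N) snd"
    using smooth_map_snd[OF atlas] by simp
qed (use assms d_dt_vertical d_dt_transversal[OF N M] in auto)

locale line_flow = basic_flow N "line_product N D" snd "d_dt N" SN SM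
  for N :: "('b::{t2_space,second_countable_topology}, 'e::euclidean_space) riem"
    and D and SN :: "('i, 'b) spin" and SM :: "('i, real \<times> 'b) spin"
begin

abbreviation "M \<equiv> line_product N D"

lemmas line_atlas = atlas_M[simplified]

text \<open>The operator i \<xi> exchanges the two copies and therefore fixes (u, u).\<close>

lemma cliff_0_diagonal:
  assumes "odd DIM('e)" and u: "u \<in> carrier_vec (spin_dim DIM('e))"
  shows "c 0 *\<^sub>v (u @\<^sub>v u) = - \<i> \<cdot>\<^sub>v (u @\<^sub>v u)"
proof (rule eq_vecI)
  have C: "c 0 \<in> carrier_mat (spin_dim (Suc DIM('e))) (spin_dim (Suc DIM('e)))"
    by (rule cliff_carrier) simp
  have W: "u @\<^sub>v u \<in> carrier_vec (spin_dim (Suc DIM('e)))"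
    using spinor_pair_carrier[OF u u] assms(1) by (simp add: spinor_pair_def)
  have id: "(\<i> \<cdot>\<^sub>m c 0) *\<^sub>v (u @\<^sub>v u) = u @\<^sub>v u"
    using identification assms by (simp add: clifford_identification_def Let_def)
  fix r assume "r < dim_vec (- \<i> \<cdot>\<^sub>v (u @\<^sub>v u))"
  then have r: "r < spin_dim (Suc DIM('e))" using u assms(1) by (simp add: spin_dim_Suc)
  have "((\<i> \<cdot>\<^sub>m c 0) *\<^sub>v (u @\<^sub>v u)) $ r = \<i> * (c 0 *\<^sub>v (u @\<^sub>v u)) $ r"
    unfolding index_mult_mat_vec_sum[OF C W r] index_mult_mat_vec_sum[OF smult_carrier_mat[OF C] W r] sum_distrib_left
    by (intro sum.cong refl) (use C r in simp)
  then have "(u @\<^sub>v u) $ r = \<i> * (c 0 *\<^sub>v (u @\<^sub>v u)) $ r"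
    by (simp only: id)
  then show "(c 0 *\<^sub>v (u @\<^sub>v u)) $ r = (- \<i> \<cdot>\<^sub>v (u @\<^sub>v u)) $ r"
    using carrier_vecD[OF W] r by (simp del: index_append_vec index_mult_mat_vec)
qed (use carrier_matD[OF cliff_carrier[of 0]] u assms(1) in \<open>simp add: spin_dim_Suc\<close>)

context
  fixes \<psi> :: "('i, 'b) spinor"
  assumes \<psi>: "spinor_field N SN \<psi>"
begin

text \<open>With \<open>u\<close> equal to \<open>\<psi>\<close>, respectively to \<open>\<psi> \<oplus> \<psi>\<close>, the induced spinor is
  \<open>cos(\<alpha> t) u + sin(\<alpha> t) \<xi> \<cdot> u\<close> in both parities; if \<open>n\<close> is odd, \<open>\<xi> \<cdot> u = - \<i> u\<close>.\<close>

lemma induced_spinor_alpha_eq: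
  assumes i: "i \<in> index SN" "x \<in> patch SN i"
  shows "induced_spinor_alpha N M SM \<alpha> \<psi> i (t, x) =
    cos (\<alpha> * of_real t) \<cdot>\<^sub>v basic_spinor \<psi> \<psi> i (t, x) + sin (\<alpha> * of_real t) \<cdot>\<^sub>v (c 0 *\<^sub>v basic_spinor \<psi> \<psi> i (t, x))"
proof -
  have exp: "exp (- \<i> * \<alpha> * of_real t) = cos (\<alpha> * of_real t) - \<i> * sin (\<alpha> * of_real t)"
    "exp (\<i> * \<alpha> * of_real t) = cos (\<alpha> * of_real t) + \<i> * sin (\<alpha> * of_real t)"
    using exp_Euler[of "\<alpha> * of_real t"] exp_minus_Euler[of "\<alpha> * of_real t"] by (simp_all add: mult.assoc)
  note C = carrier_matD[OF cliff_carrier[of 0, simplified]]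
  note u = spinor_field_carrier[OF \<psi> i]
  show ?thesis
  proof (cases "even DIM('e)")
    case True
    have clif: "clifford_mult M SM i (t, x) (d_dt N (t, x)) w = c 0 *\<^sub>v w" for w
      by (rule clifford_mult_flow) (use i in auto)
    \<comment> \<open>The sum of the two eigencomponents, entry by entry: a and b stand for cos and
      sin, x and y for entries of u and of \<xi> u.\<close>
    have mix: "(a - \<i> * b) * (x + \<i> * y) / 2 + (a + \<i> * b) * (x - \<i> * y) / 2 = a * x + b * y"
      for a b x y :: complex
      by (simp add: field_simps)
    let ?u = "\<psi> i x"
    have "induced_spinor_alpha N M SM \<alpha> \<psi> i (t, x) =
        exp (- \<i> * \<alpha> * of_real t) \<cdot>\<^sub>v ((1 / 2) \<cdot>\<^sub>v (?u + \<i> \<cdot>\<^sub>v (c 0 *\<^sub>v ?u)))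
        + exp (\<i> * \<alpha> * of_real t) \<cdot>\<^sub>v ((1 / 2) \<cdot>\<^sub>v (?u - \<i> \<cdot>\<^sub>v (c 0 *\<^sub>v ?u)))"
      using True by (simp add: induced_spinor_alpha_def plus_part_def minus_part_def clif Let_def)
    also have "\<dots> = cos (\<alpha> * of_real t) \<cdot>\<^sub>v ?u + sin (\<alpha> * of_real t) \<cdot>\<^sub>v (c 0 *\<^sub>v ?u)"
      unfolding exp using True C carrier_vecD[OF u]
      by (intro eq_vecI) (simp_all add: spin_dim_Suc mix del: index_mult_mat_vec)
    finally show ?thesis
      using True by (simp add: basic_spinor_def spinor_pair_def)
  next
    case False
    have "induced_spinor_alpha N M SM \<alpha> \<psi> i (t, x) = exp (- \<i> * \<alpha> * of_real t) \<cdot>\<^sub>v (\<psi> i x @\<^sub>v \<psi> i x)"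
      using False by (simp add: induced_spinor_alpha_def Let_def)
    also have "\<dots> = cos (\<alpha> * of_real t) \<cdot>\<^sub>v (\<psi> i x @\<^sub>v \<psi> i x) + sin (\<alpha> * of_real t) \<cdot>\<^sub>v (- \<i> \<cdot>\<^sub>v (\<psi> i x @\<^sub>v \<psi> i x))"
      unfolding exp by (intro eq_vecI) (simp_all add: left_diff_distrib mult.assoc mult.left_commute del: index_append_vec)
    finally show ?thesis
      using False cliff_0_diagonal[OF False u] by (simp add: basic_spinor_def spinor_pair_def)
  qed
qed

lemma u_carrier:
  "i \<in> index SN \<Longrightarrow> snd p \<in> patch SN i \<Longrightarrow> basic_spinor \<psi> \<psi> i p \<in> carrier_vec (spin_dim (Suc DIM('e)))"
  by (rule basic_spinor_carrier[OF \<psi> \<psi>])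

lemma cliff_0_carrier: "c 0 \<in> carrier_mat (spin_dim (Suc DIM('e))) (spin_dim (Suc DIM('e)))"
  by (rule cliff_carrier) simp

lemma induced_spinor_alpha_carrier:
  assumes i: "i \<in> index SN" "snd p \<in> patch SN i"
  shows "induced_spinor_alpha N M SM \<alpha> \<psi> i p \<in> carrier_vec (spin_dim (Suc DIM('e)))"
  using induced_spinor_alpha_eq[OF i, of \<alpha> "fst p"] u_carrier[OF i]
    mult_mat_vec_carrier[OF cliff_0_carrier u_carrier[OF i]] by simp

lemma induced_spinor_alpha_index:
  assumes i: "i \<in> index SN" "snd p \<in> patch SN i" and r: "r < spin_dim (Suc DIM('e))"
  shows "induced_spinor_alpha N M SM \<alpha> \<psi> i p $ r = cos (\<alpha> * of_real (fst p)) * basic_spinor \<psi> \<psi> i p $ r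
    + sin (\<alpha> * of_real (fst p)) * (\<Sum>s<spin_dim (Suc DIM('e)). c 0 $$ (r, s) * basic_spinor \<psi> \<psi> i p $ s)"
  using induced_spinor_alpha_eq[OF i, of \<alpha> "fst p"] carrier_vecD[OF u_carrier[OF i]] r
    carrier_matD[OF cliff_0_carrier] index_mult_mat_vec_sum[OF cliff_0_carrier u_carrier[OF i] r]
  by (simp del: index_mult_mat_vec)

text \<open>An endomorphism commuting with \<xi> passes through the rotation. It is applied to the
  spin lifts, to products of two vectors of Q, and to \<xi> itself.\<close>

lemma mult_induced_spinor_alpha:
  assumes i: "i \<in> index SN" "snd p \<in> patch SN i" and r: "r < spin_dim (Suc DIM('e))"
    and A: "A \<in> carrier_mat (spin_dim (Suc DIM('e))) (spin_dim (Suc DIM('e)))" and comm: "c 0 * A = A * c 0"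
  shows "(A *\<^sub>v induced_spinor_alpha N M SM \<alpha> \<psi> i p) $ r =
    cos (\<alpha> * of_real (fst p)) * (A *\<^sub>v basic_spinor \<psi> \<psi> i p) $ r
    + sin (\<alpha> * of_real (fst p)) * (\<Sum>s<spin_dim (Suc DIM('e)). c 0 $$ (r, s) * (A *\<^sub>v basic_spinor \<psi> \<psi> i p) $ s)"
proof -
  let ?u = "basic_spinor \<psi> \<psi> i p"
  note u = u_carrier[OF i]
  note cu = mult_mat_vec_carrier[OF cliff_0_carrier u]
  have "A *\<^sub>v induced_spinor_alpha N M SM \<alpha> \<psi> i p =
      cos (\<alpha> * of_real (fst p)) \<cdot>\<^sub>v (A *\<^sub>v ?u) + sin (\<alpha> * of_real (fst p)) \<cdot>\<^sub>v (A *\<^sub>v (c 0 *\<^sub>v ?u))"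
    using induced_spinor_alpha_eq[OF i, of \<alpha> "fst p"] u cu
    by (simp add: mult_add_distrib_mat_vec[OF A] mult_mat_vec[OF A])
  also have "A *\<^sub>v (c 0 *\<^sub>v ?u) = c 0 *\<^sub>v (A *\<^sub>v ?u)"
    using assoc_mult_mat_vec[OF A cliff_0_carrier u] assoc_mult_mat_vec[OF cliff_0_carrier A u] comm by simp
  finally show ?thesis
    using r carrier_matD[OF A] carrier_matD[OF cliff_0_carrier]
      index_mult_mat_vec_sum[OF cliff_0_carrier mult_mat_vec_carrier[OF A u] r]
    by (simp del: index_mult_mat_vec)
qed

text \<open>Product rule, the matrix \<open>c 0\<close> being constant. The term with
  \<open>v fst\<close> differentiates the rotation; the remaining ones rotate the derivative of
  u.\<close>

lemma cderiv_induced_spinor_alpha: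
  assumes i: "i \<in> index SN" "snd p \<in> patch SN i" and v: "v \<in> tspace M p" and r: "r < spin_dim (Suc DIM('e))"
  shows "cderiv v (\<lambda>q. induced_spinor_alpha N M SM \<alpha> \<psi> i q $ r) =
    \<alpha> * of_real (v fst) * (cos (\<alpha> * of_real (fst p)) * (c 0 *\<^sub>v basic_spinor \<psi> \<psi> i p) $ r
      - sin (\<alpha> * of_real (fst p)) * basic_spinor \<psi> \<psi> i p $ r)
    + cos (\<alpha> * of_real (fst p)) * cderiv v (\<lambda>q. basic_spinor \<psi> \<psi> i q $ r)
    + sin (\<alpha> * of_real (fst p)) * (\<Sum>s<spin_dim (Suc DIM('e)). c 0 $$ (r, s) * cderiv v (\<lambda>q. basic_spinor \<psi> \<psi> i q $ s))"
proof -
  let ?C = "\<lambda>q::real \<times> 'b. cos (\<alpha> * of_real (fst q))" and ?S = "\<lambda>q::real \<times> 'b. sin (\<alpha> * of_real (fst q))"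
  let ?u = "\<lambda>s q. basic_spinor \<psi> \<psi> i q $ s"
  let ?cu = "\<lambda>q. \<Sum>s<spin_dim (Suc DIM('e)). c 0 $$ (r, s) * ?u s q"
  have v': "v \<in> tangent (line_times (charts N)) p" using v by simp
  note rules = cderiv_add[OF line_atlas v'] cderiv_mult[OF line_atlas v'] cgerms_mult[OF line_atlas]
  have C: "?C \<in> cgerms (line_times (charts N)) p" and S: "?S \<in> cgerms (line_times (charts N)) p"
    using cgermsI[OF smooth_cfun_cos_fst[OF atlas_N line_atlas]] cgermsI[OF smooth_cfun_sin_fst[OF atlas_N line_atlas]] by auto
  have u: "?u s \<in> cgerms (line_times (charts N)) p" if "s < spin_dim (Suc DIM('e))" for s
    using cgermsI[OF basic_spinor_smooth[OF \<psi> \<psi> i(1) that], of p] i(2) by simp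
  have cu': "(\<lambda>q. c 0 $$ (r, s) * ?u s q) \<in> cgerms (line_times (charts N)) p"
    "cderiv v (\<lambda>q. c 0 $$ (r, s) * ?u s q) = c 0 $$ (r, s) * cderiv v (?u s)"
    if "s < spin_dim (Suc DIM('e))" for s
    using u[OF that] cgerms_const[OF line_atlas] by (simp_all add: rules cderiv_const[OF line_atlas v'])
  have cu: "?cu \<in> cgerms (line_times (charts N)) p"
    "cderiv v ?cu = (\<Sum>s<spin_dim (Suc DIM('e)). c 0 $$ (r, s) * cderiv v (?u s))"
    by (rule cgerms_sum[OF line_atlas]; use cu' in simp) (subst cderiv_sum[OF line_atlas v']; use cu' in simp)
  have "cderiv v (\<lambda>q. induced_spinor_alpha N M SM \<alpha> \<psi> i q $ r) = cderiv v (\<lambda>q. ?C q * ?u r q + ?S q * ?cu q)"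
    by (rule cderiv_local[OF line_atlas v' open_patch[OF i(1)]]) (use i induced_spinor_alpha_index r in auto)
  also have "\<dots> = cderiv v ?C * ?u r p + ?C p * cderiv v (?u r) + (cderiv v ?S * ?cu p + ?S p * cderiv v ?cu)"
    using C S u[OF r] cu(1) by (simp add: rules)
  also have "?cu p = (c 0 *\<^sub>v basic_spinor \<psi> \<psi> i p) $ r"
    by (rule index_mult_mat_vec_sum[OF cliff_0_carrier u_carrier[OF i] r, symmetric])
  finally show ?thesis
    unfolding cu(2) cderiv_cos_fst[OF atlas_N line_atlas v'] cderiv_sin_fst[OF atlas_N line_atlas v']
    by (simp add: algebra_simps del: index_mult_mat_vec)
qed

lemma induced_spinor_alpha_field: "spinor_field M SM (induced_spinor_alpha N M SM \<alpha> \<psi>)"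
proof -
  have lift: "induced_spinor_alpha N M SM \<alpha> \<psi> i p = spin_lift SM i k p *\<^sub>v induced_spinor_alpha N M SM \<alpha> \<psi> k p"
    if i: "i \<in> index SN" "snd p \<in> patch SN i" and k: "k \<in> index SN" "snd p \<in> patch SN k" for i k p
  proof -
    let ?s = "spin_lift SM i k p"
    have ik: "p \<in> patch SM i \<inter> patch SM k" using i k by (simp add: patch_eq)
    have s: "?s \<in> carrier_mat (spin_dim (Suc DIM('e))) (spin_dim (Suc DIM('e)))"
      and comm: "?s * c 0 = clifford_vec (Suc DIM('e)) c (\<lambda>j. metric M p (frame SM k 0 p) (frame SM i j p)) * ?s"
      using total_spin i(1) k(1) ik spin_group_carrier[of ?s "Suc DIM('e)" c]
      unfolding spin_structure_def index_eq by auto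
    \<comment> \<open>Both frames start with \<xi>, so the lifting condition for index 0 says that
      the lift commutes with \<open>c 0\<close>.\<close>
    have "clifford_vec (Suc DIM('e)) c (\<lambda>j. metric M p (frame SM k 0 p) (frame SM i j p)) = c 0"
      by (rule clifford_vec_unit)
        (use frame_metric[OF i, of 0] frame_0[OF i] frame_0[OF k] cliff_0_carrier in \<open>auto simp del: line_product_simps\<close>)
    then have comm: "c 0 * ?s = ?s * c 0" using comm by simp
    have u: "basic_spinor \<psi> \<psi> i p = ?s *\<^sub>v basic_spinor \<psi> \<psi> k p"
      using basic_spinor_field[OF \<psi> \<psi>] i(1) k(1) ik unfolding spinor_field_def index_eq by blast
    show ?thesis
    proof (rule eq_vecI)
      fix r assume "r < dim_vec (?s *\<^sub>v induced_spinor_alpha N M SM \<alpha> \<psi> k p)"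
      then have r: "r < spin_dim (Suc DIM('e))" using s by simp
      show "induced_spinor_alpha N M SM \<alpha> \<psi> i p $ r = (?s *\<^sub>v induced_spinor_alpha N M SM \<alpha> \<psi> k p) $ r"
        unfolding mult_induced_spinor_alpha[OF k r s comm] induced_spinor_alpha_index[OF i r] u ..
    qed (use s carrier_vecD[OF induced_spinor_alpha_carrier[OF i]] in simp)
  qed
  have smooth: "smooth_cfun (line_times (charts N)) (snd -` patch SN i) (\<lambda>p. induced_spinor_alpha N M SM \<alpha> \<psi> i p $ r)"
    if i: "i \<in> index SN" and r: "r < spin_dim (Suc DIM('e))" for i r
  proof (rule smooth_cfun_cong[OF line_atlas])
    let ?U = "snd -` patch SN i :: (real \<times> 'b) set"
    have o: "open ?U" using open_patch[OF i] .
    have restrict: "smooth_cfun (line_times (charts N)) ?U f" if "smooth_cfun (line_times (charts N)) UNIV f" for f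
      using that o by (auto simp: smooth_cfun_def intro: smooth_fun_subset)
    note u = basic_spinor_smooth[OF \<psi> \<psi> i, simplified]
    show "smooth_cfun (line_times (charts N)) ?U (\<lambda>p. cos (\<alpha> * of_real (fst p)) * basic_spinor \<psi> \<psi> i p $ r
        + sin (\<alpha> * of_real (fst p)) * (\<Sum>s<spin_dim (Suc DIM('e)). c 0 $$ (r, s) * basic_spinor \<psi> \<psi> i p $ s))"
      by (intro smooth_cfun_add[OF line_atlas] smooth_cfun_mult[OF line_atlas] smooth_cfun_sum[OF _ line_atlas o]
          smooth_cfun_const[OF line_atlas o] restrict[OF smooth_cfun_cos_fst[OF atlas_N line_atlas]]
          restrict[OF smooth_cfun_sin_fst[OF atlas_N line_atlas]] u r) auto
  qed (use i r induced_spinor_alpha_index in auto)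
  show ?thesis
    unfolding spinor_field_def index_eq dim_total
    by (intro conjI ballI allI impI) (auto simp: patch_eq intro: induced_spinor_alpha_carrier smooth lift)
qed

text \<open>Differentiating the rotation in t gives \<alpha> (cos(\<alpha> t) \<xi> u - sin(\<alpha>
  t) u), which is \<alpha> times \<xi> applied to the rotated spinor, as \<xi> \<xi> = -1. Along Q
  the rotation is constant and commutes with the even products in the connection, so the derivative
  is the rotated derivative of u, hence zero.\<close>

lemma induced_spinor_alpha_killing:
  assumes killing: "killing_spinor N SN 0 \<psi>"
  shows "transversal_killing_spinor M SM (d_dt N) \<alpha> 0 (induced_spinor_alpha N M SM \<alpha> \<psi>)"
proof -
  let ?\<phi> = "induced_spinor_alpha N M SM \<alpha> \<psi>"
  let ?u = "basic_spinor \<psi> \<psi>"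
  have xi: "transversal_conn_xi M SM (d_dt N) i p ?\<phi> = \<alpha> \<cdot>\<^sub>v clifford_mult M SM i p (d_dt N p) (?\<phi> i p)"
    if i: "i \<in> index SN" "snd p \<in> patch SN i" for i p
  proof (rule eq_vecI)
    fix r assume "r < dim_vec (\<alpha> \<cdot>\<^sub>v clifford_mult M SM i p (d_dt N p) (?\<phi> i p))"
    then have r: "r < spin_dim (Suc DIM('e))" by simp
    have flat: "cderiv (d_dt N p) (\<lambda>q. ?u i q $ s) = 0" if s: "s < spin_dim (Suc DIM('e))" for s
      using transversal_conn_xi_basic[OF \<psi> \<psi> i] transversal_conn_xi_index[where \<phi> = ?u, OF i u_carrier[OF i] s] s by simp
    have "transversal_conn_xi M SM (d_dt N) i p ?\<phi> $ r = \<alpha> * (cos (\<alpha> * of_real (fst p)) * (c 0 *\<^sub>v ?u i p) $ r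
        - sin (\<alpha> * of_real (fst p)) * ?u i p $ r)"
      unfolding transversal_conn_xi_index[where \<phi> = ?\<phi>, OF i induced_spinor_alpha_carrier[OF i] r]
        cderiv_induced_spinor_alpha[OF i flow_tangent r]
      using d_dt_fst[OF atlas_N line_atlas] flat r by simp
    also have "cos (\<alpha> * of_real (fst p)) * (c 0 *\<^sub>v ?u i p) $ r - sin (\<alpha> * of_real (fst p)) * ?u i p $ r =
        (c 0 *\<^sub>v ?\<phi> i p) $ r"
      unfolding mult_induced_spinor_alpha[OF i r cliff_0_carrier refl]
      using cliff_0_square_vec[OF u_carrier[OF i]] r carrier_vecD[OF u_carrier[OF i]]
        index_mult_mat_vec_sum[OF cliff_0_carrier mult_mat_vec_carrier[OF cliff_0_carrier u_carrier[OF i]] r, symmetric]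
      by (simp del: index_mult_mat_vec)
    finally show "transversal_conn_xi M SM (d_dt N) i p ?\<phi> $ r = (\<alpha> \<cdot>\<^sub>v clifford_mult M SM i p (d_dt N p) (?\<phi> i p)) $ r"
      using r carrier_matD[OF cliff_0_carrier] by (simp add: clifford_mult_flow[OF i] del: index_mult_mat_vec)
  qed simp
  have Q: "transversal_conn_Q M SM (d_dt N) i p v ?\<phi> =
      0 \<cdot>\<^sub>v clifford_mult M SM i p (d_dt N p) (clifford_mult M SM i p v (?\<phi> i p))"
    if i: "i \<in> index SN" "snd p \<in> patch SN i" and v: "v \<in> transversal_space M (d_dt N) p" for i p v
  proof (rule eq_vecI)
    fix r assume "r < dim_vec (0 \<cdot>\<^sub>v clifford_mult M SM i p (d_dt N p) (clifford_mult M SM i p v (?\<phi> i p)))"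
    then have r: "r < spin_dim (Suc DIM('e))" by simp
    let ?C = "cos (\<alpha> * of_real (fst p))" and ?S = "sin (\<alpha> * of_real (fst p))"
    let ?a = "\<lambda>j k. complex_of_real (metric N (snd p) (conn N (snd p) (push p v) (frame SN i j)) (frame SN i k (snd p)))"
    let ?G = "\<lambda>w r. 1 / 4 * (\<Sum>j<DIM('e). \<Sum>k<DIM('e). ?a j k * ((c (Suc j) * c (Suc k)) *\<^sub>v w) $ r)"
    \<comment> \<open>For \<beta> = 0 the spinor is parallel on N, so both copies in (\<psi>,
      \<psi>) are parallel along Q.\<close>
    have "spin_conn N SN i (snd p) (push p v) \<psi> = 0\<^sub>v (spin_dim DIM('e))"
      using killing i push_tangent[OF transversal_tangent[OF v]] base_spin
      by (intro eq_vecI) (auto simp: killing_spinor_def clifford_mult_def carrier_matD[OF clifford_vec_carrier] dim_spin_conn_eq)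
    then have "transversal_conn_Q M SM (d_dt N) i p v ?u = 0\<^sub>v (spin_dim (Suc DIM('e)))"
      unfolding transversal_conn_Q_basic[OF \<psi> \<psi> i v]
      by (intro eq_vecI) (auto simp: spinor_pair_def spin_dim_Suc)
    then have flat: "cderiv v (\<lambda>q. ?u i q $ s) + ?G (?u i p) s = 0" if "s < spin_dim (Suc DIM('e))" for s
      using transversal_conn_Q_index[where \<phi> = ?u, OF i v u_carrier[OF i] that] that by simp
    \<comment> \<open>The connection term of the rotated spinor is the rotated connection term, by
      commutation with \<open>c 0\<close>.\<close>
    have G: "?G (?\<phi> i p) r = ?C * ?G (?u i p) r + ?S * (\<Sum>s<spin_dim (Suc DIM('e)). c 0 $$ (r, s) * ?G (?u i p) s)"
    proof -
      have "?G (?\<phi> i p) r = 1 / 4 * (\<Sum>j<DIM('e). \<Sum>k<DIM('e). ?a j k * (?C * ((c (Suc j) * c (Suc k)) *\<^sub>v ?u i p) $ r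
          + ?S * (\<Sum>s<spin_dim (Suc DIM('e)). c 0 $$ (r, s) * ((c (Suc j) * c (Suc k)) *\<^sub>v ?u i p) $ s)))"
        by (intro arg_cong2[where f = "(*)"] refl sum.cong mult_induced_spinor_alpha[OF i r cliff_mult_carrier cliff_0_commute]) auto
      also have "\<dots> = ?C * ?G (?u i p) r + ?S * (1 / 4 * (\<Sum>j<DIM('e). \<Sum>k<DIM('e). \<Sum>s<spin_dim (Suc DIM('e)).
          c 0 $$ (r, s) * (?a j k * ((c (Suc j) * c (Suc k)) *\<^sub>v ?u i p) $ s)))"
        by (simp add: sum_distrib_left sum.distrib algebra_simps del: index_mult_mat_vec)
      also have "(\<Sum>j<DIM('e). \<Sum>k<DIM('e). \<Sum>s<spin_dim (Suc DIM('e)).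
          c 0 $$ (r, s) * (?a j k * ((c (Suc j) * c (Suc k)) *\<^sub>v ?u i p) $ s)) =
          (\<Sum>s<spin_dim (Suc DIM('e)). \<Sum>j<DIM('e). \<Sum>k<DIM('e).
          c 0 $$ (r, s) * (?a j k * ((c (Suc j) * c (Suc k)) *\<^sub>v ?u i p) $ s))"
        by (subst sum.swap[of _ _ "{..<spin_dim (Suc DIM('e))}"], subst sum.swap[of _ _ "{..<spin_dim (Suc DIM('e))}"]) (rule refl)
      finally show ?thesis
        by (simp add: sum_distrib_left algebra_simps del: index_mult_mat_vec)
    qed
    have "transversal_conn_Q M SM (d_dt N) i p v ?\<phi> $ r = ?C * (cderiv v (\<lambda>q. ?u i q $ r) + ?G (?u i p) r)
        + ?S * (\<Sum>s<spin_dim (Suc DIM('e)). c 0 $$ (r, s) * (cderiv v (\<lambda>q. ?u i q $ s) + ?G (?u i p) s))"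
      unfolding transversal_conn_Q_index[where \<phi> = ?\<phi>, OF i v induced_spinor_alpha_carrier[OF i] r] G
        cderiv_induced_spinor_alpha[OF i transversal_tangent[OF v] r] d_dt_transversal[OF base total v]
      by (simp add: distrib_left sum.distrib del: index_mult_mat_vec)
    also have "\<dots> = 0"
      using flat r by (subst sum.neutral) (auto simp del: index_mult_mat_vec)
    finally show "transversal_conn_Q M SM (d_dt N) i p v ?\<phi> $ r =
        (0 \<cdot>\<^sub>v clifford_mult M SM i p (d_dt N p) (clifford_mult M SM i p v (?\<phi> i p))) $ r"
      using r by simp
  qed simp
  show ?thesis
    unfolding transversal_killing_spinor_def index_eq
    using riemannian_flow induced_spinor_alpha_field xi Q by (auto simp: patch_eq)
qed

text \<open>A shift in t only changes the angle of the rotation. In the forward direction u and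
  \<xi> u may be linearly dependent, so the relation at one point is used together with its image
  under \<xi>, as a linear system for one entry of u and of \<xi> u.\<close>

lemma descends_induced_spinor_alpha:
  fixes \<alpha> L :: real and \<delta> :: nat
  assumes nonzero: "nonzero_spinor SN \<psi>" and L: "L > 0" and \<delta>: "\<delta> \<in> {0, 1}"
  shows "descends SN L \<delta> (induced_spinor_alpha N M SM (of_real \<alpha>) \<psi>) \<longleftrightarrow>
    (\<exists>k::int. \<alpha> = pi * real \<delta> / L + 2 * pi * of_int k / L)"
proof -
  let ?\<phi> = "induced_spinor_alpha N M SM (of_real \<alpha>) \<psi>"
  \<comment> \<open>As \<delta> is 0 or 1, the factor exp(i pi \<delta>) is this real sign.\<close>
  let ?\<epsilon> = "(- 1) ^ \<delta> :: real"
  have \<epsilon>: "exp (\<i> * of_real pi * of_nat \<delta>) = complex_of_real ?\<epsilon>"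
    using \<delta> by auto
  have \<phi>: "?\<phi> i (t, x) = of_real (cos (\<alpha> * t)) \<cdot>\<^sub>v basic_spinor \<psi> \<psi> i (0, x)
      + of_real (sin (\<alpha> * t)) \<cdot>\<^sub>v (c 0 *\<^sub>v basic_spinor \<psi> \<psi> i (0, x))"
    if "i \<in> index SN" "x \<in> patch SN i" for i t x
  proof -
    have "basic_spinor \<psi> \<psi> i (t, x) = basic_spinor \<psi> \<psi> i (0, x)" by (simp add: basic_spinor_def)
    then show ?thesis
      using induced_spinor_alpha_eq[OF that, of "of_real \<alpha>" t] by (simp add: cos_of_real sin_of_real flip: of_real_mult)
  qed
  have "descends SN L \<delta> ?\<phi> \<longleftrightarrow> cos (\<alpha> * L) = ?\<epsilon>"
  proof
    assume desc: "descends SN L \<delta> ?\<phi>"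
    obtain i x where i: "i \<in> index SN" "x \<in> patch SN i" and "\<psi> i x \<noteq> 0\<^sub>v (dim_vec (\<psi> i x))"
      using nonzero by (auto simp: nonzero_spinor_def)
    then obtain r where r: "r < spin_dim DIM('e)" "\<psi> i x $ r \<noteq> 0"
      using carrier_vecD[OF spinor_field_carrier[OF \<psi> i]] by (metis eq_vecI index_zero_vec)
    have r': "r < spin_dim (Suc DIM('e))" using r(1) by (auto simp: spin_dim_Suc)
    let ?u = "basic_spinor \<psi> \<psi> i (0, x)"
    let ?C = "complex_of_real (cos (\<alpha> * L))" and ?S = "complex_of_real (sin (\<alpha> * L))"
    have u: "?u \<in> carrier_vec (spin_dim (Suc DIM('e)))"
      using u_carrier i by simp
    note cu = mult_mat_vec_carrier[OF cliff_0_carrier u]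
    have ur: "?u $ r \<noteq> 0"
      using basic_spinor_index[OF \<psi> \<psi> i(1) _ r', of "(0, x)"] i(2) r by simp
    \<comment> \<open>At t = L the shifted argument is 0, where the rotation is the
      identity.\<close>
    have "?\<phi> i (L, x) = of_real ?\<epsilon> \<cdot>\<^sub>v ?\<phi> i (L - L, x)"
      using desc i unfolding descends_def \<epsilon> by blast
    also have "?\<phi> i (L - L, x) = ?u"
      unfolding \<phi>[OF i] using carrier_vecD[OF u] carrier_matD[OF cliff_0_carrier]
      by (intro eq_vecI) (simp_all del: index_mult_mat_vec)
    finally have 1: "?C \<cdot>\<^sub>v ?u + ?S \<cdot>\<^sub>v (c 0 *\<^sub>v ?u) = of_real ?\<epsilon> \<cdot>\<^sub>v ?u"
      unfolding \<phi>[OF i] .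
    \<comment> \<open>The second equation of the system: the image of the first under \<xi>,
      simplified by \<xi> \<xi> = -1.\<close>
    have "c 0 *\<^sub>v (?C \<cdot>\<^sub>v ?u + ?S \<cdot>\<^sub>v (c 0 *\<^sub>v ?u)) = c 0 *\<^sub>v (of_real ?\<epsilon> \<cdot>\<^sub>v ?u)"
      by (simp only: 1)
    then have 2: "?C \<cdot>\<^sub>v (c 0 *\<^sub>v ?u) + ?S \<cdot>\<^sub>v (- ?u) = of_real ?\<epsilon> \<cdot>\<^sub>v (c 0 *\<^sub>v ?u)"
      using u cu by (simp add: mult_add_distrib_mat_vec[OF cliff_0_carrier] mult_mat_vec[OF cliff_0_carrier]
          cliff_0_square_vec[OF u] del: of_real_power)
    let ?y = "(c 0 *\<^sub>v ?u) $ r"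
    have "?C * ?u $ r + ?S * ?y = of_real ?\<epsilon> * ?u $ r"
      using arg_cong[OF 1, of "\<lambda>w. w $ r"] carrier_vecD[OF u] carrier_vecD[OF cu] r'
      by (simp del: index_mult_mat_vec dim_mult_mat_vec of_real_power)
    moreover have "?C * ?y + ?S * - (?u $ r) = of_real ?\<epsilon> * ?y"
      using arg_cong[OF 2, of "\<lambda>w. w $ r"] carrier_vecD[OF u] carrier_vecD[OF cu] r'
      by (simp del: index_mult_mat_vec dim_mult_mat_vec of_real_power)
    \<comment> \<open>Elimination of y: the determinant of the system annihilates x.\<close>
    moreover have "((e - a)\<^sup>2 + b\<^sup>2) * x = 0" if "a * x + b * y = e * x" "a * y + b * - x = e * y"
      for a b e x y :: complex
    proof -
      have "(e - a) * x = b * y" "(e - a) * y = - (b * x)"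
        using that by (simp_all add: left_diff_distrib add.commute diff_eq_eq)
      moreover have "((e - a)\<^sup>2 + b\<^sup>2) * x = (e - a) * ((e - a) * x) + b * (b * x)"
        "(e - a) * (b * y) = b * ((e - a) * y)"
        by (simp_all add: power2_eq_square algebra_simps)
      ultimately show ?thesis by simp
    qed
    ultimately have "((of_real ?\<epsilon> - ?C)\<^sup>2 + ?S\<^sup>2) * ?u $ r = 0"
      by blast
    \<comment> \<open>For real \<alpha> the determinant is a sum of two real squares, so its
      vanishing forces cos(\<alpha> L) to be the sign.\<close>
    then have "complex_of_real ((?\<epsilon> - cos (\<alpha> * L))\<^sup>2 + (sin (\<alpha> * L))\<^sup>2) = 0"
      using ur by simp
    then have "(?\<epsilon> - cos (\<alpha> * L))\<^sup>2 + (sin (\<alpha> * L))\<^sup>2 = 0"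
      by (simp only: of_real_eq_0_iff)
    then show "cos (\<alpha> * L) = ?\<epsilon>"
      by (simp add: sum_power2_eq_zero_iff)
  next
    assume cos: "cos (\<alpha> * L) = ?\<epsilon>"
    then have sin: "sin (\<alpha> * L) = 0"
      using sin_cos_squared_add[of "\<alpha> * L"] by (simp add: power_mult[symmetric] mult.commute[of _ 2])
    have shift: "cos (\<alpha> * t) = ?\<epsilon> * cos (\<alpha> * (t - L))" "sin (\<alpha> * t) = ?\<epsilon> * sin (\<alpha> * (t - L))" for t
      using cos_add[of "\<alpha> * (t - L)" "\<alpha> * L"] sin_add[of "\<alpha> * (t - L)" "\<alpha> * L"]
      by (simp_all add: cos sin right_diff_distrib)
    show "descends SN L \<delta> ?\<phi>"
      unfolding descends_def \<epsilon>
    proof (intro ballI allI)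
      fix i x t assume i: "i \<in> index SN" "x \<in> patch SN i"
      show "?\<phi> i (t, x) = of_real ?\<epsilon> \<cdot>\<^sub>v ?\<phi> i (t - L, x)"
        unfolding \<phi>[OF i] shift[of t]
        by (intro eq_vecI) (simp_all add: distrib_left mult.assoc carrier_matD[OF cliff_0_carrier]
            carrier_vecD[OF u_carrier[OF i(1)]] i(2) del: index_mult_mat_vec of_real_power)
    qed
  qed
  \<comment> \<open>Subtracting pi \<delta> multiplies the cosine by the sign, which reduces both
    spin structures to the equation cos = 1.\<close>
  also have "\<dots> \<longleftrightarrow> cos (\<alpha> * L - pi * real \<delta>) = 1"
    using \<delta> by (auto simp: cos_diff)
  also have "\<dots> \<longleftrightarrow> (\<exists>k::int. \<alpha> * L - pi * real \<delta> = of_int k * 2 * pi)"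
    by (rule cos_one_2pi_int)
  also have "\<dots> \<longleftrightarrow> (\<exists>k::int. \<alpha> = pi * real \<delta> / L + 2 * pi * of_int k / L)"
    using L by (intro ex_cong1) (auto simp: field_simps)
  finally show ?thesis .
qed

end

end

section \<open>Circle bundles: vertical vectors and the unit fibre field\<close>

text \<open>\<open>riemannian_submersion\<close> speaks of orthogonality to all vertical vectors,
  \<open>transversal_space\<close> of orthogonality to \<xi>. The two agree: the transversal frame
  vectors project to an orthonormal frame of N, so a vector in the kernel has no component along
  them and is a multiple of \<xi>.\<close>

lemma vertical_orthogonal:
  fixes N :: "('b::{t2_space,second_countable_topology}, 'e::euclidean_space) riem"
    and M :: "('a::{t2_space,second_countable_topology}, real \<times> 'e) riem"
  assumes N: "riemannian_manifold N" and M: "riemannian_manifold M" and SN: "spin_structure N SN"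
    and ind: "induced_spin_structure N SN M \<pi> \<xi> SM"
    and vert: "pushforward (charts N) \<pi> p (\<xi> p) = (\<lambda>f. 0)"
    and u: "u \<in> tspace M p" "pushforward (charts N) \<pi> p u = (\<lambda>f. 0)"
    and v: "v \<in> transversal_space M \<xi> p"
  shows "metric M p u v = 0"
proof -
  have "\<pi> p \<in> (\<Union>i\<in>index SN. patch SN i)"
    using SN by (simp add: spin_structure_def)
  then obtain i where i: "i \<in> index SN" "\<pi> p \<in> patch SN i" by blast
  let ?e = "\<lambda>j. frame SM i j p" and ?f = "\<lambda>j. frame SN i j (\<pi> p)"
  have "orthonormal_frame M (patch SM i) (frame SM i)" "p \<in> patch SM i"
    using ind i by (auto simp: induced_spin_structure_def spin_structure_def)
  then have exp: "u = (\<lambda>f. \<Sum>j<Suc DIM('e). metric M p u (?e j) * ?e j f)"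
    and \<xi>: "?e 0 \<in> tspace M p"
    using orthonormal_expansion[OF M, of "patch SM i" "frame SM i" p u] u(1)
    by (simp_all add: orthonormal_frame_def smooth_vfield_def)
  have e: "?e 0 = \<xi> p" "pushforward (charts N) \<pi> p (?e (Suc j)) = ?f j" if "j < DIM('e)" for j
    using ind i that by (auto simp: induced_spin_structure_def)
  have e0: "?e 0 = \<xi> p" using ind i by (simp add: induced_spin_structure_def)
  have f: "orthonormal_frame N (patch SN i) (frame SN i)"
    using SN i by (auto simp: spin_structure_def)
  then have ft: "?f j \<in> tspace N (\<pi> p)" if "j < DIM('e)" for j
    using i that by (auto simp: orthonormal_frame_def smooth_vfield_def)
  have "(\<lambda>f. 0) = pushforward (charts N) \<pi> p (\<lambda>f. \<Sum>j<Suc DIM('e). metric M p u (?e j) * ?e j f)"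
    using u(2) exp by simp
  also have "\<dots> = (\<lambda>f. \<Sum>j<DIM('e). metric M p u (?e (Suc j)) * ?f j f)"
    unfolding pushforward_sum using e e0 vert
    by (intro ext) (simp add: sum.lessThan_Suc_shift del: sum.lessThan_Suc)
  finally have 0: "(\<lambda>f. \<Sum>j<DIM('e). metric M p u (?e (Suc j)) * ?f j f) = (\<lambda>f. 0)" ..
  have "metric M p u (?e (Suc k)) = 0" if k: "k < DIM('e)" for k
  proof -
    have "0 = metric N (\<pi> p) (\<lambda>f. \<Sum>j<DIM('e). metric M p u (?e (Suc j)) * ?f j f) (?f k)"
      unfolding 0 using metric_zero_left[OF N ft[OF k]] by simp
    also have "\<dots> = (\<Sum>j<DIM('e). metric M p u (?e (Suc j)) * metric N (\<pi> p) (?f j) (?f k))"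
      by (rule metric_sum_left[OF N]) (use ft k in auto)
    also have "\<dots> = (\<Sum>j<DIM('e). if j = k then metric M p u (?e (Suc j)) else 0)"
      using f i k by (intro sum.cong) (auto simp: orthonormal_frame_def)
    finally show ?thesis using k by simp
  qed
  \<comment> \<open>The zero summand gives the two-term shape of
    \<open>metric_comb_left\<close>.\<close>
  then have "u = (\<lambda>f. metric M p u (\<xi> p) * \<xi> p f + 0 * \<xi> p f)"
    using exp e0 unfolding sum.lessThan_Suc_shift by simp
  then have "metric M p u v = metric M p u (\<xi> p) * metric M p (\<xi> p) v"
    using metric_comb_left[OF M, of "\<xi> p" p "\<xi> p" v "metric M p u (\<xi> p)" 0] \<xi> e0 v
    by (simp add: transversal_space_def)
  moreover have "metric M p (\<xi> p) v = 0"
    using v \<xi> e0 metric_sym[OF M, of "\<xi> p" p v] by (simp add: transversal_space_def)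
  ultimately show ?thesis by simp
qed

text \<open>The action preserves the fibres, so f o \<pi> is constant along the orbit of p and its
  derivative is zero, whatever the normalization.\<close>

lemma unit_fibre_field_vertical:
  assumes "principal_circle_bundle M N \<pi> act"
  shows "pushforward (charts N) \<pi> p (unit_fibre_field M act p) = (\<lambda>f. 0)"
proof -
  have "\<pi> (act \<theta> p) = \<pi> p" for \<theta>
    using assms unfolding principal_circle_bundle_def by metis
  then show ?thesis
    by (auto simp: pushforward_def unit_fibre_field_def fundamental_field_def Let_def fun_eq_iff)
qed

lemma circle_bundle_basic_flow:
  fixes N :: "('b::{t2_space,second_countable_topology}, 'e::euclidean_space) riem"
    and M :: "('a::{t2_space,second_countable_topology}, real \<times> 'e) riem"
  assumes N: "riemannian_manifold N" and M: "riemannian_manifold M" and SN: "spin_structure N SN"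
    and sub: "riemannian_submersion M N \<pi>" and circle: "principal_circle_bundle M N \<pi> act"
    and ind: "induced_spin_structure N SN M \<pi> (unit_fibre_field M act) SM"
  shows "basic_flow N M \<pi> (unit_fibre_field M act) SN SM"
proof (unfold_locales)
  note vert = unit_fibre_field_vertical[OF circle]
  show "smooth_map_on (charts M) UNIV (charts N) \<pi>"
    using sub by (simp add: riemannian_submersion_def)
  fix p v w
  assume v: "v \<in> transversal_space M (unit_fibre_field M act) p"
    and w: "w \<in> transversal_space M (unit_fibre_field M act) p"
  have "metric M p u v = 0 \<and> metric M p u w = 0"
    if "u \<in> tspace M p" "pushforward (charts N) \<pi> p u = (\<lambda>f. 0)" for u
    using vertical_orthogonal[OF N M SN ind vert that v] vertical_orthogonal[OF N M SN ind vert that w] by simp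
  then show "metric M p v w = metric N (\<pi> p) (pushforward (charts N) \<pi> p v) (pushforward (charts N) \<pi> p w)"
    using sub v w unfolding riemannian_submersion_def transversal_space_def by blast
qed (use assms unit_fibre_field_vertical[OF circle] in auto)

theorem proposition3p6:
  fixes N :: "('b::{t2_space,second_countable_topology}, 'e::euclidean_space) riem"
    and SN :: "('i, 'b) spin" and \<beta> :: complex and \<psi> :: "('i, 'b) spinor"
  assumes "riemannian_manifold N" and "spin_structure N SN" and "killing_spinor N SN \<beta> \<psi>"
  shows
    "(\<forall>(M :: ('m::{t2_space,second_countable_topology}, real \<times> 'e) riem) \<pi> act SM.
        riemannian_manifold M \<and> riemannian_submersion M N \<pi> \<and>
        principal_circle_bundle M N \<pi> act \<and> totally_geodesic_fibres M N \<pi> \<and>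
        induced_spin_structure N SN M \<pi> (unit_fibre_field M act) SM \<longrightarrow>
        transversal_killing_spinor M SM (unit_fibre_field M act) 0 \<beta> (induced_spinor N \<pi> \<psi>))
     \<and>
     (\<forall>D SM. let M = line_product N D in
        riemannian_manifold M \<and> induced_spin_structure N SN M snd (d_dt N) SM \<longrightarrow>
        transversal_killing_spinor M SM (d_dt N) 0 \<beta> (induced_spinor N snd \<psi>) \<and>
        (\<beta> = 0 \<longrightarrow>
          (\<forall>\<alpha>. transversal_killing_spinor M SM (d_dt N) \<alpha> 0 (induced_spinor_alpha N M SM \<alpha> \<psi>)) \<and>
          (nonzero_spinor SN \<psi> \<longrightarrow>
            (\<forall>\<alpha>::real. \<forall>L>0. \<forall>\<delta>\<in>{0,1::nat}.
               descends SN L \<delta> (induced_spinor_alpha N M SM (of_real \<alpha>) \<psi>) \<longleftrightarrow>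
               (\<exists>k::int. \<alpha> = pi * real \<delta> / L + 2 * pi * of_int k / L)))))"
proof (intro conjI allI, intro impI)
  fix M :: "('m, real \<times> 'e) riem" and \<pi> act SM
  assume "riemannian_manifold M \<and> riemannian_submersion M N \<pi> \<and>
    principal_circle_bundle M N \<pi> act \<and> totally_geodesic_fibres M N \<pi> \<and>
    induced_spin_structure N SN M \<pi> (unit_fibre_field M act) SM"
  then show "transversal_killing_spinor M SM (unit_fibre_field M act) 0 \<beta> (induced_spinor N \<pi> \<psi>)"
    using assms by (intro basic_flow.induced_spinor_killing circle_bundle_basic_flow) auto
next
  fix D SM
  have \<psi>: "spinor_field N SN \<psi>" using assms(3) by (simp add: killing_spinor_def)
  show "let M = line_product N D in
      riemannian_manifold M \<and> induced_spin_structure N SN M snd (d_dt N) SM \<longrightarrow>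
      transversal_killing_spinor M SM (d_dt N) 0 \<beta> (induced_spinor N snd \<psi>) \<and>
      (\<beta> = 0 \<longrightarrow>
        (\<forall>\<alpha>. transversal_killing_spinor M SM (d_dt N) \<alpha> 0 (induced_spinor_alpha N M SM \<alpha> \<psi>)) \<and>
        (nonzero_spinor SN \<psi> \<longrightarrow>
          (\<forall>\<alpha>::real. \<forall>L>0. \<forall>\<delta>\<in>{0,1::nat}.
             descends SN L \<delta> (induced_spinor_alpha N M SM (of_real \<alpha>) \<psi>) \<longleftrightarrow>
             (\<exists>k::int. \<alpha> = pi * real \<delta> / L + 2 * pi * of_int k / L))))"
    unfolding Let_def
  proof (rule impI, elim conjE)
    assume "riemannian_manifold (line_product N D)"
      and "induced_spin_structure N SN (line_product N D) snd (d_dt N) SM"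
    then interpret line_flow N D SN SM
      using assms by (intro line_flow.intro line_basic_flow)
    show "transversal_killing_spinor M SM (d_dt N) 0 \<beta> (induced_spinor N snd \<psi>) \<and>
      (\<beta> = 0 \<longrightarrow>
        (\<forall>\<alpha>. transversal_killing_spinor M SM (d_dt N) \<alpha> 0 (induced_spinor_alpha N M SM \<alpha> \<psi>)) \<and>
        (nonzero_spinor SN \<psi> \<longrightarrow>
          (\<forall>\<alpha>::real. \<forall>L>0. \<forall>\<delta>\<in>{0,1::nat}.
             descends SN L \<delta> (induced_spinor_alpha N M SM (of_real \<alpha>) \<psi>) \<longleftrightarrow>
             (\<exists>k::int. \<alpha> = pi * real \<delta> / L + 2 * pi * of_int k / L))))"
      using assms(3) induced_spinor_killing induced_spinor_alpha_killing[OF \<psi>] descends_induced_spinor_alpha[OF \<psi>]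
      by blast
  qed
qed

end
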